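(* Let $\mathcal{T}_e \subset \mathbb{R}^2$ be the (interior of the) equilateral triangle with sides of length $1$. Then the Extended Courant Property for $\mathcal{T}_e$ with the Dirichlet boundary condition on $\partial \mathcal{T}_e$ is false; that is, there exist an integer $m \ge 1$ and a linear combination $v$ of Dirichlet eigenfunctions of $-\Delta$ in $\mathcal{T}_e$ associated with eigenvalues less than or equal to $\lambda_m$ such that $\beta_0(v) > \kappa(\lambda_m)$.
   Context: Let $\Omega$ be a bounded domain, with a self-adjoint realization of $-\Delta$ given by a homogeneous boundary condition $\mathfrak{b}$ (here $\mathfrak{b}=\mathfrak{d}$, the Dirichlet condition $u|_{\partial\Omega}=0$). Its eigenvalues are listed in nondecreasing order, counted with multiplicity and starting with index $1$: $\lambda_1 < \lambda_2 \le \lambda_3 \le \cdots$. For an eigenvalue $\lambda$, set $\kappa(\lambda) = \min\{k \mid \lambda_k = \lambda\}$. For $\lambda \ge 0$, let $\mathcal{L}(\Omega,\mathfrak{b},\lambda)$ be the real vector space of linear combinations of real eigenfunctions associated with eigenvalues $\le \lambda$. For a real continuous function $v$ on $\Omega$, the nodal set is $\mathcal{Z}(v) = \overline{\{x \in \Omega \mid v(x) = 0\}}$, and $\beta_0(v)$ denotes the number of connected components of $\Omega \setminus \mathcal{Z}(v)$ (nodal domains). The Extended Courant Property $\mathrm{ECP}(\Omega,\mathfrak{b})$ is the assertion: for every $m \ge 1$ and every $v \in \mathcal{L}(\Omega,\mathfrak{b},\lambda_m)$, one has $\beta_0(v) \le \kappa(\lambda_m) \le m$. Concretely, one may take $\mathcal{T}_e$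 with vertices $O=(0,0)$, $A=(1,0)$, $B=(\frac12,\frac{\sqrt3}{2})$. *)

theory Defs
  imports "HOL-Analysis.Analysis" "HOL-Library.Function_Algebras" "HOL-Library.Extended_Nat"
begin

text \<open>The library has no \<open>real_vector\<close> instance for function types; this interpretation
  provides linear spans and dimensions of sets of real functions.\<close>

global_interpretation fun_space: vector_space "\<lambda>(c::real) (f::'a \<Rightarrow> real) x. c * f x"
  by unfold_locales (auto simp: fun_eq_iff algebra_simps)

section \<open>The Dirichlet realization of the Laplacian\<close>

definition square_integrable_on :: "('a::euclidean_space \<Rightarrow> 'b::euclidean_space) \<Rightarrow> 'a set \<Rightarrow> bool"
  where "square_integrable_on f \<Omega> \<longleftrightarrow>
    set_borel_measurable lborel \<Omega> f \<and> set_integrable lborel \<Omega> (\<lambda>x. (norm (f x))\<^sup>2)"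

definition test_function :: "'a::euclidean_space set \<Rightarrow> ('a \<Rightarrow> real) \<Rightarrow> ('a \<Rightarrow> 'a) \<Rightarrow> bool"
  where "test_function \<Omega> \<phi> \<psi> \<longleftrightarrow>
    (\<forall>x. GDERIV \<phi> x :> \<psi> x) \<and> continuous_on UNIV \<psi> \<and>
    compact (closure {x. \<phi> x \<noteq> 0}) \<and> closure {x. \<phi> x \<noteq> 0} \<subseteq> \<Omega>"

text \<open>\<open>H10 \<Omega> u g\<close>: the function \<open>u\<close> lies in the Sobolev space of \<open>H\<^sup>1\<close>-functions on \<open>\<Omega>\<close>
  vanishing on the boundary, and \<open>g\<close> is its weak gradient.  The space is the closure of the
  compactly supported \<open>C\<^sup>1\<close> functions in the \<open>H\<^sup>1\<close> norm; starting from compactly supported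
  smooth functions gives the same closure.\<close>

definition H10 :: "'a::euclidean_space set \<Rightarrow> ('a \<Rightarrow> real) \<Rightarrow> ('a \<Rightarrow> 'a) \<Rightarrow> bool"
  where "H10 \<Omega> u g \<longleftrightarrow>
    square_integrable_on u \<Omega> \<and> square_integrable_on g \<Omega> \<and>
    (\<exists>\<phi> \<psi>. (\<forall>n::nat. test_function \<Omega> (\<phi> n) (\<psi> n)) \<and>
      (\<lambda>n. LINT x:\<Omega>|lborel. (\<phi> n x - u x)\<^sup>2) \<longlonglongrightarrow> 0 \<and>
      (\<lambda>n. LINT x:\<Omega>|lborel. (norm (\<psi> n x - g x))\<^sup>2) \<longlonglongrightarrow> 0)"

text \<open>The graph of the self-adjoint operator \<open>-\<Delta>\<close> associated with the closed quadratic form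
  \<open>u \<mapsto> \<integral>\<^sub>\<Omega> \<bar>\<nabla>u\<bar>\<^sup>2\<close> with form domain \<open>H10\<close>: \<open>u\<close> is in the operator domain and \<open>-\<Delta>u = f\<close>.\<close>

definition dirichlet_laplacian :: "'a::euclidean_space set \<Rightarrow> ('a \<Rightarrow> real) \<Rightarrow> ('a \<Rightarrow> real) \<Rightarrow> bool"
  where "dirichlet_laplacian \<Omega> u f \<longleftrightarrow>
    square_integrable_on f \<Omega> \<and>
    (\<exists>g. H10 \<Omega> u g \<and>
      (\<forall>w h. H10 \<Omega> w h \<longrightarrow>
        (LINT x:\<Omega>|lborel. g x \<bullet> h x) = (LINT x:\<Omega>|lborel. f x * w x)))"

text \<open>By interior regularity every eigenfunction agrees almost everywhere with a unique function
  that is continuous on \<open>\<Omega>\<close>; we take this representative, so that nodal sets make sense.  Setting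
  it to \<open>0\<close> outside \<open>\<Omega>\<close> makes it a unique total function, so that the dimensions of
  eigenspaces below are the intended ones.\<close>

definition dirichlet_eigenfunction :: "'a::euclidean_space set \<Rightarrow> real \<Rightarrow> ('a \<Rightarrow> real) \<Rightarrow> bool"
  where "dirichlet_eigenfunction \<Omega> \<mu> u \<longleftrightarrow>
    continuous_on \<Omega> u \<and> (\<forall>x. x \<notin> \<Omega> \<longrightarrow> u x = 0) \<and> (\<exists>x. u x \<noteq> 0) \<and>
    dirichlet_laplacian \<Omega> u (\<lambda>x. \<mu> * u x)"

definition is_dirichlet_eigenvalue :: "'a::euclidean_space set \<Rightarrow> real \<Rightarrow> bool"
  where "is_dirichlet_eigenvalue \<Omega> \<mu> \<longleftrightarrow> (\<exists>u. dirichlet_eigenfunction \<Omega> \<mu> u)"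

definition dirichlet_multiplicity :: "'a::euclidean_space set \<Rightarrow> real \<Rightarrow> nat"
  where "dirichlet_multiplicity \<Omega> \<mu> = fun_space.dim (insert 0 {u. dirichlet_eigenfunction \<Omega> \<mu> u})"

text \<open>The \<open>k\<close>-th entry (\<open>k \<ge> 1\<close>) of the nondecreasing list of eigenvalues repeated according to
  multiplicity is the smallest eigenvalue \<open>\<mu>\<close> such that at least \<open>k\<close> entries are \<open>\<le> \<mu>\<close>.
  For bounded \<open>\<Omega>\<close> the spectrum is discrete with finite multiplicities, so the sum is finite and
  the minimum is attained.\<close>

definition dirichlet_eigval :: "'a::euclidean_space set \<Rightarrow> nat \<Rightarrow> real"
  where "dirichlet_eigval \<Omega> k =
    (LEAST \<mu>. is_dirichlet_eigenvalue \<Omega> \<mu> \<and>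
      k \<le> (\<Sum>\<nu> | is_dirichlet_eigenvalue \<Omega> \<nu> \<and> \<nu> \<le> \<mu>. dirichlet_multiplicity \<Omega> \<nu>))"

definition dirichlet_kappa :: "'a::euclidean_space set \<Rightarrow> real \<Rightarrow> nat"
  where "dirichlet_kappa \<Omega> \<mu> = (LEAST k. k \<ge> 1 \<and> dirichlet_eigval \<Omega> k = \<mu>)"

section \<open>The Extended Courant Property\<close>

definition dirichlet_combinations :: "'a::euclidean_space set \<Rightarrow> real \<Rightarrow> ('a \<Rightarrow> real) set"
  where "dirichlet_combinations \<Omega> \<mu> =
    fun_space.span {u. \<exists>\<nu>\<le>\<mu>. dirichlet_eigenfunction \<Omega> \<nu> u}"

definition nodal_set :: "'a::euclidean_space set \<Rightarrow> ('a \<Rightarrow> real) \<Rightarrow> 'a set"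
  where "nodal_set \<Omega> v = closure {x \<in> \<Omega>. v x = 0}"

text \<open>The number of nodal domains is an \<open>enat\<close> because \<open>card\<close> is \<open>0\<close> on infinite sets.\<close>

definition nodal_count :: "'a::euclidean_space set \<Rightarrow> ('a \<Rightarrow> real) \<Rightarrow> enat"
  where "nodal_count \<Omega> v =
    (let D = components (\<Omega> - nodal_set \<Omega> v) in if finite D then enat (card D) else \<infinity>)"

definition dirichlet_ECP :: "'a::euclidean_space set \<Rightarrow> bool"
  where "dirichlet_ECP \<Omega> \<longleftrightarrow>
    (\<forall>m\<ge>1. \<forall>v \<in> dirichlet_combinations \<Omega> (dirichlet_eigval \<Omega> m).
      nodal_count \<Omega> v \<le> enat (dirichlet_kappa \<Omega> (dirichlet_eigval \<Omega> m)) \<and>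
      dirichlet_kappa \<Omega> (dirichlet_eigval \<Omega> m) \<le> m)"

definition equilateral_triangle :: "(real^2) set"
  where "equilateral_triangle =
    interior (convex hull {vector [0, 0], vector [1, 0], vector [1/2, sqrt 3 / 2]})"

end

theory Submission
  imports Defs
begin

text \<open>In barycentric coordinates the first Dirichlet eigenfunction of the equilateral triangle
is \<open>\<phi> = 4 sin (\<pi> t\<^sub>0) sin (\<pi> t\<^sub>1) sin (\<pi> t\<^sub>2)\<close>. The triangle is a fundamental alcove of the
affine Weyl group of SU(3), \<open>\<phi>\<close> is the Weyl denominator, and the trace \<open>z = e\<^sub>1 + e\<^sub>2 + e\<^sub>3\<close> of
a diagonal matrix in SU(3) is a sum of three plane waves. By the Weyl character formula \<open>\<phi> z\<close> is
an alternating sum of plane waves of equal wave length; hence \<open>\<phi> Re z\<close> and \<open>\<phi> Im z\<close> are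
Dirichlet eigenfunctions of a common eigenvalue, so \<open>v = \<phi> (Re z + 5/4)\<close> is a combination of
eigenfunctions of two eigenvalues only, and its nodal set is the level line \<open>Re z = - 5/4\<close>.

The function \<open>z\<close> maps the closed triangle bijectively onto a deltoid with cusps at three times
the cube roots of unity. A vertical line slightly to the left of abscissa \<open>-1\<close> separates the
deltoid into three pieces: it cuts off the two cusps with real part \<open>- 3/2\<close>, and these are
separated from each other because \<open>Re z \<ge> - 1\<close> on the axis of symmetry of the triangle. Hence
\<open>v\<close> has at least three nodal domains (\<open>nodal_count_example\<close>). Since \<open>v\<close> involves only the
eigenvalues up to \<open>\<lambda>\<^sub>2\<close>, and \<open>\<kappa>(\<lambda>\<^sub>2) \<le> 2\<close>, this contradicts the Extended Courant Property.

The longer part of the argument shows that the eigenvalue \<open>7 c\<close> of \<open>\<phi> Re z\<close>, with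
\<open>c = 16 \<pi>\<^sup>2 / 9\<close>, really is \<open>\<lambda>\<^sub>2\<close>: no weak eigenfunction escapes the explicit list. The products
\<open>\<phi> z\<^sup>a cnj(z)\<^sup>b\<close> lie in the form domain, because \<open>\<phi>\<close> is positive inside and vanishes on the
boundary (\<open>H10_product_vanishing_on_frontier\<close>), and the Laplacian acts on them in triangular
form: up to products of lower degree \<open>a + b\<close> it multiplies by
\<open>- c (a\<^sup>2 + a b + b\<^sup>2 + 3 a + 3 b + 3)\<close> (\<open>has_weak_laplacian_weyl_monomial\<close>). Testing a weak
eigenfunction \<open>u\<close> of eigenvalue \<open>\<mu>\<close> against all these products gives a recurrence for the
moments \<open>\<integral> u \<phi> z\<^sup>a cnj(z)\<^sup>b\<close>, and by induction on the degree all moments vanish as soon as those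
do that \<open>\<mu>\<close> resonates with (\<open>nonresonant_moments_vanish\<close>). Because \<open>z\<close> is injective on the
closed triangle (\<open>fund_char_inj\<close>), the Stone-Weierstrass theorem makes the polynomials in \<open>Re z\<close>
and \<open>Im z\<close> dense, so a function all of whose moments vanish is zero (\<open>admissible_eq_0\<close>). For
\<open>\<mu> \<le> 7 c\<close> the only resonances are \<open>3 c\<close>, with \<open>(a, b) = (0, 0)\<close>, and \<open>7 c\<close>, with \<open>(1, 0)\<close> and
\<open>(0, 1)\<close>; this determines both eigenspaces and gives \<open>\<lambda>\<^sub>2 = 7 c\<close> (\<open>eigval_2\<close>).\<close>

section \<open>Derivatives of compactly supported functions\<close>

text \<open>The derivative is a function of base point and direction. Thus a complex-valued gradient
is given by its values on the basis vectors.\<close>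

definition has_C1_derivative ::
    "('a::euclidean_space \<Rightarrow> complex) \<Rightarrow> ('a \<Rightarrow> 'a \<Rightarrow> complex) \<Rightarrow> bool"
  where "has_C1_derivative f f' \<longleftrightarrow>
    (\<forall>x. (f has_derivative f' x) (at x)) \<and> (\<forall>v. continuous_on UNIV (\<lambda>x. f' x v))"

definition compactly_supported :: "('a::topological_space \<Rightarrow> complex) \<Rightarrow> bool"
  where "compactly_supported f \<longleftrightarrow> (\<exists>K. compact K \<and> (\<forall>x. x \<notin> K \<longrightarrow> f x = 0))"

lemma has_C1_derivative_continuous: "has_C1_derivative f f' \<Longrightarrow> continuous_on UNIV f"
  unfolding has_C1_derivative_def
  by (meson continuous_at_imp_continuous_on has_derivative_continuous)

lemma has_C1_derivative_add:
  assumes "has_C1_derivative f f'" "has_C1_derivative g g'"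
  shows "has_C1_derivative (\<lambda>x. f x + g x) (\<lambda>x v. f' x v + g' x v)"
  using assms unfolding has_C1_derivative_def
  by (auto intro!: derivative_eq_intros continuous_intros)

lemma has_C1_derivative_cmult:
  assumes "has_C1_derivative f f'"
  shows "has_C1_derivative (\<lambda>x. c * f x) (\<lambda>x v. c * f' x v)"
  using assms unfolding has_C1_derivative_def
  by (auto intro!: derivative_eq_intros continuous_intros)

lemma has_C1_derivative_mult:
  assumes "has_C1_derivative f f'" "has_C1_derivative g g'"
  shows "has_C1_derivative (\<lambda>x. f x * g x) (\<lambda>x v. f x * g' x v + g x * f' x v)"
  using assms has_C1_derivative_continuous[OF assms(1)] has_C1_derivative_continuous[OF assms(2)]
  unfolding has_C1_derivative_def
  by (auto intro!: derivative_eq_intros continuous_intros simp: mult.commute)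

lemma has_C1_derivative_cnj:
  assumes "has_C1_derivative f f'"
  shows "has_C1_derivative (\<lambda>x. cnj (f x)) (\<lambda>x v. cnj (f' x v))"
  using assms unfolding has_C1_derivative_def
  by (auto intro!: derivative_eq_intros continuous_intros)

lemma compactly_supported_mult:
  "compactly_supported g \<Longrightarrow> compactly_supported (\<lambda>x. f x * g x)"
  unfolding compactly_supported_def by (metis mult_zero_right)

lemma integrable_continuous_compactly_supported:
  fixes f :: "'a::euclidean_space \<Rightarrow> complex"
  assumes "continuous_on UNIV f" "compactly_supported f"
  shows "integrable lborel f"
proof -
  obtain K where K: "compact K" "\<And>x. x \<notin> K \<Longrightarrow> f x = 0"
    using assms(2) unfolding compactly_supported_def by blast
  have "integrable lborel (\<lambda>x. indicator K x *\<^sub>R f x)"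
    using K(1) assms(1) by (intro borel_integrable_compact) (auto intro: continuous_on_subset)
  also have "(\<lambda>x. indicator K x *\<^sub>R f x) = f"
    using K(2) by (auto simp: indicator_def fun_eq_iff)
  finally show ?thesis .
qed

lemma compactly_supported_derivative:
  assumes "has_C1_derivative f f'" "compactly_supported f"
  shows "compactly_supported (\<lambda>x. f' x v)"
proof -
  obtain K where K: "compact K" "\<And>x. x \<notin> K \<Longrightarrow> f x = 0"
    using assms(2) unfolding compactly_supported_def by blast
  have "f' x v = 0" if "x \<notin> K" for x
  proof -
    have "((\<lambda>x. 0::complex) has_derivative f' x) (at x)"
    proof (rule has_derivative_transform_within_open)
      show "(f has_derivative f' x) (at x)" using assms unfolding has_C1_derivative_def by blast
      show "open (- K)" using K by (simp add: compact_imp_closed open_Compl)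
    qed (use that K in auto)
    then have "f' x = (\<lambda>_. 0)" using has_derivative_const has_derivative_unique by blast
    then show ?thesis by simp
  qed
  with K show ?thesis unfolding compactly_supported_def by blast
qed

text \<open>The integral of a difference quotient vanishes by translation invariance of Lebesgue
measure, and dominated convergence passes to the derivative. The argument treats all directions
alike.\<close>

lemma integral_directional_derivative_eq_0:
  fixes F :: "'a::euclidean_space \<Rightarrow> complex"
  assumes F: "has_C1_derivative F F'" and supp: "compactly_supported F"
  shows "(LINT x|lborel. F' x v) = 0"
proof -
  obtain K where K: "compact K" "\<And>x. x \<notin> K \<Longrightarrow> F x = 0"
    using supp unfolding compactly_supported_def by blast
  obtain K' where K': "compact K'" "\<And>x. x \<notin> K' \<Longrightarrow> F' x v = 0"
    using compactly_supported_derivative[OF F supp] unfolding compactly_supported_def by blast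
  have contF: "continuous_on UNIV F" and contF': "continuous_on UNIV (\<lambda>x. F' x v)"
    using F has_C1_derivative_continuous unfolding has_C1_derivative_def by blast+
  have intF: "integrable lborel F"
    by (rule integrable_continuous_compactly_supported[OF contF supp])
  have meas[measurable]: "F \<in> borel_measurable borel" "(\<lambda>x. F' x v) \<in> borel_measurable borel"
    using contF contF' by (auto intro: borel_measurable_continuous_onI)
  obtain R where R: "\<And>x. x \<in> K \<Longrightarrow> norm x \<le> R"
    using compact_imp_bounded[OF K(1)] bounded_iff by blast
  have "bounded ((\<lambda>x. F' x v) ` K')"
    using K'(1) contF' by (meson compact_continuous_image compact_imp_bounded
        continuous_on_subset subset_UNIV)
  then obtain C0 where C0: "\<And>x. x \<in> K' \<Longrightarrow> norm (F' x v) \<le> C0"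
    unfolding bounded_iff by blast
  (* The maximum guards against an empty set K', where C0 could be negative. *)
  define C where "C = max C0 0"
  have C: "norm (F' x v) \<le> C" "C \<ge> 0" for x
    using C0[of x] K'(2)[of x] unfolding C_def by (cases "x \<in> K'", auto)
  define h where "h n = 1 / real (Suc n)" for n
  have h: "h n > 0" "h n \<le> 1" for n unfolding h_def by auto
  define q where "q n x = (F (x + h n *\<^sub>R v) - F x) /\<^sub>R h n" for n x
  have lin: "linear (F' x)" for x
    using F has_derivative_linear unfolding has_C1_derivative_def by blast
  have line: "((\<lambda>t::real. F (x + t *\<^sub>R v)) has_derivative (\<lambda>s. s *\<^sub>R F' (x + t *\<^sub>R v) v)) (at t)"
    for x t
  proof -
    have "((\<lambda>t. F (x + t *\<^sub>R v)) has_derivative (\<lambda>s. F' (x + t *\<^sub>R v) (s *\<^sub>R v))) (at t)"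
      by (rule has_derivative_compose[where f = "\<lambda>t. x + t *\<^sub>R v" and g=F and g'="F' (x + t *\<^sub>R v)"])
         (use F in \<open>auto simp: has_C1_derivative_def intro!: derivative_eq_intros\<close>)
    then show ?thesis by (simp add: linear_cmul[OF lin])
  qed
  have qbound: "norm (q n x) \<le> C * indicator (cball 0 (R + norm v)) x" for n x
  proof (cases "x \<in> cball 0 (R + norm v)")
    case True
    have "norm (F (x + h n *\<^sub>R v) - F (x + 0 *\<^sub>R v)) \<le> C * norm (h n - 0)"
    proof (rule differentiable_bound[where S = UNIV])
      show "onorm (\<lambda>s. s *\<^sub>R F' (x + t *\<^sub>R v) v) \<le> C" for t
        using C by (intro onorm_le) (simp, metis abs_ge_zero mult.commute mult_left_mono)
    qed (use line in auto)
    then have "norm (F (x + h n *\<^sub>R v) - F x) \<le> C * h n" using h[of n] by simp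
    then have "norm (q n x) \<le> C"
      unfolding q_def norm_scaleR using h[of n] by (simp add: field_simps)
    then show ?thesis using True by simp
  next
    case False
    then have x: "norm x > R + norm v" by simp
    have "norm (h n *\<^sub>R v) \<le> norm v" using h[of n] by (simp add: mult_left_le_one_le)
    then have "norm (x + h n *\<^sub>R v) > R"
      using norm_diff_ineq[of x "h n *\<^sub>R v"] x by linarith
    moreover have "norm x > R" using x norm_ge_zero[of v] by linarith
    ultimately have "F (x + h n *\<^sub>R v) = 0" "F x = 0" using K(2) R by force+
    then show ?thesis using False by (simp add: q_def)
  qed
  have qint: "(LINT x|lborel. q n x) = 0" for n
  proof -
    have "integrable (distr lborel borel ((+) (h n *\<^sub>R v))) F"
      using intF by (simp add: lborel_distr_plus)
    then have i: "integrable lborel (\<lambda>x. F (h n *\<^sub>R v + x))"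
      by (subst (asm) integrable_distr_eq) auto
    have "(LINT x|lborel. F x) = (LINT x|distr lborel borel ((+) (h n *\<^sub>R v)). F x)"
      by (simp add: lborel_distr_plus)
    also have "\<dots> = (LINT x|lborel. F (h n *\<^sub>R v + x))"
      by (rule integral_distr) auto
    finally have "(LINT x|lborel. F (h n *\<^sub>R v + x) - F x) = 0"
      using i intF by simp
    then show ?thesis unfolding q_def by (simp add: add.commute)
  qed
  have "(\<lambda>n. LINT x|lborel. q n x) \<longlonglongrightarrow> (LINT x|lborel. F' x v)"
  proof (rule integral_dominated_convergence[where w = "\<lambda>x. C * indicator (cball 0 (R + norm v)) x"])
    have "emeasure lborel (cball 0 (R + norm v)::'a set) < \<infinity>"
      using emeasure_bounded_finite[OF bounded_cball] by (simp add: less_top)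
    then show "integrable lborel (\<lambda>x::'a. C * indicator (cball 0 (R + norm v)) x)"
      by (intro integrable_mult_right) auto
    have "(\<lambda>n. q n x) \<longlonglongrightarrow> F' x v" for x
    proof -
      have "((\<lambda>t. norm ((F (x + t *\<^sub>R v) - F x) /\<^sub>R t - F' x v)) \<longlongrightarrow> 0) (at 0)"
      proof (rule Lim_transform_eventually)
        show "((\<lambda>t. norm (F (x + t *\<^sub>R v) - F (x + 0 *\<^sub>R v) - (t - 0) *\<^sub>R F' (x + 0 *\<^sub>R v) v)
            / norm (t - 0)) \<longlongrightarrow> 0) (at 0)"
          using line[of x 0] unfolding has_derivative_iff_norm by blast
        have "norm (F (x + t *\<^sub>R v) - F x - t *\<^sub>R F' x v) / \<bar>t\<bar> =
            norm ((F (x + t *\<^sub>R v) - F x) /\<^sub>R t - F' x v)" if "t \<noteq> 0" for t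
        proof -
          have "(F (x + t *\<^sub>R v) - F x) /\<^sub>R t - F' x v =
              (F (x + t *\<^sub>R v) - F x - t *\<^sub>R F' x v) /\<^sub>R t"
            using that by (simp add: scaleR_diff_right)
          then show ?thesis by (simp add: divide_inverse mult.commute)
        qed
        then show "\<forall>\<^sub>F t in at 0. norm (F (x + t *\<^sub>R v) - F (x + 0 *\<^sub>R v) - (t - 0) *\<^sub>R F' (x + 0 *\<^sub>R v) v)
            / norm (t - 0) = norm ((F (x + t *\<^sub>R v) - F x) /\<^sub>R t - F' x v)"
          by (auto simp: eventually_at_filter)
      qed
      then have "((\<lambda>t. (F (x + t *\<^sub>R v) - F x) /\<^sub>R t) \<longlongrightarrow> F' x v) (at 0)"
        using LIM_zero_cancel tendsto_norm_zero_iff by blast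
      moreover have "filterlim h (at 0) sequentially"
        using LIMSEQ_inverse_real_of_nat h(1) unfolding filterlim_at h_def
        by (auto simp: inverse_eq_divide)
      ultimately show ?thesis unfolding q_def by (rule filterlim_compose)
    qed
    then show "AE x in lborel. (\<lambda>n. q n x) \<longlonglongrightarrow> F' x v" by simp
    show "AE x in lborel. norm (q n x) \<le> C * indicator (cball 0 (R + norm v)) x" for n
      using qbound by simp
  qed (auto simp: q_def)
  then show ?thesis by (simp add: qint LIMSEQ_const_iff)
qed

section \<open>Weak Laplacians\<close>

text \<open>The bilinear (not sesquilinear) product of complex gradients, as it occurs in the Leibniz
rule for the Laplacian.\<close>

definition grad_dot :: "('a::euclidean_space \<Rightarrow> 'a \<Rightarrow> complex) \<Rightarrow> ('a \<Rightarrow> 'a \<Rightarrow> complex) \<Rightarrow> 'a \<Rightarrow> complex"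
  where "grad_dot f' g' x = (\<Sum>b\<in>Basis. f' x b * g' x b)"

text \<open>The Laplacian \<open>L\<close> of \<open>f\<close> in the sense of distributions, tested against \<open>C\<^sup>1\<close> functions.
Complex test functions are allowed so that, in a product, a complex factor can be moved into the
test function.\<close>

definition has_weak_laplacian ::
    "('a::euclidean_space \<Rightarrow> complex) \<Rightarrow> ('a \<Rightarrow> 'a \<Rightarrow> complex) \<Rightarrow> ('a \<Rightarrow> complex) \<Rightarrow> bool"
  where "has_weak_laplacian f f' L \<longleftrightarrow>
    has_C1_derivative f f' \<and> continuous_on UNIV L \<and>
    (\<forall>\<psi> \<psi>'. has_C1_derivative \<psi> \<psi>' \<longrightarrow> compactly_supported \<psi> \<longrightarrow>
      (LINT x|lborel. grad_dot f' \<psi>' x + L x * \<psi> x) = 0)"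

lemma continuous_grad_dot:
  "has_C1_derivative f f' \<Longrightarrow> has_C1_derivative g g' \<Longrightarrow> continuous_on UNIV (grad_dot f' g')"
  unfolding grad_dot_def has_C1_derivative_def by (intro continuous_intros) auto

lemma grad_dot_commute: "grad_dot f' g' x = grad_dot g' f' x"
  by (simp add: grad_dot_def mult.commute)

lemma grad_dot_add: "grad_dot (\<lambda>x v. f' x v + g' x v) h' x = grad_dot f' h' x + grad_dot g' h' x"
  by (simp add: grad_dot_def sum.distrib distrib_right)

lemma grad_dot_cmult: "grad_dot (\<lambda>x v. c x * f' x v) h' x = c x * grad_dot f' h' x"
  by (simp add: grad_dot_def sum_distrib_left mult.assoc)

lemma grad_dot_diff: "grad_dot (\<lambda>x v. f' x v - g' x v) h' x = grad_dot f' h' x - grad_dot g' h' x"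
  by (simp add: grad_dot_def sum_subtractf left_diff_distrib)

lemma grad_dot_add_right: "grad_dot h' (\<lambda>x v. f' x v + g' x v) x = grad_dot h' f' x + grad_dot h' g' x"
  by (simp add: grad_dot_def sum.distrib distrib_left)

lemma grad_dot_cmult_right: "grad_dot h' (\<lambda>x v. c x * f' x v) x = c x * grad_dot h' f' x"
  by (simp add: grad_dot_def sum_distrib_left algebra_simps)

lemma grad_dot_cnj: "grad_dot (\<lambda>x v. cnj (f' x v)) (\<lambda>x v. cnj (g' x v)) x = cnj (grad_dot f' g' x)"
  by (simp add: grad_dot_def)

lemma has_weak_laplacianD:
  assumes "has_weak_laplacian f f' L"
  shows "has_C1_derivative f f'" "continuous_on UNIV L" "continuous_on UNIV f"
  using assms has_C1_derivative_continuous unfolding has_weak_laplacian_def by blast+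

lemma weak_laplacian_integrable:
  assumes "has_C1_derivative f f'" "continuous_on UNIV L"
    and "has_C1_derivative \<psi> \<psi>'" "compactly_supported \<psi>"
  shows "integrable lborel (\<lambda>x. grad_dot f' \<psi>' x + L x * \<psi> x)"
proof (rule integrable_continuous_compactly_supported)
  show "continuous_on UNIV (\<lambda>x. grad_dot f' \<psi>' x + L x * \<psi> x)"
    using assms has_C1_derivative_continuous by (intro continuous_intros continuous_grad_dot) auto
  have "\<exists>K. compact K \<and> (\<forall>x. x \<notin> K \<longrightarrow> \<psi>' x b = 0)" for b
    using compactly_supported_derivative[OF assms(3,4)] unfolding compactly_supported_def .
  then obtain K where K: "\<And>b. compact (K b)" "\<And>b x. x \<notin> K b \<Longrightarrow> \<psi>' x b = 0" by metis
  obtain K0 where K0: "compact K0" "\<And>x. x \<notin> K0 \<Longrightarrow> \<psi> x = 0"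
    using assms(4) unfolding compactly_supported_def by blast
  have "compact (K0 \<union> (\<Union>b\<in>Basis. K b))"
    using K0 K by (intro compact_Un compact_UN) auto
  moreover have "grad_dot f' \<psi>' x + L x * \<psi> x = 0" if "x \<notin> K0 \<union> (\<Union>b\<in>Basis. K b)" for x
    using that K K0 by (auto simp: grad_dot_def)
  ultimately show "compactly_supported (\<lambda>x. grad_dot f' \<psi>' x + L x * \<psi> x)"
    unfolding compactly_supported_def by blast
qed

lemma has_weak_laplacian_add:
  fixes f :: "'a::euclidean_space \<Rightarrow> complex"
  assumes "has_weak_laplacian f f' L" "has_weak_laplacian g g' M"
  shows "has_weak_laplacian (\<lambda>x. f x + g x) (\<lambda>x v. f' x v + g' x v) (\<lambda>x. L x + M x)"
  unfolding has_weak_laplacian_def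
proof (intro conjI allI impI)
  fix \<psi> :: "'a \<Rightarrow> complex" and \<psi>'
  assume p: "has_C1_derivative \<psi> \<psi>'" "compactly_supported \<psi>"
  have "(LINT x|lborel. grad_dot (\<lambda>x v. f' x v + g' x v) \<psi>' x + (L x + M x) * \<psi> x) =
      (LINT x|lborel. (grad_dot f' \<psi>' x + L x * \<psi> x) + (grad_dot g' \<psi>' x + M x * \<psi> x))"
    by (simp add: grad_dot_add algebra_simps)
  also have "\<dots> = 0"
    using assms p unfolding has_weak_laplacian_def
    by (subst Bochner_Integration.integral_add) (auto intro!: weak_laplacian_integrable)
  finally show "(LINT x|lborel. grad_dot (\<lambda>x v. f' x v + g' x v) \<psi>' x + (L x + M x) * \<psi> x) = 0" .
qed (use assms in \<open>auto intro!: has_C1_derivative_add continuous_intros dest: has_weak_laplacianD\<close>)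

lemma has_weak_laplacian_cmult:
  fixes f :: "'a::euclidean_space \<Rightarrow> complex"
  assumes "has_weak_laplacian f f' L"
  shows "has_weak_laplacian (\<lambda>x. c * f x) (\<lambda>x v. c * f' x v) (\<lambda>x. c * L x)"
  unfolding has_weak_laplacian_def
proof (intro conjI allI impI)
  fix \<psi> :: "'a \<Rightarrow> complex" and \<psi>'
  assume p: "has_C1_derivative \<psi> \<psi>'" "compactly_supported \<psi>"
  have "(LINT x|lborel. grad_dot (\<lambda>x v. c * f' x v) \<psi>' x + (c * L x) * \<psi> x) =
      (LINT x|lborel. c * (grad_dot f' \<psi>' x + L x * \<psi> x))"
    by (simp add: grad_dot_cmult algebra_simps)
  also have "\<dots> = 0"
    using assms p unfolding has_weak_laplacian_def by simp
  finally show "(LINT x|lborel. grad_dot (\<lambda>x v. c * f' x v) \<psi>' x + (c * L x) * \<psi> x) = 0" .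
qed (use assms in \<open>auto intro!: has_C1_derivative_cmult continuous_intros dest: has_weak_laplacianD\<close>)

lemma has_weak_laplacian_diff:
  fixes f :: "'a::euclidean_space \<Rightarrow> complex"
  assumes "has_weak_laplacian f f' L" "has_weak_laplacian g g' M"
  shows "has_weak_laplacian (\<lambda>x. f x - g x) (\<lambda>x v. f' x v - g' x v) (\<lambda>x. L x - M x)"
  using has_weak_laplacian_add[OF assms(1) has_weak_laplacian_cmult[OF assms(2), of "-1"]] by simp

lemma has_weak_laplacian_cnj:
  fixes f :: "'a::euclidean_space \<Rightarrow> complex"
  assumes "has_weak_laplacian f f' L"
  shows "has_weak_laplacian (\<lambda>x. cnj (f x)) (\<lambda>x v. cnj (f' x v)) (\<lambda>x. cnj (L x))"
  unfolding has_weak_laplacian_def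
proof (intro conjI allI impI)
  fix \<psi> :: "'a \<Rightarrow> complex" and \<psi>'
  assume p: "has_C1_derivative \<psi> \<psi>'" "compactly_supported \<psi>"
  have "(LINT x|lborel. grad_dot f' (\<lambda>x v. cnj (\<psi>' x v)) x + L x * cnj (\<psi> x)) = 0"
    using assms has_C1_derivative_cnj[OF p(1)] p(2)
    unfolding has_weak_laplacian_def compactly_supported_def by auto
  moreover have "(LINT x|lborel. grad_dot (\<lambda>x v. cnj (f' x v)) \<psi>' x + cnj (L x) * \<psi> x) =
      (LINT x|lborel. cnj (grad_dot f' (\<lambda>x v. cnj (\<psi>' x v)) x + L x * cnj (\<psi> x)))"
    using grad_dot_cnj[of f' "\<lambda>x v. cnj (\<psi>' x v)"] by simp
  ultimately show "(LINT x|lborel. grad_dot (\<lambda>x v. cnj (f' x v)) \<psi>' x + cnj (L x) * \<psi> x) = 0"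
    by (simp only: Bochner_Integration.integral_cnj complex_cnj_zero)
qed (use assms in \<open>auto intro!: has_C1_derivative_cnj continuous_intros dest: has_weak_laplacianD\<close>)

text \<open>The Leibniz rule \<open>\<Delta>(f g) = f \<Delta>g + g \<Delta>f + 2 \<nabla>f \<cdot> \<nabla>g\<close> without second derivatives: \<open>\<nabla>(f g) \<cdot>
\<nabla>\<psi> = \<nabla>g \<cdot> \<nabla>(f \<psi>) + \<nabla>f \<cdot> \<nabla>(g \<psi>) - 2 \<psi> \<nabla>f \<cdot> \<nabla>g\<close>, and both \<open>f \<psi>\<close> and \<open>g \<psi>\<close> are test functions.\<close>

lemma has_weak_laplacian_mult:
  fixes f :: "'a::euclidean_space \<Rightarrow> complex"
  assumes f: "has_weak_laplacian f f' L" and g: "has_weak_laplacian g g' M"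
  shows "has_weak_laplacian (\<lambda>x. f x * g x) (\<lambda>x v. f x * g' x v + g x * f' x v)
    (\<lambda>x. f x * M x + g x * L x + 2 * grad_dot f' g' x)"
  unfolding has_weak_laplacian_def
proof (intro conjI allI impI)
  note fD = has_weak_laplacianD[OF f] and gD = has_weak_laplacianD[OF g]
  fix \<psi> :: "'a \<Rightarrow> complex" and \<psi>'
  assume p: "has_C1_derivative \<psi> \<psi>'" "compactly_supported \<psi>"
  let ?A = "\<lambda>x. grad_dot g' (\<lambda>x v. f x * \<psi>' x v + \<psi> x * f' x v) x + M x * (f x * \<psi> x)"
  let ?B = "\<lambda>x. grad_dot f' (\<lambda>x v. g x * \<psi>' x v + \<psi> x * g' x v) x + L x * (g x * \<psi> x)"
  have f\<psi>: "has_C1_derivative (\<lambda>x. f x * \<psi> x) (\<lambda>x v. f x * \<psi>' x v + \<psi> x * f' x v)"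
    and g\<psi>: "has_C1_derivative (\<lambda>x. g x * \<psi> x) (\<lambda>x v. g x * \<psi>' x v + \<psi> x * g' x v)"
    using fD gD p by (auto intro!: has_C1_derivative_mult)
  have supp: "compactly_supported (\<lambda>x. f x * \<psi> x)" "compactly_supported (\<lambda>x. g x * \<psi> x)"
    using p(2) by (auto intro: compactly_supported_mult)
  have "(LINT x|lborel. ?A x + ?B x) = (LINT x|lborel. ?A x) + (LINT x|lborel. ?B x)"
    using fD gD f\<psi> g\<psi> supp
    by (intro Bochner_Integration.integral_add weak_laplacian_integrable)
  also have "\<dots> = 0"
    using f g f\<psi> g\<psi> supp unfolding has_weak_laplacian_def by simp
  finally have "(LINT x|lborel. ?A x + ?B x) = 0" .
  moreover have "?A x + ?B x = grad_dot (\<lambda>x v. f x * g' x v + g x * f' x v) \<psi>' x +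
      (f x * M x + g x * L x + 2 * grad_dot f' g' x) * \<psi> x" for x
    unfolding grad_dot_def
    by (simp add: sum.distrib sum_distrib_left sum_distrib_right algebra_simps flip: mult_2)
  ultimately show "(LINT x|lborel. grad_dot (\<lambda>x v. f x * g' x v + g x * f' x v) \<psi>' x +
      (f x * M x + g x * L x + 2 * grad_dot f' g' x) * \<psi> x) = 0"
    by simp
next
  show "has_C1_derivative (\<lambda>x. f x * g x) (\<lambda>x v. f x * g' x v + g x * f' x v)"
    using has_C1_derivative_mult assms has_weak_laplacianD by blast
  show "continuous_on UNIV (\<lambda>x. f x * M x + g x * L x + 2 * grad_dot f' g' x)"
    by (intro continuous_intros continuous_grad_dot[OF has_weak_laplacianD(1)[OF f] has_weak_laplacianD(1)[OF g]]
        has_weak_laplacianD[OF f] has_weak_laplacianD[OF g])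
qed

definition plane_wave :: "'a::euclidean_space \<Rightarrow> 'a \<Rightarrow> complex"
  where "plane_wave k x = cis (k \<bullet> x)"

definition plane_wave_deriv :: "'a::euclidean_space \<Rightarrow> 'a \<Rightarrow> 'a \<Rightarrow> complex"
  where "plane_wave_deriv k x v = \<i> * of_real (k \<bullet> v) * plane_wave k x"

lemma has_C1_derivative_plane_wave: "has_C1_derivative (plane_wave k) (plane_wave_deriv k)"
proof -
  have "(plane_wave k has_derivative plane_wave_deriv k x) (at x)" for x
    unfolding plane_wave_def[abs_def] plane_wave_deriv_def
    by (auto intro!: derivative_eq_intros simp: scaleR_conv_of_real plane_wave_def)
  moreover have "continuous_on UNIV (plane_wave k)"
    unfolding plane_wave_def[abs_def] cis_conv_exp by (intro continuous_intros)
  ultimately show ?thesis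
    unfolding has_C1_derivative_def plane_wave_deriv_def by (auto intro!: continuous_intros)
qed

lemma grad_dot_plane_wave:
  "grad_dot (plane_wave_deriv k) (plane_wave_deriv l) x = - of_real (k \<bullet> l) * (plane_wave k x * plane_wave l x)"
proof -
  have "grad_dot (plane_wave_deriv k) (plane_wave_deriv l) x =
      (\<Sum>b\<in>Basis. - of_real ((k \<bullet> b) * (l \<bullet> b)) * (plane_wave k x * plane_wave l x))"
    unfolding grad_dot_def plane_wave_deriv_def
    by (intro sum.cong) (auto simp: algebra_simps)
  also have "\<dots> = - of_real (k \<bullet> l) * (plane_wave k x * plane_wave l x)"
    unfolding euclidean_inner[of k l] by (simp add: sum_distrib_right sum_negf)
  finally show ?thesis .
qed

text \<open>The integrand in the definition is \<open>\<i>\<close> times the derivative of \<open>e\<^sub>k \<psi>\<close> in the direction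
\<open>k\<close>.\<close>

lemma has_weak_laplacian_plane_wave:
  fixes k :: "'a::euclidean_space"
  shows "has_weak_laplacian (plane_wave k) (plane_wave_deriv k) (\<lambda>x. - of_real (k \<bullet> k) * plane_wave k x)"
  unfolding has_weak_laplacian_def
proof (intro conjI allI impI)
  fix \<psi> :: "'a \<Rightarrow> complex" and \<psi>'
  assume p: "has_C1_derivative \<psi> \<psi>'" "compactly_supported \<psi>"
  let ?F' = "\<lambda>x v. plane_wave k x * \<psi>' x v + \<psi> x * plane_wave_deriv k x v"
  have "(LINT x|lborel. ?F' x k) = 0"
    by (rule integral_directional_derivative_eq_0[where F = "\<lambda>x. plane_wave k x * \<psi> x"])
       (intro has_C1_derivative_mult has_C1_derivative_plane_wave compactly_supported_mult p)+
  moreover have "grad_dot (plane_wave_deriv k) \<psi>' x + - of_real (k \<bullet> k) * plane_wave k x * \<psi> x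
      = \<i> * ?F' x k" for x
  proof -
    have "linear (\<psi>' x)"
      using p(1) has_derivative_linear unfolding has_C1_derivative_def by blast
    then have "\<psi>' x k = (\<Sum>b\<in>Basis. (k \<bullet> b) *\<^sub>R \<psi>' x b)"
      by (metis (no_types, lifting) euclidean_representation linear_cmul linear_sum sum.cong)
    then have "grad_dot (plane_wave_deriv k) \<psi>' x = \<i> * plane_wave k x * \<psi>' x k"
      by (simp add: grad_dot_def plane_wave_deriv_def sum_distrib_left scaleR_conv_of_real algebra_simps)
    then show ?thesis by (simp add: plane_wave_deriv_def algebra_simps)
  qed
  ultimately show "(LINT x|lborel. grad_dot (plane_wave_deriv k) \<psi>' x +
      - of_real (k \<bullet> k) * plane_wave k x * \<psi> x) = 0"
    by (simp del: of_real_mult)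
next
  show "continuous_on UNIV (\<lambda>x. - of_real (k \<bullet> k) * plane_wave k x)"
    using has_C1_derivative_continuous[OF has_C1_derivative_plane_wave[of k]] by (intro continuous_intros)
qed (rule has_C1_derivative_plane_wave)

lemma plane_wave_mult: "plane_wave k x * plane_wave l x = plane_wave (k + l) x"
  by (simp add: plane_wave_def cis_mult inner_add_left)

lemma cnj_plane_wave: "cnj (plane_wave k x) = plane_wave (- k) x"
  by (simp add: plane_wave_def cis_cnj)

lemma cnj_plane_wave_deriv: "cnj (plane_wave_deriv k x v) = plane_wave_deriv (- k) x v"
  by (simp add: plane_wave_deriv_def cnj_plane_wave)

text \<open>The truncated exponents \<open>n - 1\<close> and \<open>n - 2\<close> are harmless: their coefficients vanish
whenever truncation takes place.\<close>

lemma has_weak_laplacian_power: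
  fixes f :: "'a::euclidean_space \<Rightarrow> complex"
  assumes f: "has_weak_laplacian f f' L"
  shows "has_weak_laplacian (\<lambda>x. f x ^ n) (\<lambda>x v. of_nat n * f x ^ (n - 1) * f' x v)
    (\<lambda>x. of_nat n * f x ^ (n - 1) * L x + of_nat (n * (n - 1)) * f x ^ (n - 2) * grad_dot f' f' x)"
proof (induction n)
  case 0
  (* The constant 1 is the plane wave with wave vector 0; the summand 0 * f aligns the derivatives. *)
  have "has_weak_laplacian (\<lambda>x. 0 * f x + plane_wave 0 x) (\<lambda>x v. 0 * f' x v + plane_wave_deriv 0 x v)
      (\<lambda>x. 0 * L x + - of_real ((0::'a) \<bullet> 0) * plane_wave 0 x)"
    by (intro has_weak_laplacian_add has_weak_laplacian_cmult f has_weak_laplacian_plane_wave)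
  then show ?case by (simp add: plane_wave_def plane_wave_deriv_def)
next
  case (Suc n)
  have "has_weak_laplacian (\<lambda>x. f x * f x ^ n)
      (\<lambda>x v. f x * (of_nat n * f x ^ (n - 1) * f' x v) + f x ^ n * f' x v)
      (\<lambda>x. f x * (of_nat n * f x ^ (n - 1) * L x + of_nat (n * (n - 1)) * f x ^ (n - 2) * grad_dot f' f' x)
        + f x ^ n * L x + 2 * grad_dot f' (\<lambda>x v. of_nat n * f x ^ (n - 1) * f' x v) x)"
    by (rule has_weak_laplacian_mult[OF f Suc.IH])
  moreover have "f x * (of_nat n * f x ^ (n - 1) * y) + f x ^ n * y = of_nat (Suc n) * f x ^ n * y" for x y
    by (cases n) (auto simp: algebra_simps)
  moreover have "f x * (of_nat n * f x ^ (n - 1) * L x + of_nat (n * (n - 1)) * f x ^ (n - 2) * grad_dot f' f' x)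
        + f x ^ n * L x + 2 * grad_dot f' (\<lambda>x v. of_nat n * f x ^ (n - 1) * f' x v) x =
      of_nat (Suc n) * f x ^ n * L x + of_nat (Suc n * n) * f x ^ (n - 1) * grad_dot f' f' x" for x
  proof -
    have g: "grad_dot f' (\<lambda>x v. of_nat n * f x ^ (n - 1) * f' x v) x =
        of_nat n * f x ^ (n - 1) * grad_dot f' f' x"
      by (subst grad_dot_commute) (rule grad_dot_cmult[of "\<lambda>x. of_nat n * f x ^ (n - 1)"])
    consider "n = 0" | "n = 1" | k where "n = Suc (Suc k)" by (metis One_nat_def not0_implies_Suc)
    then show ?thesis
      unfolding g by cases (simp_all add: algebra_simps)
  qed
  ultimately show ?case by simp
qed

section \<open>Square-integrable functions on a bounded domain\<close>

abbreviation dom_measure :: "'a::euclidean_space set \<Rightarrow> 'a measure"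
  where "dom_measure \<Omega> \<equiv> restrict_space lborel \<Omega>"

text \<open>On a bounded domain, this gives access to the theory of finite measures.\<close>

lemma set_integral_dom_measure:
  fixes f :: "'a::euclidean_space \<Rightarrow> 'b::{banach, second_countable_topology}"
  assumes "open \<Omega>"
  shows "(LINT x:\<Omega>|lborel. f x) = (LINT x|dom_measure \<Omega>. f x)"
  using assms by (simp add: set_lebesgue_integral_def integral_restrict_space)

lemma square_integrable_on_iff:
  assumes "open \<Omega>"
  shows "square_integrable_on f \<Omega> \<longleftrightarrow>
    f \<in> borel_measurable (dom_measure \<Omega>) \<and> integrable (dom_measure \<Omega>) (\<lambda>x. (norm (f x))\<^sup>2)"
  using assms
  by (simp add: square_integrable_on_def set_borel_measurable_def set_integrable_def
      integrable_restrict_space borel_measurable_restrict_space_iff)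

lemma finite_measure_dom_measure:
  assumes "open \<Omega>" "bounded \<Omega>"
  shows "finite_measure (dom_measure \<Omega>)"
  using assms emeasure_bounded_finite[of \<Omega>]
  by (intro finite_measureI) (simp add: space_restrict_space emeasure_restrict_space less_top)

lemma integrable_inner_square_integrable:
  fixes f g :: "'a \<Rightarrow> 'b::euclidean_space"
  assumes "f \<in> borel_measurable M" "integrable M (\<lambda>x. (norm (f x))\<^sup>2)"
    and "g \<in> borel_measurable M" "integrable M (\<lambda>x. (norm (g x))\<^sup>2)"
  shows "integrable M (\<lambda>x. f x \<bullet> g x)"
proof (rule Bochner_Integration.integrable_bound)
  show "integrable M (\<lambda>x. (norm (f x))\<^sup>2 + (norm (g x))\<^sup>2)"
    using assms by simp
  have "\<bar>f x \<bullet> g x\<bar> \<le> (norm (f x))\<^sup>2 + (norm (g x))\<^sup>2" for x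
  proof -
    have "2 * (norm (f x) * norm (g x)) \<le> (norm (f x))\<^sup>2 + (norm (g x))\<^sup>2"
      using sum_squares_bound[of "norm (f x)" "norm (g x)"] by simp
    moreover have "\<bar>f x \<bullet> g x\<bar> \<le> norm (f x) * norm (g x)"
      by (rule Cauchy_Schwarz_ineq2)
    moreover have "0 \<le> norm (f x) * norm (g x)" by simp
    ultimately show ?thesis by linarith
  qed
  then show "AE x in M. norm (f x \<bullet> g x) \<le> norm ((norm (f x))\<^sup>2 + (norm (g x))\<^sup>2)"
    by simp
qed (use assms in measurable)

lemma integrable_square_diff:
  fixes f g :: "'a \<Rightarrow> 'b::euclidean_space"
  assumes "f \<in> borel_measurable M" "integrable M (\<lambda>x. (norm (f x))\<^sup>2)"
    and "g \<in> borel_measurable M" "integrable M (\<lambda>x. (norm (g x))\<^sup>2)"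
  shows "integrable M (\<lambda>x. (norm (f x - g x))\<^sup>2)"
proof -
  have "(norm (f x - g x))\<^sup>2 = (norm (f x))\<^sup>2 + (norm (g x))\<^sup>2 - 2 * (f x \<bullet> g x)" for x
    by (simp add: power2_norm_eq_inner inner_diff_left inner_diff_right inner_commute)
  then show ?thesis
    using assms integrable_inner_square_integrable[OF assms] by simp
qed

text \<open>Convergence in \<open>L\<^sup>2\<close> implies weak convergence against bounded functions on a finite
measure space, by the pointwise estimate \<open>C t \<le> e + C\<^sup>2 t\<^sup>2 / (4 e)\<close>.\<close>

lemma integral_inner_bounded_tendsto_0:
  fixes k :: "'a \<Rightarrow> 'b::euclidean_space"
  assumes "finite_measure M"
    and k: "k \<in> borel_measurable M" "\<And>x. x \<in> space M \<Longrightarrow> norm (k x) \<le> C"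
    and d: "\<And>n::nat. d n \<in> borel_measurable M" "\<And>n. integrable M (\<lambda>x. (norm (d n x))\<^sup>2)"
    and lim: "(\<lambda>n. LINT x|M. (norm (d n x))\<^sup>2) \<longlonglongrightarrow> 0"
  shows "(\<lambda>n. LINT x|M. k x \<bullet> d n x) \<longlonglongrightarrow> 0"
proof (rule LIMSEQ_I)
  interpret finite_measure M by fact
  fix r :: real assume r: "r > 0"
  define m where "m = measure M (space M)"
  define e where "e = (r / 2) / (m + 1)"
  have m: "m \<ge> 0" unfolding m_def by simp
  have e: "e > 0" unfolding e_def using r m by simp
  have em: "e * m < r / 2"
  proof -
    have "e * m < e * (m + 1)" using e by simp
    also have "\<dots> = r / 2"
    proof -
      have "m + 1 \<noteq> 0" using m by simp
      then show ?thesis using e_def nonzero_eq_divide_eq by blast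
    qed
    finally show ?thesis .
  qed
  (* The summand 1 keeps the divisor c positive when C is zero. *)
  define c where "c = C\<^sup>2 / (4 * e) + 1"
  have c: "c > 0" unfolding c_def using e by (simp add: add_nonneg_pos)
  have pt: "\<bar>k x \<bullet> d n x\<bar> \<le> e + c * (norm (d n x))\<^sup>2" if "x \<in> space M" for x n
  proof -
    let ?t = "norm (d n x)"
    have "\<bar>k x \<bullet> d n x\<bar> \<le> C * ?t"
      using Cauchy_Schwarz_ineq2[of "k x" "d n x"] k(2)[OF that]
      by (meson mult_right_mono norm_ge_zero order_trans)
    also have "C * ?t \<le> e + C\<^sup>2 / (4 * e) * ?t\<^sup>2"
    proof -
      have "0 \<le> (2 * e - C * ?t)\<^sup>2 / (4 * e)" using e by simp
      also have "\<dots> = e - C * ?t + C\<^sup>2 / (4 * e) * ?t\<^sup>2"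
        using e by (simp add: power2_eq_square field_simps)
      finally show ?thesis by simp
    qed
    also have "\<dots> \<le> e + c * ?t\<^sup>2" unfolding c_def by (simp add: distrib_right)
    finally show ?thesis .
  qed
  obtain N where N: "\<And>n. n \<ge> N \<Longrightarrow> \<bar>LINT x|M. (norm (d n x))\<^sup>2\<bar> < r / (2 * c)"
    using LIMSEQ_D[OF lim, of "r / (2 * c)"] r c by auto
  have "norm ((LINT x|M. k x \<bullet> d n x) - 0) < r" if "n \<ge> N" for n
  proof -
    have i: "integrable M (\<lambda>x. e + c * (norm (d n x))\<^sup>2)" using d by simp
    have "integrable M (\<lambda>x. k x \<bullet> d n x)"
      by (rule Bochner_Integration.integrable_bound[OF i])
         (use pt k d in \<open>auto intro!: AE_I2 intro: order_trans[OF _ abs_ge_self]\<close>)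
    then have "(LINT x|M. norm (k x \<bullet> d n x)) \<le> (LINT x|M. e + c * (norm (d n x))\<^sup>2)"
      using i pt by (intro integral_mono) auto
    then have "norm (LINT x|M. k x \<bullet> d n x) \<le> (LINT x|M. e + c * (norm (d n x))\<^sup>2)"
      by (rule order_trans[OF integral_norm_bound])
    also have "\<dots> = e * m + c * (LINT x|M. (norm (d n x))\<^sup>2)"
      using d by (simp add: m_def)
    also have "c * (LINT x|M. (norm (d n x))\<^sup>2) < r / 2"
      using N[OF that] c by (simp add: field_simps)
    finally show ?thesis using em by simp
  qed
  then show "\<exists>no. \<forall>n\<ge>no. norm ((LINT x|M. k x \<bullet> d n x) - 0) < r" by blast
qed

lemma continuous_on_bounded_dom:
  fixes f :: "'a::euclidean_space \<Rightarrow> 'b::euclidean_space"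
  assumes "bounded \<Omega>" "continuous_on (closure \<Omega>) f"
  obtains C where "C \<ge> 0" "\<And>x. x \<in> \<Omega> \<Longrightarrow> norm (f x) \<le> C"
proof -
  have "bounded (f ` closure \<Omega>)"
    using assms by (intro compact_imp_bounded compact_continuous_image) auto
  then obtain C where "\<And>x. x \<in> closure \<Omega> \<Longrightarrow> norm (f x) \<le> C"
    unfolding bounded_iff by auto
  then have "norm (f x) \<le> max C 0" if "x \<in> \<Omega>" for x
    using that closure_subset by (meson max.coboundedI1 subsetD)
  then show ?thesis using that by (metis max.cobounded2)
qed

lemma continuous_on_measurable_dom:
  fixes f :: "'a::euclidean_space \<Rightarrow> 'b::euclidean_space"
  assumes "open \<Omega>" "continuous_on \<Omega> f"
  shows "f \<in> borel_measurable (dom_measure \<Omega>)"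
  using assms borel_measurable_continuous_on_restrict[of \<Omega> f]
  by (simp add: measurable_cong_sets sets_restrict_space cong: measurable_cong_sets)

lemma continuous_square_integrable:
  fixes f :: "'a::euclidean_space \<Rightarrow> 'b::euclidean_space"
  assumes "open \<Omega>" "bounded \<Omega>" "continuous_on UNIV f"
  shows "f \<in> borel_measurable (dom_measure \<Omega>)" "integrable (dom_measure \<Omega>) (\<lambda>x. (norm (f x))\<^sup>2)"
    "square_integrable_on f \<Omega>"
proof -
  interpret finite_measure "dom_measure \<Omega>"
    by (rule finite_measure_dom_measure[OF assms(1,2)])
  show m: "f \<in> borel_measurable (dom_measure \<Omega>)"
    using assms by (intro continuous_on_measurable_dom) (auto intro: continuous_on_subset)
  obtain C where C: "\<And>x. x \<in> \<Omega> \<Longrightarrow> norm (f x) \<le> C"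
    using continuous_on_bounded_dom[OF assms(2), of f] assms(3) by (metis continuous_on_subset subset_UNIV)
  show i: "integrable (dom_measure \<Omega>) (\<lambda>x. (norm (f x))\<^sup>2)"
    by (rule integrable_const_bound[where B="C\<^sup>2"])
       (use C m in \<open>auto simp: space_restrict_space intro!: AE_I2 power_mono\<close>)
  show "square_integrable_on f \<Omega>" using m i square_integrable_on_iff[OF assms(1)] by blast
qed

lemma integral_tendsto_0_bounded:
  fixes d :: "nat \<Rightarrow> 'a \<Rightarrow> real"
  assumes "finite_measure M" and "\<And>n. d n \<in> borel_measurable M"
    and "\<And>n x. x \<in> space M \<Longrightarrow> \<bar>d n x\<bar> \<le> C" and "\<And>x. x \<in> space M \<Longrightarrow> (\<lambda>n. d n x) \<longlonglongrightarrow> 0"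
  shows "(\<lambda>n. LINT x|M. d n x) \<longlonglongrightarrow> 0"
proof -
  interpret finite_measure M by fact
  have "(\<lambda>n. LINT x|M. d n x) \<longlonglongrightarrow> (LINT x|M. 0)"
    by (rule integral_dominated_convergence[where w = "\<lambda>_. C"]) (use assms in \<open>auto intro!: AE_I2\<close>)
  then show ?thesis by simp
qed

text \<open>A nonempty open set is not negligible, so a continuous nonnegative function that vanishes
almost everywhere on an open set vanishes there.\<close>

lemma continuous_nonneg_integral_0:
  fixes h :: "'a::euclidean_space \<Rightarrow> real"
  assumes \<Omega>: "open \<Omega>" and h: "continuous_on \<Omega> h" "\<And>x. x \<in> \<Omega> \<Longrightarrow> h x \<ge> 0"
    and int: "integrable (dom_measure \<Omega>) h" "(LINT x|dom_measure \<Omega>. h x) = 0" and x: "x \<in> \<Omega>"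
  shows "h x = 0"
proof (rule ccontr)
  assume "h x \<noteq> 0"
  define U where "U = \<Omega> \<inter> h -` (- {0})"
  have U: "open U" unfolding U_def using \<Omega> h by (intro continuous_open_preimage) auto
  have "x \<in> U" unfolding U_def using x \<open>h x \<noteq> 0\<close> by simp
  have "AE x in dom_measure \<Omega>. 0 \<le> h x"
    by (rule AE_I2) (simp add: space_restrict_space h)
  then have "AE x in dom_measure \<Omega>. h x = 0"
    using int integral_nonneg_eq_0_iff_AE by blast
  then have "AE x in lborel. x \<in> \<Omega> \<longrightarrow> h x = 0"
    using \<Omega> by (simp add: AE_restrict_space_iff)
  then have "AE x in lborel. x \<notin> U"
    by eventually_elim (auto simp: U_def)
  then have "U \<in> null_sets lborel"
    using U by (subst AE_iff_null_sets) auto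
  then have "negligible U"
    by (simp add: negligible_iff_null_sets null_sets_completionI)
  then show False using open_not_negligible[OF U] \<open>x \<in> U\<close> by blast
qed

section \<open>Testing against Sobolev functions\<close>

definition re_grad :: "('a::euclidean_space \<Rightarrow> 'a \<Rightarrow> complex) \<Rightarrow> 'a \<Rightarrow> 'a"
  where "re_grad F' x = (\<Sum>b\<in>Basis. Re (F' x b) *\<^sub>R b)"

lemma re_grad_inner: "linear (F' x) \<Longrightarrow> v \<bullet> re_grad F' x = Re (F' x v)"
proof -
  assume l: "linear (F' x)"
  have "F' x v = (\<Sum>b\<in>Basis. (v \<bullet> b) *\<^sub>R F' x b)"
    by (metis (no_types, lifting) l euclidean_representation linear_cmul linear_sum sum.cong)
  then show ?thesis by (simp add: re_grad_def inner_sum_right mult.commute)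
qed

lemma GDERIV_re_grad: "has_C1_derivative F F' \<Longrightarrow> GDERIV (\<lambda>x. Re (F x)) x :> re_grad F' x"
proof -
  assume F: "has_C1_derivative F F'"
  then have "((\<lambda>x. Re (F x)) has_derivative (\<lambda>v. Re (F' x v))) (at x)"
    unfolding has_C1_derivative_def by (auto intro!: derivative_eq_intros)
  moreover have "linear (F' x)"
    using F has_derivative_linear unfolding has_C1_derivative_def by blast
  ultimately show ?thesis by (simp add: gderiv_def re_grad_inner)
qed

lemma continuous_re_grad: "has_C1_derivative F F' \<Longrightarrow> continuous_on UNIV (re_grad F')"
  unfolding re_grad_def has_C1_derivative_def by (auto intro!: continuous_intros)

lemma test_functionD:
  assumes "test_function \<Omega> \<phi> \<psi>"
  shows "(\<phi> has_derivative (\<lambda>v. v \<bullet> \<psi> x)) (at x)" "continuous_on UNIV \<phi>" "continuous_on UNIV \<psi>"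
    and "compact (closure {x. \<phi> x \<noteq> 0})" "closure {x. \<phi> x \<noteq> 0} \<subseteq> \<Omega>"
proof -
  show d: "(\<phi> has_derivative (\<lambda>v. v \<bullet> \<psi> x)) (at x)" for x
    using assms unfolding test_function_def gderiv_def by (elim conjE allE)
  show "continuous_on UNIV \<phi>"
    by (rule continuous_at_imp_continuous_on) (simp add: has_derivative_continuous[OF d])
qed (use assms in \<open>auto simp only: test_function_def\<close>)

lemma test_function_zero:
  assumes "test_function \<Omega> \<phi> \<psi>" "x \<notin> closure {x. \<phi> x \<noteq> 0}"
  shows "\<phi> x = 0"
  using assms(2) closure_subset[of "{x. \<phi> x \<noteq> 0}"] by blast

lemma test_function_has_C1_derivative:
  assumes "test_function \<Omega> \<phi> \<psi>"
  shows "has_C1_derivative (\<lambda>x. of_real (\<phi> x)) (\<lambda>x v. of_real (v \<bullet> \<psi> x))"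
    and "compactly_supported (\<lambda>x. of_real (\<phi> x))"
proof -
  show "has_C1_derivative (\<lambda>x. of_real (\<phi> x)) (\<lambda>x v. of_real (v \<bullet> \<psi> x))"
    unfolding has_C1_derivative_def
    by (auto intro!: continuous_intros has_derivative_of_real test_functionD[OF assms])
  show "compactly_supported (\<lambda>x. of_real (\<phi> x))"
    unfolding compactly_supported_def
  proof (intro exI conjI allI impI)
    show "compact (closure {x. \<phi> x \<noteq> 0})" by (rule test_functionD[OF assms])
    fix x assume "x \<notin> closure {x. \<phi> x \<noteq> 0}"
    from test_function_zero[OF assms this] show "complex_of_real (\<phi> x) = 0" by (simp only: of_real_0)
  qed
qed

text \<open>A real test function is a complex one, and taking real parts of the defining identity of a
weak Laplacian turns it into Green's formula on the domain.\<close>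

lemma test_function_weak_laplacian:
  fixes \<Omega> :: "'a::euclidean_space set"
  assumes \<Omega>: "open \<Omega>" "bounded \<Omega>" and t: "test_function \<Omega> \<phi> \<psi>" and F: "has_weak_laplacian F F' L"
  shows "(LINT x|dom_measure \<Omega>. re_grad F' x \<bullet> \<psi> x) + (LINT x|dom_measure \<Omega>. Re (L x) * \<phi> x) = 0"
proof -
  note c1 = test_function_has_C1_derivative[OF t]
  note FD = has_weak_laplacianD[OF F]
  have 0: "\<phi> x = 0 \<and> \<psi> x = 0" if x: "x \<notin> \<Omega>" for x
  proof -
    define U where "U = - closure {x. \<phi> x \<noteq> 0}"
    have U: "x \<in> U" "open U"
      unfolding U_def using test_functionD(5)[OF t] x by auto
    have z: "\<phi> y = 0" if "y \<in> U" for y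
      by (rule test_function_zero[OF t]) (use that U_def in blast)
    have "((\<lambda>_. 0::real) has_derivative (\<lambda>v. v \<bullet> \<psi> x)) (at x)"
      by (rule has_derivative_transform_within_open[OF test_functionD(1)[OF t] U(2,1)]) (rule z)
    from has_derivative_unique[OF this has_derivative_const] have "\<psi> x \<bullet> \<psi> x = 0"
      by (rule fun_cong)
    then show ?thesis using z[OF U(1)] by simp
  qed
  let ?f = "\<lambda>x. grad_dot F' (\<lambda>x v. of_real (v \<bullet> \<psi> x)) x + L x * of_real (\<phi> x)"
  have "Re (grad_dot F' (\<lambda>x v. of_real (v \<bullet> \<psi> x)) x) = re_grad F' x \<bullet> \<psi> x" for x
    by (simp add: grad_dot_def re_grad_def inner_sum_left)
  then have Re: "Re (?f x) = re_grad F' x \<bullet> \<psi> x + Re (L x) * \<phi> x" for x by simp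
  have "(LINT x|lborel. ?f x) = 0" using F c1 unfolding has_weak_laplacian_def by blast
  then have "(LINT x|lborel. Re (?f x)) = 0"
    using weak_laplacian_integrable[OF FD(1,2) c1] by (subst integral_Re) auto
  then have "(LINT x|lborel. re_grad F' x \<bullet> \<psi> x + Re (L x) * \<phi> x) = 0" unfolding Re .
  moreover have "(LINT x|lborel. re_grad F' x \<bullet> \<psi> x + Re (L x) * \<phi> x) =
      (LINT x:\<Omega>|lborel. re_grad F' x \<bullet> \<psi> x + Re (L x) * \<phi> x)"
    unfolding set_lebesgue_integral_def
    by (rule Bochner_Integration.integral_cong) (use 0 in \<open>auto simp: indicator_def\<close>)
  ultimately have e: "(LINT x|dom_measure \<Omega>. re_grad F' x \<bullet> \<psi> x + Re (L x) * \<phi> x) = 0"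
    by (simp add: set_integral_dom_measure[OF \<Omega>(1)])
  have c\<phi>: "continuous_on UNIV \<phi>" "continuous_on UNIV \<psi>"
    by (rule test_functionD[OF t])+
  have c: "continuous_on UNIV (\<lambda>x. Re (L x))" using FD by (intro continuous_intros)
  have "integrable (dom_measure \<Omega>) (\<lambda>x. re_grad F' x \<bullet> \<psi> x)"
    "integrable (dom_measure \<Omega>) (\<lambda>x. Re (L x) \<bullet> \<phi> x)"
    by (intro integrable_inner_square_integrable continuous_square_integrable \<Omega> c c\<phi>
        continuous_re_grad[OF FD(1)])+
  then show ?thesis using e by simp
qed

text \<open>Green's formula passes from test functions to their limits in the Sobolev space, since \<open>L\<close>
and the gradient of \<open>F\<close> are bounded on a bounded domain.\<close>

lemma H10_weak_laplacian:
  fixes \<Omega> :: "'a::euclidean_space set"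
  assumes \<Omega>: "open \<Omega>" "bounded \<Omega>" and w: "H10 \<Omega> w h" and F: "has_weak_laplacian F F' L"
  shows "(LINT x|dom_measure \<Omega>. re_grad F' x \<bullet> h x) = - (LINT x|dom_measure \<Omega>. Re (L x) * w x)"
proof -
  let ?N = "dom_measure \<Omega>"
  note FD = has_weak_laplacianD[OF F]
  have c: "continuous_on UNIV (\<lambda>x. Re (L x))" "continuous_on UNIV (re_grad F')"
    using FD continuous_re_grad by (auto intro!: continuous_intros)
  obtain C1 where C1: "\<And>x. x \<in> \<Omega> \<Longrightarrow> norm (Re (L x)) \<le> C1"
    using continuous_on_bounded_dom[OF \<Omega>(2), of "\<lambda>x. Re (L x)"] c by (metis continuous_on_subset subset_UNIV)
  obtain C2 where C2: "\<And>x. x \<in> \<Omega> \<Longrightarrow> norm (re_grad F' x) \<le> C2"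
    using continuous_on_bounded_dom[OF \<Omega>(2), of "re_grad F'"] c by (metis continuous_on_subset subset_UNIV)
  obtain \<phi> \<psi> where t: "\<And>n::nat. test_function \<Omega> (\<phi> n) (\<psi> n)"
    and l1: "(\<lambda>n. LINT x|?N. (norm (\<phi> n x - w x))\<^sup>2) \<longlonglongrightarrow> 0"
    and l2: "(\<lambda>n. LINT x|?N. (norm (\<psi> n x - h x))\<^sup>2) \<longlonglongrightarrow> 0"
    using w unfolding H10_def set_integral_dom_measure[OF \<Omega>(1)] by auto
  have w2: "w \<in> borel_measurable ?N" "integrable ?N (\<lambda>x. (norm (w x))\<^sup>2)"
    and h2: "h \<in> borel_measurable ?N" "integrable ?N (\<lambda>x. (norm (h x))\<^sup>2)"
    using w unfolding H10_def square_integrable_on_iff[OF \<Omega>(1)] by auto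
  have ct: "continuous_on UNIV (\<phi> n)" "continuous_on UNIV (\<psi> n)" for n
    by (rule test_functionD[OF t])+
  note \<phi>2 = continuous_square_integrable[OF \<Omega> ct(1)] and \<psi>2 = continuous_square_integrable[OF \<Omega> ct(2)]
    and L2 = continuous_square_integrable[OF \<Omega> c(1)] and V2 = continuous_square_integrable[OF \<Omega> c(2)]
  have "(\<lambda>n. LINT x|?N. Re (L x) \<bullet> (\<phi> n x - w x)) \<longlonglongrightarrow> 0"
    by (rule integral_inner_bounded_tendsto_0[where C = C1])
       (use \<Omega> C1 L2 \<phi>2 w2 l1 in \<open>auto intro: finite_measure_dom_measure integrable_square_diff
          simp: space_restrict_space simp del: real_norm_def\<close>)
  moreover have "(LINT x|?N. Re (L x) \<bullet> (\<phi> n x - w x)) =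
      (LINT x|?N. Re (L x) * \<phi> n x) - (LINT x|?N. Re (L x) * w x)" for n
    using integrable_inner_square_integrable[OF L2(1,2) \<phi>2(1,2)[of n]]
      integrable_inner_square_integrable[OF L2(1,2) w2]
    by (simp add: right_diff_distrib)
  ultimately have A: "(\<lambda>n. LINT x|?N. Re (L x) * \<phi> n x) \<longlonglongrightarrow> (LINT x|?N. Re (L x) * w x)"
    by (simp add: LIM_zero_iff)
  have "(\<lambda>n. LINT x|?N. re_grad F' x \<bullet> (\<psi> n x - h x)) \<longlonglongrightarrow> 0"
    by (rule integral_inner_bounded_tendsto_0[where C = C2])
       (use \<Omega> C2 V2 \<psi>2 h2 l2 in \<open>auto intro: finite_measure_dom_measure integrable_square_diff
          simp: space_restrict_space\<close>)
  moreover have "(LINT x|?N. re_grad F' x \<bullet> (\<psi> n x - h x)) =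
      (LINT x|?N. re_grad F' x \<bullet> \<psi> n x) - (LINT x|?N. re_grad F' x \<bullet> h x)" for n
    using integrable_inner_square_integrable[OF V2(1,2) \<psi>2(1,2)[of n]]
      integrable_inner_square_integrable[OF V2(1,2) h2]
    by (simp add: inner_diff_right)
  ultimately have B: "(\<lambda>n. LINT x|?N. re_grad F' x \<bullet> \<psi> n x) \<longlonglongrightarrow> (LINT x|?N. re_grad F' x \<bullet> h x)"
    by (simp add: LIM_zero_iff)
  have "(\<lambda>n. LINT x|?N. re_grad F' x \<bullet> \<psi> n x) = (\<lambda>n. - (LINT x|?N. Re (L x) * \<phi> n x))"
    using test_function_weak_laplacian[OF \<Omega> t F] by (auto simp: eq_neg_iff_add_eq_0)
  then have "(\<lambda>n. - (LINT x|?N. Re (L x) * \<phi> n x)) \<longlonglongrightarrow> (LINT x|?N. re_grad F' x \<bullet> h x)"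
    using B by (simp only:)
  then show ?thesis by (rule LIMSEQ_unique) (rule tendsto_minus[OF A])
qed

text \<open>The weak gradient only sees the values inside the domain; eigenfunctions are required to
vanish outside, whereas the explicit formulas do not.\<close>

lemma H10_cong:
  assumes \<Omega>: "open \<Omega>" and eq: "\<And>x. x \<in> \<Omega> \<Longrightarrow> u x = w x" and H: "H10 \<Omega> u g"
  shows "H10 \<Omega> w g"
proof -
  have "(LINT x:\<Omega>|lborel. (\<phi> x - u x)\<^sup>2) = (LINT x:\<Omega>|lborel. (\<phi> x - w x)\<^sup>2)" for \<phi>
    unfolding set_lebesgue_integral_def
    by (rule Bochner_Integration.integral_cong) (auto simp: indicator_def eq)
  moreover have "square_integrable_on w \<Omega>"
  proof -
    have "u \<in> borel_measurable (dom_measure \<Omega>)" "integrable (dom_measure \<Omega>) (\<lambda>x. (norm (u x))\<^sup>2)"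
      using H unfolding H10_def square_integrable_on_iff[OF \<Omega>] by auto
    moreover have "u \<in> borel_measurable (dom_measure \<Omega>) \<longleftrightarrow> w \<in> borel_measurable (dom_measure \<Omega>)"
      by (rule measurable_cong) (simp add: space_restrict_space eq)
    moreover have "integrable (dom_measure \<Omega>) (\<lambda>x. (norm (u x))\<^sup>2) \<longleftrightarrow>
        integrable (dom_measure \<Omega>) (\<lambda>x. (norm (w x))\<^sup>2)"
      by (rule Bochner_Integration.integrable_cong) (simp_all add: space_restrict_space eq)
    ultimately show ?thesis unfolding square_integrable_on_iff[OF \<Omega>] by simp
  qed
  ultimately show ?thesis using H unfolding H10_def by simp
qed

section \<open>Products with a function vanishing on the boundary\<close>

text \<open>A \<open>C\<^sup>1\<close> approximation of the identity on the positive reals that vanishes up to \<open>e\<close>.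
Composed with a function that is positive inside a domain and zero on its boundary, it produces
compact support.\<close>

definition cutoff :: "real \<Rightarrow> real \<Rightarrow> real"
  where "cutoff e t = (if t \<le> e then 0 else (t - e)\<^sup>2 / t)"

definition cutoff_deriv :: "real \<Rightarrow> real \<Rightarrow> real"
  where "cutoff_deriv e t = (if t \<le> e then 0 else 1 - e\<^sup>2 / t\<^sup>2)"

text \<open>The two branches fit together at \<open>t = e\<close> because \<open>(t - e)\<^sup>2 / t\<close> is of second order
there.\<close>

lemma cutoff_has_derivative:
  assumes e: "e > 0"
  shows "(cutoff e has_real_derivative cutoff_deriv e t) (at t)"
proof -
  consider "t < e" | "t = e" | "t > e" by linarith
  then show ?thesis
  proof cases
    case 1
    have "((\<lambda>_. 0) has_real_derivative 0) (at t)" by simp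
    then have "(cutoff e has_real_derivative 0) (at t)"
      by (rule has_field_derivative_transform_within_open[where S = "{..<e}"])
         (use 1 in \<open>auto simp: cutoff_def\<close>)
    then show ?thesis using 1 by (simp add: cutoff_deriv_def)
  next
    case 2
    have "(cutoff e has_derivative (*) 0) (at e)"
    proof (rule has_derivativeI_sandwich[where e = 1 and H = "\<lambda>y. \<bar>y - e\<bar> / e"])
      fix y :: real
      assume "y \<noteq> e"
      show "norm (cutoff e y - cutoff e e - 0 * (y - e)) / norm (y - e) \<le> \<bar>y - e\<bar> / e"
      proof (cases "y \<le> e")
        case True
        then show ?thesis using e by (simp add: cutoff_def)
      next
        case False
        then have "norm (cutoff e y - cutoff e e - 0 * (y - e)) / norm (y - e) = (y - e) / y"
          using e by (simp add: cutoff_def power2_eq_square)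
        also have "\<dots> \<le> (y - e) / e" using False e by (simp add: frac_le)
        finally show ?thesis using False by simp
      qed
    next
      have "((\<lambda>y. \<bar>y - e\<bar> / e) \<longlongrightarrow> \<bar>e - e\<bar> / e) (at e)"
        using e by (intro tendsto_intros) simp
      then show "((\<lambda>y. \<bar>y - e\<bar> / e) \<longlongrightarrow> 0) (at e)" by simp
    next
      show "bounded_linear ((*) (0::real))" by (rule bounded_linear_mult_right)
    qed simp
    moreover have "cutoff_deriv e e = 0" by (simp add: cutoff_deriv_def)
    ultimately show ?thesis unfolding has_field_derivative_def 2 by (simp only:)
  next
    case 3
    have "((\<lambda>t. (t - e)\<^sup>2 / t) has_real_derivative (2 * (t - e) * t - (t - e)\<^sup>2) / (t * t)) (at t)"
      using 3 e by (auto intro!: derivative_eq_intros)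
    also have "(2 * (t - e) * t - (t - e)\<^sup>2) / (t * t) = 1 - e\<^sup>2 / t\<^sup>2"
      using 3 e by (simp add: field_simps power2_eq_square)
    finally have "(cutoff e has_real_derivative 1 - e\<^sup>2 / t\<^sup>2) (at t)"
      by (rule has_field_derivative_transform_within_open[where S = "{e<..}"])
         (use 3 in \<open>auto simp: cutoff_def\<close>)
    then show ?thesis using 3 by (simp add: cutoff_deriv_def)
  qed
qed

lemma continuous_cutoff_deriv:
  assumes e: "e > 0"
  shows "continuous_on UNIV (cutoff_deriv e)"
proof -
  have "cutoff_deriv e = (\<lambda>t. 1 - e\<^sup>2 / (max t e)\<^sup>2)"
    using e by (auto simp: cutoff_deriv_def fun_eq_iff max_def)
  moreover have "continuous_on UNIV (\<lambda>t. 1 - e\<^sup>2 / (max t e)\<^sup>2)"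
    using e by (intro continuous_intros) (auto simp: max_def)
  ultimately show ?thesis by simp
qed

lemma cutoff_bounds:
  assumes "e > 0" "t > 0"
  shows "\<bar>cutoff e t - t\<bar> \<le> 2 * e" "\<bar>cutoff_deriv e t - 1\<bar> \<le> 1"
proof -
  show "\<bar>cutoff e t - t\<bar> \<le> 2 * e"
  proof (cases "t \<le> e")
    case False
    have "(t - e)\<^sup>2 / t - t = e * (e / t) - 2 * e"
      using assms by (simp add: field_simps power2_eq_square)
    moreover have "0 \<le> e * (e / t)" using assms by simp
    moreover have "e * (e / t) \<le> e * 1" using assms False by (intro mult_left_mono) auto
    ultimately show ?thesis using False by (simp add: cutoff_def)
  qed (use assms in \<open>simp add: cutoff_def\<close>)
  show "\<bar>cutoff_deriv e t - 1\<bar> \<le> 1"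
    using assms by (auto simp: cutoff_deriv_def power_mono)
qed

lemma cutoff_tendsto:
  assumes t: "t > 0"
  shows "(\<lambda>n. cutoff (1 / real (Suc n)) t) \<longlonglongrightarrow> t"
    and "(\<lambda>n. cutoff_deriv (1 / real (Suc n)) t) \<longlonglongrightarrow> 1"
proof -
  have e0: "(\<lambda>n. 1 / real (Suc n)) \<longlonglongrightarrow> 0"
    using LIMSEQ_inverse_real_of_nat by (simp add: inverse_eq_divide)
  have "(\<lambda>n. (1 / real (Suc n))\<^sup>2 / t\<^sup>2) \<longlonglongrightarrow> 0\<^sup>2 / t\<^sup>2"
    using t by (intro tendsto_intros e0) simp
  then have "(\<lambda>n. 1 - (1 / real (Suc n))\<^sup>2 / t\<^sup>2) \<longlonglongrightarrow> 1 - 0"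
    by (intro tendsto_intros) simp
  moreover have "\<forall>\<^sub>F n in sequentially. 1 / real (Suc n) < t"
    using order_tendstoD(2)[OF e0 t] .
  then have "\<forall>\<^sub>F n in sequentially. 1 - (1 / real (Suc n))\<^sup>2 / t\<^sup>2 = cutoff_deriv (1 / real (Suc n)) t"
    by eventually_elim (simp add: cutoff_deriv_def)
  ultimately show "(\<lambda>n. cutoff_deriv (1 / real (Suc n)) t) \<longlonglongrightarrow> 1"
    by (simp add: Lim_transform_eventually)
  have g: "(\<lambda>n. 2 * (1 / real (Suc n))) \<longlonglongrightarrow> 0" using tendsto_mult_left[OF e0, of 2] by simp
  have "\<forall>\<^sub>F n in sequentially. norm (cutoff (1 / real (Suc n)) t - t) \<le> 2 * (1 / real (Suc n))"
  proof (intro always_eventually allI)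
    show "norm (cutoff (1 / real (Suc n)) t - t) \<le> 2 * (1 / real (Suc n))" for n
      using cutoff_bounds(1)[of "1 / real (Suc n)" t] t by simp
  qed
  then have "(\<lambda>n. cutoff (1 / real (Suc n)) t - t) \<longlonglongrightarrow> 0"
    by (rule Lim_null_comparison) (rule g)
  then show "(\<lambda>n. cutoff (1 / real (Suc n)) t) \<longlonglongrightarrow> t" by (simp add: LIM_zero_iff)
qed

text \<open>The approximating test functions are \<open>cutoff (1 / (n + 1)) (\<rho> x) * P x\<close>. Placing the
cut-off on the positive factor \<open>\<rho>\<close>, rather than on the product, avoids the zeros of \<open>P\<close> inside
the domain, where the derivative of the cut-off would not tend to \<open>1\<close>.\<close>

lemma H10_product_vanishing_on_frontier:
  fixes \<Omega> :: "'a::euclidean_space set"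
  assumes \<Omega>: "open \<Omega>" "bounded \<Omega>"
    and \<rho>: "\<And>x. GDERIV \<rho> x :> \<rho>' x" "continuous_on UNIV \<rho>'"
    and P: "\<And>x. GDERIV P x :> P' x" "continuous_on UNIV P'"
    and pos: "\<And>x. x \<in> \<Omega> \<Longrightarrow> \<rho> x > 0"
    and zero: "\<And>x. x \<in> frontier \<Omega> \<Longrightarrow> \<rho> x = 0"
  shows "H10 \<Omega> (\<lambda>x. \<rho> x * P x) (\<lambda>x. \<rho> x *\<^sub>R P' x + P x *\<^sub>R \<rho>' x)"
proof -
  let ?N = "dom_measure \<Omega>"
  interpret finite_measure ?N by (rule finite_measure_dom_measure[OF \<Omega>])
  have c\<rho>: "continuous_on UNIV \<rho>" and cP: "continuous_on UNIV P"
    using \<rho>(1) P(1) unfolding gderiv_def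
    by (auto intro!: continuous_at_imp_continuous_on intro: has_derivative_continuous)
  have bdd: "\<exists>C\<ge>0. \<forall>x\<in>\<Omega>. norm (f x) \<le> C" if "continuous_on UNIV f" for f :: "'a \<Rightarrow> 'c::euclidean_space"
    using continuous_on_bounded_dom[OF \<Omega>(2) continuous_on_subset[OF that]] by (metis subset_UNIV)
  obtain CP where CP: "CP \<ge> 0" "\<And>x. x \<in> \<Omega> \<Longrightarrow> norm (P x) \<le> CP" using bdd[OF cP] by blast
  obtain C\<rho>' where C\<rho>': "C\<rho>' \<ge> 0" "\<And>x. x \<in> \<Omega> \<Longrightarrow> norm (\<rho>' x) \<le> C\<rho>'" using bdd[OF \<rho>(2)] by blast
  obtain CP' where CP': "CP' \<ge> 0" "\<And>x. x \<in> \<Omega> \<Longrightarrow> norm (P' x) \<le> CP'" using bdd[OF P(2)] by blast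
  define e where "e n = 1 / real (Suc n)" for n
  have e: "e n > 0" "e n \<le> 1" for n unfolding e_def by auto
  define \<phi> where "\<phi> n x = (if x \<in> \<Omega> then cutoff (e n) (\<rho> x) * P x else 0)" for n x
  define \<psi> where "\<psi> n x = (if x \<in> \<Omega> then cutoff (e n) (\<rho> x) *\<^sub>R P' x
      + P x *\<^sub>R (cutoff_deriv (e n) (\<rho> x) *\<^sub>R \<rho>' x) else 0)" for n x
  have c_cut: "continuous_on UNIV (cutoff (e n))" for n
    using cutoff_has_derivative[OF e(1)] by (meson DERIV_isCont continuous_at_imp_continuous_on)
  have c1: "continuous_on UNIV (\<lambda>x. cutoff (e n) (\<rho> x))" for n
    by (rule continuous_on_compose2[OF c_cut c\<rho>]) simp
  have c2: "continuous_on UNIV (\<lambda>x. cutoff_deriv (e n) (\<rho> x))" for n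
    by (rule continuous_on_compose2[OF continuous_cutoff_deriv[OF e(1)] c\<rho>]) simp
  define K where "K n = closure \<Omega> \<inter> {x. e n \<le> \<rho> x}" for n
  have K: "compact (K n)" for n
    unfolding K_def using \<Omega>(2) c\<rho>
    by (intro compact_Int_closed closed_Collect_le) (auto intro: continuous_intros)
  have K\<Omega>: "K n \<subseteq> \<Omega>" for n
  proof
    fix x assume x: "x \<in> K n"
    show "x \<in> \<Omega>"
    proof (rule ccontr)
      assume "x \<notin> \<Omega>"
      then have "x \<in> frontier \<Omega>" using x \<Omega>(1) unfolding K_def frontier_def by (auto simp: interior_open)
      then show False using zero x e(1)[of n] unfolding K_def by auto
    qed
  qed
  have out: "\<phi> n x = 0 \<and> \<psi> n x = 0" if "x \<in> - K n" for n x
  proof (cases "x \<in> \<Omega>")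
    case True
    then have "\<rho> x < e n" using that closure_subset[of \<Omega>] unfolding K_def by auto
    then show ?thesis by (simp add: \<phi>_def \<psi>_def cutoff_def cutoff_deriv_def)
  qed (simp add: \<phi>_def \<psi>_def)
  have oK: "open (- K n)" for n using K by (simp add: compact_imp_closed open_Compl)
  have test: "test_function \<Omega> (\<phi> n) (\<psi> n)" for n
    unfolding test_function_def
  proof (intro conjI allI)
    fix x
    show "GDERIV (\<phi> n) x :> \<psi> n x"
    proof (cases "x \<in> \<Omega>")
      case True
      have "GDERIV (\<lambda>x. cutoff (e n) (\<rho> x) * P x) x :> \<psi> n x"
        using True GDERIV_mult[OF GDERIV_DERIV_compose[OF \<rho>(1) cutoff_has_derivative[OF e(1)]] P(1)]
        by (simp add: \<psi>_def)
      then show ?thesis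
        unfolding gderiv_def
        by (rule has_derivative_transform_within_open[OF _ \<Omega>(1) True]) (simp add: \<phi>_def)
    next
      case False
      then have x: "x \<in> - K n" using K\<Omega> by auto
      have "((\<lambda>_. 0) has_derivative (\<lambda>h. h \<bullet> \<psi> n x)) (at x)" using out[OF x] by simp
      then show "GDERIV (\<phi> n) x :> \<psi> n x"
        unfolding gderiv_def
        by (rule has_derivative_transform_within_open[OF _ oK x]) (use out in auto)
    qed
  next
    have "continuous_on \<Omega> (\<lambda>x. cutoff (e n) (\<rho> x) *\<^sub>R P' x + P x *\<^sub>R (cutoff_deriv (e n) (\<rho> x) *\<^sub>R \<rho>' x))"
      using c1 c2 \<rho>(2) P(2) cP by (intro continuous_intros) (auto intro: continuous_on_subset)
    then have "continuous_on \<Omega> (\<psi> n)"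
      by (rule continuous_on_eq) (simp add: \<psi>_def)
    moreover have "continuous_on (- K n) (\<psi> n)"
      by (rule continuous_on_eq[of _ "\<lambda>_. 0"]) (use out in auto)
    ultimately have "continuous_on (\<Omega> \<union> - K n) (\<psi> n)"
      by (rule continuous_on_open_Un[OF \<Omega>(1) oK])
    moreover have "\<Omega> \<union> - K n = UNIV" using K\<Omega> by auto
    ultimately show "continuous_on UNIV (\<psi> n)" by simp
  next
    have "{x. \<phi> n x \<noteq> 0} \<subseteq> K n" using out by auto
    then have cl: "closure {x. \<phi> n x \<noteq> 0} \<subseteq> K n"
      using K by (simp add: closure_minimal compact_imp_closed)
    then show "closure {x. \<phi> n x \<noteq> 0} \<subseteq> \<Omega>" using K\<Omega> by blast
    show "compact (closure {x. \<phi> n x \<noteq> 0})"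
      using cl K compact_eq_bounded_closed bounded_subset by (metis closed_closure)
  qed
  have m: "f \<in> borel_measurable ?N" if "continuous_on UNIV f" for f :: "'a \<Rightarrow> 'c::euclidean_space"
    by (rule continuous_square_integrable[OF \<Omega> that])
  have lim: "(\<lambda>n. cutoff (e n) (\<rho> x)) \<longlonglongrightarrow> \<rho> x" "(\<lambda>n. cutoff_deriv (e n) (\<rho> x)) \<longlonglongrightarrow> 1" if "x \<in> \<Omega>" for x
    using cutoff_tendsto[OF pos[OF that]] unfolding e_def .
  have L1: "(\<lambda>n. LINT x|?N. (\<phi> n x - \<rho> x * P x)\<^sup>2) \<longlonglongrightarrow> 0"
  proof (rule integral_tendsto_0_bounded[where C = "(2 * CP)\<^sup>2"])
    show "(\<lambda>x. (\<phi> n x - \<rho> x * P x)\<^sup>2) \<in> borel_measurable ?N" for n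
      using m[OF test_functionD(2)[OF test]] m[OF c\<rho>] m[OF cP] by measurable
    fix x assume "x \<in> space ?N"
    then have x: "x \<in> \<Omega>" by (simp add: space_restrict_space)
    show "(\<lambda>n. (\<phi> n x - \<rho> x * P x)\<^sup>2) \<longlonglongrightarrow> 0"
      using x by (auto simp: \<phi>_def intro!: tendsto_eq_intros lim)
    fix n
    have "\<bar>\<phi> n x - \<rho> x * P x\<bar> = \<bar>cutoff (e n) (\<rho> x) - \<rho> x\<bar> * \<bar>P x\<bar>"
      using x by (simp add: \<phi>_def abs_mult flip: left_diff_distrib)
    also have "\<dots> \<le> 2 * CP"
      using cutoff_bounds(1)[OF e(1)[of n] pos[OF x]] e(2)[of n] CP(2)[OF x]
      by (intro mult_mono) auto
    finally have "\<bar>\<phi> n x - \<rho> x * P x\<bar>\<^sup>2 \<le> (2 * CP)\<^sup>2"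
      by (rule power_mono) simp
    then show "\<bar>(\<phi> n x - \<rho> x * P x)\<^sup>2\<bar> \<le> (2 * CP)\<^sup>2"
      by (simp only: power2_abs abs_power2)
  qed (rule finite_measure_axioms)
  have L2: "(\<lambda>n. LINT x|?N. (norm (\<psi> n x - (\<rho> x *\<^sub>R P' x + P x *\<^sub>R \<rho>' x)))\<^sup>2) \<longlonglongrightarrow> 0"
  proof (rule integral_tendsto_0_bounded[where C = "(2 * CP' + CP * C\<rho>')\<^sup>2"])
    show "(\<lambda>x. (norm (\<psi> n x - (\<rho> x *\<^sub>R P' x + P x *\<^sub>R \<rho>' x)))\<^sup>2) \<in> borel_measurable ?N" for n
      using m[OF test_functionD(3)[OF test]] m[OF c\<rho>] m[OF cP] m[OF P(2)] m[OF \<rho>(2)] by measurable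
    fix x assume "x \<in> space ?N"
    then have x: "x \<in> \<Omega>" by (simp add: space_restrict_space)
    have d: "\<psi> n x - (\<rho> x *\<^sub>R P' x + P x *\<^sub>R \<rho>' x) =
        (cutoff (e n) (\<rho> x) - \<rho> x) *\<^sub>R P' x + (P x * (cutoff_deriv (e n) (\<rho> x) - 1)) *\<^sub>R \<rho>' x" for n
      using x by (simp add: \<psi>_def algebra_simps)
    show "(\<lambda>n. (norm (\<psi> n x - (\<rho> x *\<^sub>R P' x + P x *\<^sub>R \<rho>' x)))\<^sup>2) \<longlonglongrightarrow> 0"
      unfolding d using x by (auto intro!: tendsto_eq_intros lim)
    fix n
    have "norm (\<psi> n x - (\<rho> x *\<^sub>R P' x + P x *\<^sub>R \<rho>' x)) \<le>
        \<bar>cutoff (e n) (\<rho> x) - \<rho> x\<bar> * norm (P' x) + (\<bar>P x\<bar> * \<bar>cutoff_deriv (e n) (\<rho> x) - 1\<bar>) * norm (\<rho>' x)"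
      unfolding d by (rule order_trans[OF norm_triangle_ineq]) (simp add: abs_mult)
    also have "\<dots> \<le> 2 * CP' + (CP * 1) * C\<rho>'"
      using cutoff_bounds[OF e(1)[of n] pos[OF x]] e(2)[of n] CP(1) CP(2)[OF x] CP'(2)[OF x] C\<rho>'(2)[OF x]
      by (intro add_mono mult_mono) auto
    finally show "\<bar>(norm (\<psi> n x - (\<rho> x *\<^sub>R P' x + P x *\<^sub>R \<rho>' x)))\<^sup>2\<bar> \<le> (2 * CP' + CP * C\<rho>')\<^sup>2"
      by (simp add: power_mono)
  qed (rule finite_measure_axioms)
  have "square_integrable_on (\<lambda>x. \<rho> x * P x) \<Omega>"
    "square_integrable_on (\<lambda>x. \<rho> x *\<^sub>R P' x + P x *\<^sub>R \<rho>' x) \<Omega>"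
    by (intro continuous_square_integrable \<Omega> continuous_intros c\<rho> cP \<rho> P)+
  then show ?thesis
    unfolding H10_def set_integral_dom_measure[OF \<Omega>(1)] using test L1 L2 by blast
qed

section \<open>Weyl denominator and fundamental character of SU(3)\<close>

text \<open>The common squared length of the three weights, and the unit in which the eigenvalues of
the triangle are integers.\<close>

definition eig_unit :: real where "eig_unit = 16 * pi\<^sup>2 / 9"

text \<open>The three weights of the standard representation of SU(3): vectors of equal length at
mutual angles of 120 degrees, scaled so that the alcove becomes the triangle of side \<open>1\<close>.\<close>

definition weight1 :: "real^2" where "weight1 = vector [4 * pi / 3, 0]"
definition weight2 :: "real^2" where "weight2 = vector [- (2 * pi / 3), 2 * pi * sqrt 3 / 3]"
definition weight3 :: "real^2" where "weight3 = - (weight1 + weight2)"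

lemma inner_weight:
  "weight1 \<bullet> weight1 = eig_unit" "weight2 \<bullet> weight2 = eig_unit" "weight3 \<bullet> weight3 = eig_unit"
  "weight1 \<bullet> weight2 = - eig_unit / 2" "weight2 \<bullet> weight1 = - eig_unit / 2"
  "weight1 \<bullet> weight3 = - eig_unit / 2" "weight3 \<bullet> weight1 = - eig_unit / 2"
  "weight2 \<bullet> weight3 = - eig_unit / 2" "weight3 \<bullet> weight2 = - eig_unit / 2"
proof -
  show 11: "weight1 \<bullet> weight1 = eig_unit" and 12: "weight1 \<bullet> weight2 = - eig_unit / 2" and 22: "weight2 \<bullet> weight2 = eig_unit"
    by (simp_all add: inner_vec_def sum_2 weight1_def weight2_def eig_unit_def power2_eq_square field_simps)
  then show 21: "weight2 \<bullet> weight1 = - eig_unit / 2" by (simp add: inner_commute)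
  show "weight3 \<bullet> weight3 = eig_unit" "weight1 \<bullet> weight3 = - eig_unit / 2" "weight3 \<bullet> weight1 = - eig_unit / 2"
    "weight2 \<bullet> weight3 = - eig_unit / 2" "weight3 \<bullet> weight2 = - eig_unit / 2"
    unfolding weight3_def inner_minus_left inner_minus_right inner_add_left inner_add_right 11 12 22 21
    by (simp_all add: field_simps)
qed

text \<open>The character of the standard representation of SU(3), restricted to the maximal torus.\<close>

definition fund_char :: "real^2 \<Rightarrow> complex"
  where "fund_char x = plane_wave weight1 x + plane_wave weight2 x + plane_wave weight3 x"

definition fund_char_deriv :: "real^2 \<Rightarrow> real^2 \<Rightarrow> complex"
  where "fund_char_deriv = (\<lambda>x v. plane_wave_deriv weight1 x v + plane_wave_deriv weight2 x v + plane_wave_deriv weight3 x v)"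

text \<open>The alternating sum of the plane waves in the Weyl group orbit of the Weyl vector. As the
plane waves of the three weights multiply to \<open>1\<close>, it is the Vandermonde product of these three
numbers up to sign.\<close>

definition vandermonde :: "real^2 \<Rightarrow> complex"
  where "vandermonde x = plane_wave (weight1 - weight2) x - plane_wave (weight2 - weight1) x
    + plane_wave (weight2 - weight3) x - plane_wave (weight3 - weight2) x
    + plane_wave (weight3 - weight1) x - plane_wave (weight1 - weight3) x"

definition vandermonde_deriv :: "real^2 \<Rightarrow> real^2 \<Rightarrow> complex"
  where "vandermonde_deriv = (\<lambda>x v. plane_wave_deriv (weight1 - weight2) x v - plane_wave_deriv (weight2 - weight1) x v
    + plane_wave_deriv (weight2 - weight3) x v - plane_wave_deriv (weight3 - weight2) x v
    + plane_wave_deriv (weight3 - weight1) x v - plane_wave_deriv (weight1 - weight3) x v)"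

text \<open>The factor makes the Weyl denominator real, and positive in the triangle.\<close>

definition weyl_denom :: "real^2 \<Rightarrow> complex"
  where "weyl_denom x = inverse (2 * \<i>) * vandermonde x"

definition weyl_denom_deriv :: "real^2 \<Rightarrow> real^2 \<Rightarrow> complex"
  where "weyl_denom_deriv = (\<lambda>x v. inverse (2 * \<i>) * vandermonde_deriv x v)"

lemma plane_wave_weight_prod: "plane_wave weight1 x * plane_wave weight2 x * plane_wave weight3 x = 1"
  by (simp add: plane_wave_mult weight3_def) (simp add: plane_wave_def)

text \<open>With \<open>weight1 + weight2 + weight3 = 0\<close>, every plane wave that occurs is a monomial in
those of the three weights. This reduces the gradient identities below to polynomial
identities.\<close>

lemma plane_wave_diffs:
  "plane_wave (weight1 - weight2) x = (plane_wave weight1 x)\<^sup>2 * plane_wave weight3 x"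
  "plane_wave (weight2 - weight1) x = (plane_wave weight2 x)\<^sup>2 * plane_wave weight3 x"
  "plane_wave (weight2 - weight3) x = (plane_wave weight2 x)\<^sup>2 * plane_wave weight1 x"
  "plane_wave (weight3 - weight2) x = (plane_wave weight3 x)\<^sup>2 * plane_wave weight1 x"
  "plane_wave (weight3 - weight1) x = (plane_wave weight3 x)\<^sup>2 * plane_wave weight2 x"
  "plane_wave (weight1 - weight3) x = (plane_wave weight1 x)\<^sup>2 * plane_wave weight2 x"
  "plane_wave (- weight1) x = plane_wave weight2 x * plane_wave weight3 x"
  "plane_wave (- weight2) x = plane_wave weight1 x * plane_wave weight3 x"
  "plane_wave (- weight3) x = plane_wave weight1 x * plane_wave weight2 x"
  by (simp_all add: power2_eq_square plane_wave_mult weight3_def algebra_simps)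

lemma cnj_fund_char:
  "cnj (fund_char x) = plane_wave weight1 x * plane_wave weight2 x + plane_wave weight2 x * plane_wave weight3 x
    + plane_wave weight1 x * plane_wave weight3 x"
  by (simp add: fund_char_def cnj_plane_wave plane_wave_diffs)

lemma has_weak_laplacian_fund_char:
  "has_weak_laplacian fund_char fund_char_deriv (\<lambda>x. - of_real eig_unit * fund_char x)"
proof -
  have "has_weak_laplacian (\<lambda>x. plane_wave weight1 x + plane_wave weight2 x + plane_wave weight3 x) fund_char_deriv
    (\<lambda>x. - of_real (weight1 \<bullet> weight1) * plane_wave weight1 x + - of_real (weight2 \<bullet> weight2) * plane_wave weight2 x
      + - of_real (weight3 \<bullet> weight3) * plane_wave weight3 x)"
    unfolding fund_char_deriv_def by (intro has_weak_laplacian_add has_weak_laplacian_plane_wave)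
  then show ?thesis unfolding inner_weight fund_char_def[abs_def] by (simp add: algebra_simps)
qed

lemma inner_weight_diff:
  "(weight1 - weight2) \<bullet> (weight1 - weight2) = 3 * eig_unit" "(weight2 - weight1) \<bullet> (weight2 - weight1) = 3 * eig_unit"
  "(weight2 - weight3) \<bullet> (weight2 - weight3) = 3 * eig_unit" "(weight3 - weight2) \<bullet> (weight3 - weight2) = 3 * eig_unit"
  "(weight3 - weight1) \<bullet> (weight3 - weight1) = 3 * eig_unit" "(weight1 - weight3) \<bullet> (weight1 - weight3) = 3 * eig_unit"
  by (simp_all add: inner_diff_left inner_diff_right inner_weight)

lemma has_weak_laplacian_weyl_denom:
  "has_weak_laplacian weyl_denom weyl_denom_deriv (\<lambda>x. - of_real (3 * eig_unit) * weyl_denom x)"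
proof -
  have "has_weak_laplacian (\<lambda>x. inverse (2 * \<i>) * (plane_wave (weight1 - weight2) x - plane_wave (weight2 - weight1) x
    + plane_wave (weight2 - weight3) x - plane_wave (weight3 - weight2) x
    + plane_wave (weight3 - weight1) x - plane_wave (weight1 - weight3) x)) weyl_denom_deriv
    (\<lambda>x. inverse (2 * \<i>) * (- of_real ((weight1 - weight2) \<bullet> (weight1 - weight2)) * plane_wave (weight1 - weight2) x
     - (- of_real ((weight2 - weight1) \<bullet> (weight2 - weight1)) * plane_wave (weight2 - weight1) x)
     + - of_real ((weight2 - weight3) \<bullet> (weight2 - weight3)) * plane_wave (weight2 - weight3) x
     - (- of_real ((weight3 - weight2) \<bullet> (weight3 - weight2)) * plane_wave (weight3 - weight2) x)
     + - of_real ((weight3 - weight1) \<bullet> (weight3 - weight1)) * plane_wave (weight3 - weight1) x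
     - (- of_real ((weight1 - weight3) \<bullet> (weight1 - weight3)) * plane_wave (weight1 - weight3) x)))"
    unfolding weyl_denom_deriv_def vandermonde_deriv_def
    by (intro has_weak_laplacian_cmult has_weak_laplacian_add has_weak_laplacian_diff has_weak_laplacian_plane_wave)
  then show ?thesis
    unfolding inner_weight_diff weyl_denom_def[abs_def] vandermonde_def by (simp add: algebra_simps)
qed

lemma grad_dot_char_char:
  "grad_dot fund_char_deriv fund_char_deriv x = - of_real eig_unit * ((fund_char x)\<^sup>2 - 3 * cnj (fund_char x))"
  unfolding cnj_fund_char unfolding fund_char_deriv_def fund_char_def
  by (simp add: grad_dot_add grad_dot_add_right grad_dot_plane_wave inner_weight) algebra

lemma grad_dot_char_cnj_char:
  "grad_dot fund_char_deriv (\<lambda>x v. cnj (fund_char_deriv x v)) x =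
    of_real eig_unit / 2 * (9 - fund_char x * cnj (fund_char x))"
  unfolding cnj_fund_char unfolding fund_char_deriv_def fund_char_def complex_cnj_add cnj_plane_wave_deriv
  using plane_wave_weight_prod[of x]
  by (simp add: grad_dot_add grad_dot_add_right grad_dot_plane_wave inner_weight plane_wave_diffs) algebra

lemma grad_dot_vandermonde_char:
  "2 * grad_dot vandermonde_deriv fund_char_deriv x = - 3 * of_real eig_unit * vandermonde x * fund_char x"
  unfolding vandermonde_deriv_def fund_char_deriv_def fund_char_def vandermonde_def
  by (simp add: grad_dot_add grad_dot_add_right grad_dot_diff grad_dot_plane_wave
     inner_weight inner_diff_left plane_wave_diffs power2_eq_square algebra_simps)

text \<open>This identity is equivalent to \<open>\<Delta>(\<phi> z) = - 7 c \<phi> z\<close>, hence to the statement that the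
product of the Weyl denominator and the character is an eigenfunction.\<close>

lemma grad_dot_weyl_denom_char:
  "2 * grad_dot weyl_denom_deriv fund_char_deriv x = - 3 * of_real eig_unit * weyl_denom x * fund_char x"
  unfolding weyl_denom_deriv_def weyl_denom_def
  unfolding grad_dot_cmult[of "\<lambda>x. inverse (2 * \<i>)"]
  using arg_cong[OF grad_dot_vandermonde_char[of x], of "(*) (inverse (2 * \<i>))"]
  by (simp only: mult_ac minus_mult_left[symmetric] minus_mult_right[symmetric])

lemma cnj_weyl_denom: "cnj (weyl_denom x) = weyl_denom x"
  by (simp add: weyl_denom_def vandermonde_def cnj_plane_wave algebra_simps)

lemma cnj_weyl_denom_deriv: "cnj (weyl_denom_deriv x v) = weyl_denom_deriv x v"
  by (simp add: weyl_denom_deriv_def vandermonde_deriv_def cnj_plane_wave_deriv algebra_simps)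

lemma Im_weyl_denom: "Im (weyl_denom x) = 0"
  by (metis cnj_weyl_denom complex_cnj cnj.simps(2) equal_neg_zero)

lemma Im_weyl_denom_deriv: "Im (weyl_denom_deriv x v) = 0"
  by (metis cnj_weyl_denom_deriv cnj.simps(2) equal_neg_zero)

lemma grad_dot_weyl_denom_cnj_char:
  "2 * grad_dot weyl_denom_deriv (\<lambda>x v. cnj (fund_char_deriv x v)) x = - 3 * of_real eig_unit * weyl_denom x * cnj (fund_char x)"
proof -
  have "grad_dot weyl_denom_deriv (\<lambda>x v. cnj (fund_char_deriv x v)) x = cnj (grad_dot weyl_denom_deriv fund_char_deriv x)"
    using grad_dot_cnj[of weyl_denom_deriv fund_char_deriv x] by (simp add: cnj_weyl_denom_deriv)
  then have "2 * grad_dot weyl_denom_deriv (\<lambda>x v. cnj (fund_char_deriv x v)) x = cnj (2 * grad_dot weyl_denom_deriv fund_char_deriv x)"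
    by simp
  then show ?thesis unfolding grad_dot_weyl_denom_char by (simp add: cnj_weyl_denom)
qed

definition monomial :: "nat \<Rightarrow> nat \<Rightarrow> real^2 \<Rightarrow> complex"
  where "monomial a b x = fund_char x ^ a * cnj (fund_char x) ^ b"

text \<open>The form produced by the Leibniz rule and by the rule for powers.\<close>

definition monomial_deriv :: "nat \<Rightarrow> nat \<Rightarrow> real^2 \<Rightarrow> real^2 \<Rightarrow> complex"
  where "monomial_deriv a b = (\<lambda>x v. fund_char x ^ a * (of_nat b * cnj (fund_char x) ^ (b - 1) * cnj (fund_char_deriv x v))
    + cnj (fund_char x) ^ b * (of_nat a * fund_char x ^ (a - 1) * fund_char_deriv x v))"

text \<open>This is \<open>m\<^sup>2 + m n + n\<^sup>2\<close> for \<open>m = a + 1\<close> and \<open>n = b + 1\<close>, the familiar form of the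
eigenvalues of the equilateral triangle.\<close>

definition eig_coeff :: "nat \<Rightarrow> nat \<Rightarrow> nat"
  where "eig_coeff a b = a\<^sup>2 + a * b + b\<^sup>2 + 3 * a + 3 * b + 3"

text \<open>The leading term is diagonal, and the three others have degree \<open>a + b - 1\<close> or \<open>a + b - 2\<close>.
The truncated exponents only occur with coefficient zero.\<close>

definition weyl_monomial_laplacian :: "nat \<Rightarrow> nat \<Rightarrow> real^2 \<Rightarrow> complex"
  where "weyl_monomial_laplacian a b x = of_real eig_unit * weyl_denom x *
    (- of_nat (eig_coeff a b) * monomial a b x
     + of_nat (3 * a * (a - 1)) * monomial (a - 2) (b + 1) x
     + of_nat (3 * b * (b - 1)) * monomial (a + 1) (b - 2) x
     + of_nat (9 * a * b) * monomial (a - 1) (b - 1) x)"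

text \<open>The Laplacian is triangular with respect to the degree \<open>a + b\<close>. The lower terms arise from
\<open>\<nabla>z \<cdot> \<nabla>z = - c (z\<^sup>2 - 3 cnj z)\<close> and \<open>\<nabla>z \<cdot> \<nabla>(cnj z) = c (9 - z cnj z) / 2\<close>, whereas \<open>\<nabla>\<phi> \<cdot> \<nabla>z\<close> is
a multiple of \<open>\<phi> z\<close> and only contributes to the diagonal.\<close>

lemma has_weak_laplacian_weyl_monomial:
  "has_C1_derivative (monomial a b) (monomial_deriv a b)"
  "has_weak_laplacian (\<lambda>x. weyl_denom x * monomial a b x)
    (\<lambda>x v. weyl_denom x * monomial_deriv a b x v + monomial a b x * weyl_denom_deriv x v) (weyl_monomial_laplacian a b)"
proof -
  let ?z = fund_char and ?z' = fund_char_deriv and ?s = "complex_of_real eig_unit"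
  let ?zc' = "\<lambda>x v. cnj (?z' x v)"
  let ?A' = "\<lambda>x v. of_nat a * ?z x ^ (a - 1) * ?z' x v"
  let ?B' = "\<lambda>x v. of_nat b * cnj (?z x) ^ (b - 1) * ?zc' x v"
  let ?LA = "\<lambda>x. of_nat a * ?z x ^ (a - 1) * (- ?s * ?z x)
     + of_nat (a * (a - 1)) * ?z x ^ (a - 2) * grad_dot ?z' ?z' x"
  let ?LB = "\<lambda>x. of_nat b * cnj (?z x) ^ (b - 1) * cnj (- ?s * ?z x)
     + of_nat (b * (b - 1)) * cnj (?z x) ^ (b - 2) * grad_dot ?zc' ?zc' x"
  note A = has_weak_laplacian_power[OF has_weak_laplacian_fund_char, of a]
  note B = has_weak_laplacian_power[OF has_weak_laplacian_cnj[OF has_weak_laplacian_fund_char], of b]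
  note AB = has_weak_laplacian_mult[OF A B]
  let ?LAB = "\<lambda>x. ?z x ^ a * ?LB x + cnj (?z x) ^ b * ?LA x + 2 * grad_dot ?A' ?B' x"
  have AB': "has_weak_laplacian (monomial a b) (monomial_deriv a b) ?LAB"
    using AB unfolding monomial_def[abs_def] monomial_deriv_def .
  then show "has_C1_derivative (monomial a b) (monomial_deriv a b)" by (rule has_weak_laplacianD)
  note W = has_weak_laplacian_mult[OF has_weak_laplacian_weyl_denom AB']
  have "weyl_denom x * ?LAB x + monomial a b x * (- of_real (3 * eig_unit) * weyl_denom x)
      + 2 * grad_dot weyl_denom_deriv (monomial_deriv a b) x = weyl_monomial_laplacian a b x" for x
  proof -
    define z where "z = ?z x"
    define w where "w = cnj z"
    define s where "s = ?s"
    have g1: "grad_dot ?z' ?z' x = - s * (z\<^sup>2 - 3 * w)"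
      unfolding grad_dot_char_char z_def w_def s_def by simp
    have g2: "grad_dot ?zc' ?zc' x = - s * (w\<^sup>2 - 3 * z)"
      unfolding grad_dot_cnj grad_dot_char_char z_def w_def s_def by simp
    have g3: "2 * grad_dot ?A' ?B' x =
        of_nat (a * b) * z ^ (a - 1) * w ^ (b - 1) * s * (9 - z * w)"
      unfolding grad_dot_cmult[of "\<lambda>x. of_nat a * ?z x ^ (a - 1)" ?z']
        grad_dot_cmult_right[of _ "\<lambda>x. of_nat b * cnj (?z x) ^ (b - 1)" ?zc'] grad_dot_char_cnj_char
      by (simp add: z_def w_def s_def)
    have "2 * grad_dot weyl_denom_deriv (monomial_deriv a b) x =
        z ^ a * (of_nat b * w ^ (b - 1) * (2 * grad_dot weyl_denom_deriv ?zc' x)) +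
        w ^ b * (of_nat a * z ^ (a - 1) * (2 * grad_dot weyl_denom_deriv ?z' x))"
      unfolding monomial_deriv_def z_def w_def grad_dot_def
      by (simp add: sum_distrib_left distrib_left sum.distrib algebra_simps)
    then have g4: "2 * grad_dot weyl_denom_deriv (monomial_deriv a b) x =
        z ^ a * (of_nat b * w ^ (b - 1) * (- 3 * s * weyl_denom x * w)) +
        w ^ b * (of_nat a * z ^ (a - 1) * (- 3 * s * weyl_denom x * z))"
      unfolding grad_dot_weyl_denom_char grad_dot_weyl_denom_cnj_char z_def w_def s_def .
    consider "a = 0" | "a = 1" | i where "a = Suc (Suc i)" by (metis One_nat_def not0_implies_Suc)
    note ca = this
    consider "b = 0" | "b = 1" | j where "b = Suc (Suc j)" by (metis One_nat_def not0_implies_Suc)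
    note cb = this
    note unf = g1 g2 g3 g4 weyl_monomial_laplacian_def monomial_def z_def[symmetric] w_def[symmetric]
      s_def[symmetric] complex_cnj_mult complex_cnj_minus of_real_mult
    have cs: "cnj s = s" by (simp add: s_def)
    show ?thesis
      using ca
    proof cases
      case 1
      show ?thesis unfolding unf using cb
        by cases (simp_all add: 1 cs eig_coeff_def power2_eq_square algebra_simps)
    next
      case 2
      show ?thesis unfolding unf using cb
        by cases (simp_all add: 2 cs eig_coeff_def power2_eq_square algebra_simps)
    next
      case 3
      show ?thesis unfolding unf using cb
        by cases (simp_all add: 3 cs eig_coeff_def power2_eq_square algebra_simps)
    qed
  qed
  then show "has_weak_laplacian (\<lambda>x. weyl_denom x * monomial a b x)
    (\<lambda>x v. weyl_denom x * monomial_deriv a b x v + monomial a b x * weyl_denom_deriv x v) (weyl_monomial_laplacian a b)"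
    using W by simp
qed

section \<open>The triangle as a fundamental alcove\<close>

text \<open>Barycentric coordinates with respect to the vertices \<open>(0, 0)\<close>, \<open>(1, 0)\<close> and
\<open>(1/2, sqrt 3 / 2)\<close>; the index \<open>0\<close> belongs to the first vertex.\<close>

definition bary1 :: "real^2 \<Rightarrow> real" where "bary1 x = x $ 1 - x $ 2 / sqrt 3"
definition bary2 :: "real^2 \<Rightarrow> real" where "bary2 x = 2 * x $ 2 / sqrt 3"
definition bary0 :: "real^2 \<Rightarrow> real" where "bary0 x = 1 - bary1 x - bary2 x"

lemma bary_inject: "bary1 x = bary1 y \<Longrightarrow> bary2 x = bary2 y \<Longrightarrow> x = y"
  by (simp add: bary1_def bary2_def vec_eq_iff forall_2)

lemma continuous_bary:
  "continuous_on A bary0" "continuous_on A bary1" "continuous_on A bary2"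
  unfolding bary0_def[abs_def] bary1_def[abs_def] bary2_def[abs_def] by (intro continuous_intros; simp)+

abbreviation closed_triangle :: "(real^2) set"
  where "closed_triangle \<equiv> convex hull {vector [0, 0], vector [1, 0], vector [1/2, sqrt 3 / 2]}"

lemma closed_triangle_eq: "closed_triangle = {x. 0 \<le> bary0 x \<and> 0 \<le> bary1 x \<and> 0 \<le> bary2 x}"
proof (intro set_eqI iffI)
  fix x assume "x \<in> closed_triangle"
  then obtain u v w where uvw: "0 \<le> u" "0 \<le> v" "0 \<le> w" "u + v + w = 1"
    and x: "x = u *\<^sub>R vector [0, 0] + v *\<^sub>R vector [1, 0] + w *\<^sub>R vector [1/2, sqrt 3 / 2]"
    unfolding convex_hull_3 by blast
  have "bary1 x = v" "bary2 x = w"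
    unfolding bary1_def bary2_def x by (simp_all add: field_simps)
  moreover from this have "bary0 x = u" using uvw by (simp add: bary0_def)
  ultimately show "x \<in> {x. 0 \<le> bary0 x \<and> 0 \<le> bary1 x \<and> 0 \<le> bary2 x}" using uvw by simp
next
  fix x :: "real^2" assume x: "x \<in> {x. 0 \<le> bary0 x \<and> 0 \<le> bary1 x \<and> 0 \<le> bary2 x}"
  let ?y = "bary0 x *\<^sub>R vector [0, 0] + bary1 x *\<^sub>R vector [1, 0] + bary2 x *\<^sub>R vector [1/2, sqrt 3 / 2]"
  have "x = ?y"
    by (rule bary_inject) (simp_all add: bary1_def bary2_def field_simps)
  moreover have "?y \<in> closed_triangle"
    unfolding convex_hull_3 mem_Collect_eq using x
    by (intro exI[of _ "bary0 x"] exI[of _ "bary1 x"] exI[of _ "bary2 x"]) (simp add: bary0_def)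
  ultimately show "x \<in> closed_triangle" by simp
qed

lemma equilateral_triangle_eq:
  "equilateral_triangle = {x. 0 < bary0 x \<and> 0 < bary1 x \<and> 0 < bary2 x}"
proof
  have "open {x. 0 < bary0 x \<and> 0 < bary1 x \<and> 0 < bary2 x}"
    by (intro open_Collect_conj open_Collect_less continuous_bary continuous_intros)
  moreover have "{x. 0 < bary0 x \<and> 0 < bary1 x \<and> 0 < bary2 x} \<subseteq> closed_triangle"
    unfolding closed_triangle_eq by auto
  ultimately show "{x. 0 < bary0 x \<and> 0 < bary1 x \<and> 0 < bary2 x} \<subseteq> equilateral_triangle"
    unfolding equilateral_triangle_def by (rule interior_maximal[rotated])
  define a1 a2 :: "real^2" where "a1 = vector [1, - 1 / sqrt 3]" and "a2 = vector [0, 2 / sqrt 3]"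
  have b: "bary1 x = a1 \<bullet> x" "bary2 x = a2 \<bullet> x" "bary0 x = - (a1 + a2) \<bullet> x + 1" for x
    by (simp_all add: bary0_def bary1_def bary2_def a1_def a2_def inner_vec_def sum_2 field_simps)
  have "a1 $ 1 \<noteq> 0" "a2 $ 2 \<noteq> 0" "(- (a1 + a2)) $ 1 \<noteq> 0" by (simp_all add: a1_def a2_def)
  then have n: "a1 \<noteq> 0" "a2 \<noteq> 0" "- (a1 + a2) \<noteq> 0" by (metis zero_index)+
  have "closed_triangle \<subseteq> {x. a1 \<bullet> x \<ge> 0}" "closed_triangle \<subseteq> {x. a2 \<bullet> x \<ge> 0}"
    "closed_triangle \<subseteq> {x. - (a1 + a2) \<bullet> x \<ge> -1}"
    unfolding closed_triangle_eq using b by auto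
  from this[THEN interior_mono, unfolded interior_halfspace_ge[OF n(1)] interior_halfspace_ge[OF n(2)]
      interior_halfspace_ge[OF n(3)]]
  show "equilateral_triangle \<subseteq> {x. 0 < bary0 x \<and> 0 < bary1 x \<and> 0 < bary2 x}"
    unfolding equilateral_triangle_def b by fastforce
qed

lemma open_triangle: "open equilateral_triangle"
  unfolding equilateral_triangle_def by simp

lemma compact_closed_triangle: "compact closed_triangle"
  by (intro finite_imp_compact_convex_hull) simp

lemma triangle_subset: "equilateral_triangle \<subseteq> closed_triangle"
  unfolding equilateral_triangle_def by (rule interior_subset)

lemma bounded_triangle: "bounded equilateral_triangle"
  using compact_imp_bounded[OF compact_closed_triangle] triangle_subset bounded_subset by blast

text \<open>Differences of these phases are \<open>2 \<pi> t\<^sub>1\<close>, \<open>2 \<pi> t\<^sub>2\<close> and \<open>2 \<pi> t\<^sub>0 - 2 \<pi>\<close>, so that the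
triangle is the alcove \<open>\<theta>\<^sub>1 > \<theta>\<^sub>2 > \<theta>\<^sub>3 > \<theta>\<^sub>1 - 2 \<pi>\<close>.\<close>

lemma inner_weight_bary:
  "weight1 \<bullet> x = 2 * pi * ((2 * bary1 x + bary2 x) / 3)"
  "weight2 \<bullet> x = 2 * pi * ((bary2 x - bary1 x) / 3)"
  "weight3 \<bullet> x = 2 * pi * (- (bary1 x + 2 * bary2 x) / 3)"
proof -
  have s: "sqrt 3 * sqrt 3 = 3" by simp
  show 1: "weight1 \<bullet> x = 2 * pi * ((2 * bary1 x + bary2 x) / 3)"
    by (simp add: weight1_def bary1_def bary2_def inner_vec_def sum_2 field_simps)
  have d: "bary2 x - bary1 x = sqrt 3 * x $ 2 - x $ 1"
    unfolding bary1_def bary2_def by (simp add: field_simps s)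
  show 2: "weight2 \<bullet> x = 2 * pi * ((bary2 x - bary1 x) / 3)"
    unfolding d by (simp add: weight2_def inner_vec_def sum_2 field_simps)
  show "weight3 \<bullet> x = 2 * pi * (- (bary1 x + 2 * bary2 x) / 3)"
    unfolding weight3_def inner_minus_left inner_add_left 1 2 by (simp add: field_simps)
qed

lemma sin_double_sum:
  fixes a b :: real
  shows "sin (2 * a) + sin (2 * b) - sin (2 * (a + b)) = 4 * sin (a + b) * sin a * sin b"
proof -
  have ca: "cos a * cos a = 1 - sin a * sin a" and cb: "cos b * cos b = 1 - sin b * sin b"
    by (simp_all add: cos_squared_eq flip: power2_eq_square)
  show ?thesis
    unfolding sin_double sin_add cos_add using ca cb by algebra
qed

text \<open>The six plane waves combine to the three sines \<open>sin (2 \<pi> t\<^sub>i)\<close>, whose sum is a product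
since \<open>t\<^sub>0 + t\<^sub>1 + t\<^sub>2 = 1\<close>. The product makes the sign inside the triangle and the zeros on its
sides visible.\<close>

lemma weyl_denom_eq: "weyl_denom x = of_real (4 * sin (pi * bary0 x) * sin (pi * bary1 x) * sin (pi * bary2 x))"
proof -
  have s: "plane_wave (p - q) x - plane_wave (q - p) x = 2 * \<i> * of_real (sin (p \<bullet> x - q \<bullet> x))" for p q :: "real^2"
    by (simp add: plane_wave_def inner_diff_left complex_eq_iff) (metis minus_diff_eq sin_minus cos_minus)
  have "vandermonde x = 2 * \<i> * of_real (sin (weight1 \<bullet> x - weight2 \<bullet> x) + sin (weight2 \<bullet> x - weight3 \<bullet> x) + sin (weight3 \<bullet> x - weight1 \<bullet> x))"
    unfolding vandermonde_def using s[of weight1 weight2] s[of weight2 weight3] s[of weight3 weight1] by (simp add: algebra_simps)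
  then have "weyl_denom x = of_real (sin (weight1 \<bullet> x - weight2 \<bullet> x) + sin (weight2 \<bullet> x - weight3 \<bullet> x) + sin (weight3 \<bullet> x - weight1 \<bullet> x))"
    unfolding weyl_denom_def by (simp add: field_simps)
  moreover have d: "weight1 \<bullet> x - weight2 \<bullet> x = 2 * (pi * bary1 x)" "weight2 \<bullet> x - weight3 \<bullet> x = 2 * (pi * bary2 x)"
    "weight3 \<bullet> x - weight1 \<bullet> x = - (2 * (pi * bary1 x + pi * bary2 x))"
    unfolding inner_weight_bary by (simp_all add: field_simps)
  moreover have "sin (pi * bary0 x) = sin (pi * bary1 x + pi * bary2 x)"
    using sin_pi_minus[of "pi * bary1 x + pi * bary2 x"] by (simp add: bary0_def algebra_simps)
  ultimately show ?thesis
    by (simp only: d sin_minus add_uminus_conv_diff sin_double_sum)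
qed

lemma weyl_denom_pos: "x \<in> equilateral_triangle \<Longrightarrow> Re (weyl_denom x) > 0"
proof -
  assume x: "x \<in> equilateral_triangle"
  then have t: "0 < bary0 x" "0 < bary1 x" "0 < bary2 x" unfolding equilateral_triangle_eq by auto
  then have "bary0 x < 1" "bary1 x < 1" "bary2 x < 1" by (auto simp: bary0_def)
  then show ?thesis unfolding weyl_denom_eq using t by (auto intro!: mult_pos_pos sin_gt_zero)
qed

lemma weyl_denom_zero: "x \<in> frontier equilateral_triangle \<Longrightarrow> Re (weyl_denom x) = 0"
proof -
  assume x: "x \<in> frontier equilateral_triangle"
  then have "x \<in> closure equilateral_triangle" "x \<notin> equilateral_triangle"
    using open_triangle by (auto simp: frontier_def interior_open)
  then have "x \<in> closed_triangle"
    using closure_minimal[OF triangle_subset] compact_closed_triangle compact_imp_closed by blast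
  then have "bary0 x = 0 \<or> bary1 x = 0 \<or> bary2 x = 0"
    using \<open>x \<notin> equilateral_triangle\<close> unfolding equilateral_triangle_eq closed_triangle_eq by auto
  then show ?thesis unfolding weyl_denom_eq by auto
qed

text \<open>Both triples consist of the roots of one and the same cubic polynomial.\<close>

lemma same_symmetric_functions_imp_permutation:
  fixes a1 a2 a3 b1 b2 b3 :: complex
  assumes s: "b1 + b2 + b3 = a1 + a2 + a3" "b1 * b2 + b2 * b3 + b1 * b3 = a1 * a2 + a2 * a3 + a1 * a3"
    and p: "b1 * b2 * b3 = a1 * a2 * a3"
  shows "b1 = a1 \<and> (b2 = a2 \<and> b3 = a3 \<or> b2 = a3 \<and> b3 = a2) \<or>
    b1 = a2 \<and> (b2 = a1 \<and> b3 = a3 \<or> b2 = a3 \<and> b3 = a1) \<or>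
    b1 = a3 \<and> (b2 = a1 \<and> b3 = a2 \<or> b2 = a2 \<and> b3 = a1)"
proof -
  have pair: "q = c \<and> r = d \<or> q = d \<and> r = c" if "q + r = c + d" "q * r = c * d" for q r c d :: complex
  proof -
    have "(q - c) * (q - d) = 0" using that by algebra
    then show ?thesis using that by auto
  qed
  have "(b1 - a1) * (b1 - a2) * (b1 - a3) = 0" using s p by algebra
  then consider "b1 = a1" | "b1 = a2" | "b1 = a3" by auto
  then show ?thesis
  proof cases
    case 1
    have "b2 + b3 = a2 + a3" "b2 * b3 = a2 * a3" using s unfolding 1 by algebra+
    from pair[OF this] show ?thesis using 1 by blast
  next
    case 2
    have "b2 + b3 = a1 + a3" "b2 * b3 = a1 * a3" using s unfolding 2 by algebra+
    from pair[OF this] show ?thesis using 2 by blast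
  next
    case 3
    have "b2 + b3 = a1 + a2" "b2 * b3 = a1 * a2" using s unfolding 3 by algebra+
    from pair[OF this] show ?thesis using 3 by blast
  qed
qed

lemma plane_wave_eqD:
  assumes "plane_wave k y = plane_wave l x" "k \<bullet> y = 2 * pi * v" "l \<bullet> x = 2 * pi * u"
  shows "v - u \<in> \<int>"
proof -
  have "sin (2 * pi * v) = sin (2 * pi * u) \<and> cos (2 * pi * v) = cos (2 * pi * u)"
    using assms(1) unfolding plane_wave_def assms(2,3) by (simp add: complex_eq_iff)
  then obtain n :: int where "2 * pi * v = 2 * pi * u + 2 * pi * of_int n"
    unfolding sin_cos_eq_iff by blast
  then have "2 * pi * (v - u) = 2 * pi * of_int n" by (simp add: algebra_simps)
  then have "v - u = of_int n" by simp
  then show ?thesis by simp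
qed

lemma small_Ints: "d \<in> \<int> \<Longrightarrow> \<bar>d\<bar> < 2 \<Longrightarrow> d = -1 \<or> d = 0 \<or> d = (1::real)"
proof -
  assume "d \<in> \<int>" and d: "\<bar>d\<bar> < 2"
  then obtain n :: int where n: "d = of_int n" by (elim Ints_cases)
  then have "- 2 < n" "n < 2" using d by linarith+
  then have "n = -1 \<or> n = 0 \<or> n = 1" by linarith
  then show ?thesis using n by auto
qed

text \<open>The character determines all elementary symmetric functions of the three plane waves:
their product is \<open>1\<close>, and the second one is the conjugate of the first. So the plane waves at
\<open>y\<close> are a permutation of those at \<open>x\<close>, and the phases agree up to a permutation and multiples of
\<open>2 \<pi>\<close>. In the closed alcove this leaves only \<open>y = x\<close>.\<close>

lemma fund_char_inj:
  assumes "x \<in> closed_triangle" "y \<in> closed_triangle" and eq: "fund_char y = fund_char x"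
  shows "y = x"
proof -
  define u1 u2 u3 where "u1 = (2 * bary1 x + bary2 x) / 3" and "u2 = (bary2 x - bary1 x) / 3"
    and "u3 = - (bary1 x + 2 * bary2 x) / 3"
  define v1 v2 v3 where "v1 = (2 * bary1 y + bary2 y) / 3" and "v2 = (bary2 y - bary1 y) / 3"
    and "v3 = - (bary1 y + 2 * bary2 y) / 3"
  note u = inner_weight_bary[of x, folded u1_def u2_def u3_def]
  note v = inner_weight_bary[of y, folded v1_def v2_def v3_def]
  have iu: "u1 + u2 + u3 = 0" "u1 \<ge> u2" "u2 \<ge> u3" "u3 \<ge> u1 - 1"
    using assms(1) unfolding closed_triangle_eq u1_def u2_def u3_def bary0_def by (auto simp: field_simps)
  have iv: "v1 + v2 + v3 = 0" "v1 \<ge> v2" "v2 \<ge> v3" "v3 \<ge> v1 - 1"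
    using assms(2) unfolding closed_triangle_eq v1_def v2_def v3_def bary0_def by (auto simp: field_simps)
  have int: "v - u = -1 \<or> v - u = 0 \<or> v - u = 1"
    if "plane_wave k y = plane_wave l x" "k \<bullet> y = 2 * pi * v" "l \<bullet> x = 2 * pi * u" "\<bar>v - u\<bar> < 2"
    for k l u v using plane_wave_eqD[OF that(1-3)] that(4) by (rule small_Ints)
  (* In units of 2 pi the phases range over intervals of length 2/3, so that only shifts by
     -1, 0 and 1 are possible and each of the six permutations is settled by linear arithmetic. *)
  have bd: "\<bar>v1 - u1\<bar> < 2" "\<bar>v1 - u2\<bar> < 2" "\<bar>v1 - u3\<bar> < 2" "\<bar>v2 - u1\<bar> < 2" "\<bar>v2 - u2\<bar> < 2" "\<bar>v2 - u3\<bar> < 2"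
    using iu iv by linarith+
  have "plane_wave weight1 y + plane_wave weight2 y + plane_wave weight3 y = plane_wave weight1 x + plane_wave weight2 x + plane_wave weight3 x"
    using eq unfolding fund_char_def .
  moreover have "plane_wave weight1 y * plane_wave weight2 y + plane_wave weight2 y * plane_wave weight3 y
    + plane_wave weight1 y * plane_wave weight3 y = plane_wave weight1 x * plane_wave weight2 x + plane_wave weight2 x * plane_wave weight3 x
    + plane_wave weight1 x * plane_wave weight3 x"
    using arg_cong[OF eq, of cnj] unfolding cnj_fund_char .
  moreover have "plane_wave weight1 y * plane_wave weight2 y * plane_wave weight3 y =
      plane_wave weight1 x * plane_wave weight2 x * plane_wave weight3 x"
    by (simp add: plane_wave_weight_prod)
  ultimately have perm: "plane_wave weight1 y = plane_wave weight1 x \<and> plane_wave weight2 y = plane_wave weight2 x \<or>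
     plane_wave weight1 y = plane_wave weight1 x \<and> plane_wave weight2 y = plane_wave weight3 x \<or>
     plane_wave weight1 y = plane_wave weight2 x \<and> plane_wave weight2 y = plane_wave weight1 x \<or>
     plane_wave weight1 y = plane_wave weight2 x \<and> plane_wave weight2 y = plane_wave weight3 x \<or>
     plane_wave weight1 y = plane_wave weight3 x \<and> plane_wave weight2 y = plane_wave weight1 x \<or>
     plane_wave weight1 y = plane_wave weight3 x \<and> plane_wave weight2 y = plane_wave weight2 x"
    using same_symmetric_functions_imp_permutation by blast
  have "v1 = u1 \<and> v2 = u2"
    using perm
  proof (elim disjE conjE)
    assume "plane_wave weight1 y = plane_wave weight1 x" "plane_wave weight2 y = plane_wave weight2 x"
    from int[OF this(1) v(1) u(1) bd(1)] int[OF this(2) v(2) u(2) bd(5)]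
    show ?thesis using iu iv by (elim disjE) linarith+
  next
    assume "plane_wave weight1 y = plane_wave weight1 x" "plane_wave weight2 y = plane_wave weight3 x"
    from int[OF this(1) v(1) u(1) bd(1)] int[OF this(2) v(2) u(3) bd(6)]
    show ?thesis using iu iv by (elim disjE) linarith+
  next
    assume "plane_wave weight1 y = plane_wave weight2 x" "plane_wave weight2 y = plane_wave weight1 x"
    from int[OF this(1) v(1) u(2) bd(2)] int[OF this(2) v(2) u(1) bd(4)]
    show ?thesis using iu iv by (elim disjE) linarith+
  next
    assume "plane_wave weight1 y = plane_wave weight2 x" "plane_wave weight2 y = plane_wave weight3 x"
    from int[OF this(1) v(1) u(2) bd(2)] int[OF this(2) v(2) u(3) bd(6)]
    show ?thesis using iu iv by (elim disjE) linarith+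
  next
    assume "plane_wave weight1 y = plane_wave weight3 x" "plane_wave weight2 y = plane_wave weight1 x"
    from int[OF this(1) v(1) u(3) bd(3)] int[OF this(2) v(2) u(1) bd(4)]
    show ?thesis using iu iv by (elim disjE) linarith+
  next
    assume "plane_wave weight1 y = plane_wave weight3 x" "plane_wave weight2 y = plane_wave weight2 x"
    from int[OF this(1) v(1) u(3) bd(3)] int[OF this(2) v(2) u(2) bd(5)]
    show ?thesis using iu iv by (elim disjE) linarith+
  qed
  then show ?thesis unfolding u1_def u2_def v1_def v2_def
    by (intro bary_inject) (auto simp: field_simps)
qed

section \<open>Nodal domains of a combination of eigenfunctions\<close>

lemma Re_fund_char: "Re (fund_char x) = cos (2 * pi * ((2 * bary1 x + bary2 x) / 3))
    + cos (2 * pi * ((bary2 x - bary1 x) / 3)) + cos (2 * pi * (- (bary1 x + 2 * bary2 x) / 3))"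
  unfolding fund_char_def plane_wave_def inner_weight_bary by simp

text \<open>On this axis of symmetry the phases are \<open>\<theta>\<close>, \<open>0\<close> and \<open>- \<theta>\<close>.\<close>

lemma Re_fund_char_axis:
  assumes "bary1 x = bary2 x"
  shows "Re (fund_char x) \<ge> -1"
proof -
  have "Re (fund_char x) = 1 + 2 * cos (2 * pi * bary2 x)"
    unfolding Re_fund_char assms by (simp add: field_simps flip: cos_minus[of "- _"])
  moreover have "cos (2 * pi * bary2 x) \<ge> -1" by (rule cos_ge_minus_one)
  ultimately show ?thesis by linarith
qed

text \<open>Removing the closure of the zero set instead of the zero set itself loses none of the
three points: by continuity they have neighbourhoods without zeros.\<close>

lemma three_le_nodal_count:
  assumes "open \<Omega>" and cont: "continuous_on \<Omega> v"
    and pts: "p \<in> \<Omega>" "q \<in> \<Omega>" "r \<in> \<Omega>" "v p \<noteq> 0" "v q \<noteq> 0" "v r \<noteq> 0"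
    and sep: "\<And>C. connected C \<Longrightarrow> C \<subseteq> {x \<in> \<Omega>. v x \<noteq> 0} \<Longrightarrow>
      \<not> (p \<in> C \<and> q \<in> C) \<and> \<not> (p \<in> C \<and> r \<in> C) \<and> \<not> (q \<in> C \<and> r \<in> C)"
  shows "enat 3 \<le> nodal_count \<Omega> v"
proof -
  define S where "S = \<Omega> - nodal_set \<Omega> v"
  have S1: "S \<subseteq> {x \<in> \<Omega>. v x \<noteq> 0}"
    unfolding S_def nodal_set_def using closure_subset[of "{x \<in> \<Omega>. v x = 0}"] by blast
  have "open (\<Omega> \<inter> v -` (- {0}))"
    using cont assms(1) by (intro continuous_open_preimage) auto
  then have "(\<Omega> \<inter> v -` (- {0})) \<inter> closure {x \<in> \<Omega>. v x = 0} = {}"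
    using open_Int_closure_eq_empty by blast
  then have S: "p \<in> S" "q \<in> S" "r \<in> S"
    unfolding S_def nodal_set_def using pts by auto
  let ?c = "connected_component_set S"
  have c: "?c x \<in> components S" if "x \<in> S" for x
    using that by (auto simp: components_def)
  have ne: "\<not> (p \<in> ?c x \<and> q \<in> ?c x) \<and> \<not> (p \<in> ?c x \<and> r \<in> ?c x) \<and> \<not> (q \<in> ?c x \<and> r \<in> ?c x)" for x
    using S1 connected_component_subset by (intro sep connected_connected_component) blast
  have "p \<in> ?c p" "q \<in> ?c q" "r \<in> ?c r" using S by auto
  with ne have d: "?c p \<noteq> ?c q" "?c p \<noteq> ?c r" "?c q \<noteq> ?c r" by metis+
  have "card {?c p, ?c q, ?c r} \<le> card (components S)" if "finite (components S)"
    using that c S by (intro card_mono) auto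
  then have "3 \<le> card (components S)" if "finite (components S)" using that d by simp
  then show ?thesis
    unfolding nodal_count_def S_def[symmetric] by (auto simp: Let_def)
qed

text \<open>Any level strictly between \<open>- 3/2\<close>, the real part of two of the cusps of the deltoid, and
\<open>- 1\<close>, the minimum on the axis of symmetry, would serve in place of \<open>- 5/4\<close>.\<close>

definition nodal_example :: "real^2 \<Rightarrow> real"
  where "nodal_example x = Re (weyl_denom x) * (Re (fund_char x) + 5/4)"

text \<open>The function is positive at the centre and negative at points near the second and the
third vertex. A connected set containing the last two meets the axis of symmetry, where the
function is positive, and so it contains a zero.\<close>

lemma nodal_count_example:
  assumes v: "\<And>x. x \<in> equilateral_triangle \<Longrightarrow> v x = nodal_example x"
  shows "enat 3 \<le> nodal_count equilateral_triangle v"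
proof -
  let ?T = equilateral_triangle
  define pt :: "real \<Rightarrow> real \<Rightarrow> real^2" where "pt s t = vector [s + t / 2, t * sqrt 3 / 2]" for s t
  have pt: "bary1 (pt s t) = s" "bary2 (pt s t) = t" for s t
    by (simp_all add: bary1_def bary2_def pt_def)
  have cw: "continuous_on UNIV (\<lambda>x. Re (weyl_denom x))" "continuous_on UNIV (\<lambda>x. Re (fund_char x))"
    using has_weak_laplacianD(3)[OF has_weak_laplacian_weyl_denom] has_weak_laplacianD(3)[OF has_weak_laplacian_fund_char]
    by (auto intro: continuous_intros)
  have "continuous_on UNIV nodal_example"
    unfolding nodal_example_def[abs_def] by (intro continuous_intros cw)
  then have cv: "continuous_on ?T v"
    using v by (metis (mono_tags, lifting) continuous_on_cong continuous_on_subset subset_UNIV)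
  have sgn: "v x > 0 \<longleftrightarrow> Re (fund_char x) > - 5/4" "v x < 0 \<longleftrightarrow> Re (fund_char x) < - 5/4" if "x \<in> ?T" for x
    using weyl_denom_pos[OF that] v[OF that]
    by (auto simp: nodal_example_def zero_less_mult_iff mult_less_0_iff)
  (* The centre, and the points on the angle bisectors of the second and third vertex at which
     the phases are multiples of pi/6. *)
  define p q r where "p = pt (1/3) (1/3)" and "q = pt (5/6) (1/12)" and "r = pt (1/12) (5/6)"
  have T: "p \<in> ?T" "q \<in> ?T" "r \<in> ?T"
    unfolding equilateral_triangle_eq p_def q_def r_def by (simp_all add: bary0_def pt)
  have s3: "sqrt 3 > 3/2" by (rule real_less_rsqrt) (simp add: power2_eq_square)
  have "Re (fund_char p) \<ge> -1" by (rule Re_fund_char_axis) (simp add: p_def pt)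
  then have vp: "v p > 0" using sgn(1)[OF T(1)] by simp
  have cs: "cos (2 * pi / 3) = - 1/2" "cos (7 * pi / 6) = - sqrt 3 / 2"
  proof -
    have "cos (2 * pi / 3) = - cos (pi / 3)" using cos_pi_minus[of "pi/3"] by (simp add: field_simps)
    then show "cos (2 * pi / 3) = - 1/2" by (simp add: cos_60)
    have "cos (7 * pi / 6) = - cos (pi / 6)" using cos_periodic_pi[of "pi/6"] by (simp add: field_simps)
    then show "cos (7 * pi / 6) = - sqrt 3 / 2" by (simp add: cos_30)
  qed
  have "Re (fund_char q) = cos (7 * pi / 6) + cos (- (pi / 2)) + cos (- (2 * pi / 3))"
    unfolding Re_fund_char q_def pt by (simp add: field_simps)
  then have "Re (fund_char q) = - sqrt 3 / 2 - 1 / 2" by (simp add: cs)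
  then have vq: "v q < 0" using sgn(2)[OF T(2)] s3 by simp
  have "Re (fund_char r) = cos (2 * pi / 3) + cos (pi / 2) + cos (- (7 * pi / 6))"
    unfolding Re_fund_char r_def pt by (simp add: field_simps)
  then have "Re (fund_char r) = - sqrt 3 / 2 - 1 / 2" by (simp add: cs)
  then have vr: "v r < 0" using sgn(2)[OF T(3)] s3 by simp
  have sign_change: "False" if C: "connected C" "C \<subseteq> {x \<in> ?T. v x \<noteq> 0}" and ab: "a \<in> C" "b \<in> C" "v a > 0" "v b < 0"
    for C a b
  proof -
    have "connected (v ` C)"
      using C cv by (intro connected_continuous_image) (auto intro: continuous_on_subset)
    then have "0 \<in> v ` C"
      using ab by (intro connectedD_interval[of "v ` C" "v b" "v a" 0]) auto
    then show False using C by auto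
  qed
  show ?thesis
  proof (rule three_le_nodal_count[OF open_triangle cv T])
    fix C assume C: "connected C" "C \<subseteq> {x \<in> ?T. v x \<noteq> 0}"
    have "\<not> (q \<in> C \<and> r \<in> C)"
    proof
      assume qr: "q \<in> C \<and> r \<in> C"
      let ?d = "\<lambda>x. bary1 x - bary2 x"
      have "connected (?d ` C)"
        using C by (intro connected_continuous_image continuous_intros continuous_bary)
      then have "0 \<in> ?d ` C"
      proof (rule connectedD_interval)
        show "?d r \<in> ?d ` C" "?d q \<in> ?d ` C" using qr by (auto intro: imageI)
        show "?d r \<le> 0" "0 \<le> ?d q" by (simp_all add: q_def r_def pt)
      qed
      then obtain x where x: "x \<in> C" "bary1 x = bary2 x" by auto
      then have "v x > 0" using sgn(1)[of x] Re_fund_char_axis[of x] C by force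
      then show False using sign_change[OF C x(1), of q] qr vq by blast
    qed
    then show "\<not> (p \<in> C \<and> q \<in> C) \<and> \<not> (p \<in> C \<and> r \<in> C) \<and> \<not> (q \<in> C \<and> r \<in> C)"
      using sign_change[OF C] vp vq vr by blast
  qed (use vp vq vr in auto)
qed

section \<open>Moments of eigenfunctions and completeness\<close>

abbreviation tri_measure :: "(real^2) measure"
  where "tri_measure \<equiv> dom_measure equilateral_triangle"

lemma finite_tri_measure: "finite_measure tri_measure"
  by (rule finite_measure_dom_measure[OF open_triangle bounded_triangle])

lemma space_tri_measure: "space tri_measure = equilateral_triangle"
  by (simp add: space_restrict_space)

text \<open>The Weyl denominator and its derivative are real, so taking real parts commutes with
multiplication by them.\<close>

lemma H10_weyl_denom_mult:
  assumes G: "has_C1_derivative G G'"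
  shows "H10 equilateral_triangle (\<lambda>x. Re (weyl_denom x * G x))
    (re_grad (\<lambda>x v. weyl_denom x * G' x v + G x * weyl_denom_deriv x v))"
proof -
  note W = has_weak_laplacianD[OF has_weak_laplacian_weyl_denom]
  have "H10 equilateral_triangle (\<lambda>x. Re (weyl_denom x) * Re (G x))
      (\<lambda>x. Re (weyl_denom x) *\<^sub>R re_grad G' x + Re (G x) *\<^sub>R re_grad weyl_denom_deriv x)"
    by (rule H10_product_vanishing_on_frontier[OF open_triangle bounded_triangle
          GDERIV_re_grad[OF W(1)] continuous_re_grad[OF W(1)] GDERIV_re_grad[OF G]
          continuous_re_grad[OF G] weyl_denom_pos weyl_denom_zero])
  moreover have "(\<lambda>x. Re (weyl_denom x) *\<^sub>R re_grad G' x + Re (G x) *\<^sub>R re_grad weyl_denom_deriv x) =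
      re_grad (\<lambda>x v. weyl_denom x * G' x v + G x * weyl_denom_deriv x v)"
    by (simp add: fun_eq_iff re_grad_def Im_weyl_denom Im_weyl_denom_deriv scaleR_sum_right sum.distrib
        scaleR_add_left)
  ultimately show ?thesis by (simp add: Im_weyl_denom)
qed

text \<open>The factor \<open>\<theta>\<close> selects between real part (\<open>\<theta> = 1\<close>) and imaginary part (\<open>\<theta> = - \<i>\<close>).\<close>

lemma weyl_monomial_cmult:
  "H10 equilateral_triangle (\<lambda>x. Re (\<theta> * (weyl_denom x * monomial a b x)))
    (re_grad (\<lambda>x v. \<theta> * (weyl_denom x * monomial_deriv a b x v + monomial a b x * weyl_denom_deriv x v)))"
  "has_weak_laplacian (\<lambda>x. \<theta> * (weyl_denom x * monomial a b x))
    (\<lambda>x v. \<theta> * (weyl_denom x * monomial_deriv a b x v + monomial a b x * weyl_denom_deriv x v))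
    (\<lambda>x. \<theta> * weyl_monomial_laplacian a b x)"
proof -
  show "has_weak_laplacian (\<lambda>x. \<theta> * (weyl_denom x * monomial a b x))
    (\<lambda>x v. \<theta> * (weyl_denom x * monomial_deriv a b x v + monomial a b x * weyl_denom_deriv x v))
    (\<lambda>x. \<theta> * weyl_monomial_laplacian a b x)"
    by (rule has_weak_laplacian_cmult[OF has_weak_laplacian_weyl_monomial(2)])
  have "H10 equilateral_triangle (\<lambda>x. Re (weyl_denom x * (\<theta> * monomial a b x)))
    (re_grad (\<lambda>x v. weyl_denom x * (\<theta> * monomial_deriv a b x v) + (\<theta> * monomial a b x) * weyl_denom_deriv x v))"
    by (intro H10_weyl_denom_mult has_C1_derivative_cmult has_weak_laplacian_weyl_monomial)
  then show "H10 equilateral_triangle (\<lambda>x. Re (\<theta> * (weyl_denom x * monomial a b x)))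
    (re_grad (\<lambda>x v. \<theta> * (weyl_denom x * monomial_deriv a b x v + monomial a b x * weyl_denom_deriv x v)))"
    by (simp only: distrib_left mult.assoc mult.left_commute)
qed

text \<open>The functions whose moments are considered: eigenfunctions and their linear combinations
belong to this class.\<close>

definition admissible :: "(real^2 \<Rightarrow> real) \<Rightarrow> bool"
  where "admissible u \<longleftrightarrow> continuous_on equilateral_triangle u \<and> square_integrable_on u equilateral_triangle"

lemma admissibleD:
  assumes "admissible u"
  shows "continuous_on equilateral_triangle u" "u \<in> borel_measurable tri_measure"
    "integrable tri_measure (\<lambda>x. (u x)\<^sup>2)" "integrable tri_measure u"
proof -
  interpret finite_measure tri_measure by (rule finite_tri_measure)
  show "continuous_on equilateral_triangle u" and m: "u \<in> borel_measurable tri_measure"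
    and i: "integrable tri_measure (\<lambda>x. (u x)\<^sup>2)"
    using assms unfolding admissible_def square_integrable_on_iff[OF open_triangle] by auto
  show "integrable tri_measure u"
    using integrable_inner_square_integrable[OF m _ borel_measurable_const[of "1::real"]] i by simp
qed

lemma integrable_admissible_mult:
  fixes k :: "real^2 \<Rightarrow> complex"
  assumes u: "admissible u" and k: "continuous_on UNIV k"
  shows "integrable tri_measure (\<lambda>x. of_real (u x) * k x)"
proof -
  note uD = admissibleD[OF u]
  obtain C where C: "\<And>x. x \<in> equilateral_triangle \<Longrightarrow> norm (k x) \<le> C"
    using continuous_on_bounded_dom[OF bounded_triangle continuous_on_subset[OF k subset_UNIV]] by blast
  note km = continuous_square_integrable(1)[OF open_triangle bounded_triangle k]
  show ?thesis
  proof (rule Bochner_Integration.integrable_bound)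
    show "integrable tri_measure (\<lambda>x. C * \<bar>u x\<bar>)" using uD by simp
    show "(\<lambda>x. of_real (u x) * k x) \<in> borel_measurable tri_measure"
      using uD km by measurable
    have "norm (of_real (u x) * k x) \<le> norm (C * \<bar>u x\<bar>)" if "x \<in> equilateral_triangle" for x
    proof -
      have "norm (of_real (u x) * k x) \<le> C * \<bar>u x\<bar>"
        using mult_left_mono[OF C[OF that] abs_ge_zero[of "u x"]] by (simp add: norm_mult mult.commute)
      then show ?thesis by simp
    qed
    then show "AE x in tri_measure. norm (of_real (u x) * k x) \<le> norm (C * \<bar>u x\<bar>)"
      by (intro AE_I2) (simp only: space_tri_measure)
  qed
qed

lemma admissible_bounded_continuous:
  assumes "continuous_on UNIV f" "\<And>x. x \<in> equilateral_triangle \<Longrightarrow> u x = f x"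
  shows "admissible u"
proof -
  have "continuous_on equilateral_triangle u"
    using assms by (metis (mono_tags, lifting) continuous_on_cong continuous_on_subset subset_UNIV)
  moreover have f: "f \<in> borel_measurable tri_measure" "integrable tri_measure (\<lambda>x. (norm (f x))\<^sup>2)"
    using continuous_square_integrable[OF open_triangle bounded_triangle assms(1)] by auto
  moreover have "u \<in> borel_measurable tri_measure \<longleftrightarrow> f \<in> borel_measurable tri_measure"
    by (rule measurable_cong) (simp add: space_tri_measure assms)
  moreover have "integrable tri_measure (\<lambda>x. (norm (u x))\<^sup>2) \<longleftrightarrow> integrable tri_measure (\<lambda>x. (norm (f x))\<^sup>2)"
    by (rule Bochner_Integration.integrable_cong) (simp_all add: space_tri_measure assms)
  ultimately show ?thesis
    unfolding admissible_def square_integrable_on_iff[OF open_triangle] by simp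
qed

lemma admissible_diff_scale:
  assumes "admissible u" "admissible w"
  shows "admissible (\<lambda>x. u x - t * w x)"
proof -
  note uD = admissibleD[OF assms(1)] and wD = admissibleD[OF assms(2)]
  have "integrable tri_measure (\<lambda>x. (norm (u x - t * w x))\<^sup>2)"
    using uD wD by (intro integrable_square_diff) (auto simp: power_mult_distrib)
  then show ?thesis
    unfolding admissible_def square_integrable_on_iff[OF open_triangle]
    using uD wD by (auto intro!: continuous_intros)
qed

definition moment :: "(real^2 \<Rightarrow> real) \<Rightarrow> nat \<Rightarrow> nat \<Rightarrow> complex"
  where "moment u a b = (LINT x|tri_measure. of_real (u x) * (weyl_denom x * monomial a b x))"

text \<open>What the eigenvalue equation says about the functions \<open>\<phi> z\<^sup>a cnj(z)\<^sup>b\<close>. The condition is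
linear in \<open>u\<close>, so projections onto known eigenfunctions can be subtracted from an
eigenfunction.\<close>

definition has_eigenvalue_moments :: "real \<Rightarrow> (real^2 \<Rightarrow> real) \<Rightarrow> bool"
  where "has_eigenvalue_moments \<mu> u \<longleftrightarrow> admissible u \<and>
    (\<forall>a b. (LINT x|tri_measure. of_real (u x) * (of_real \<mu> * (weyl_denom x * monomial a b x) + weyl_monomial_laplacian a b x)) = 0)"

lemma continuous_weyl_monomial:
  "continuous_on UNIV (\<lambda>x. weyl_denom x * monomial a b x)" "continuous_on UNIV (weyl_monomial_laplacian a b)"
  using has_weak_laplacianD[OF has_weak_laplacian_weyl_monomial(2)[of a b]] by auto

lemma has_eigenvalue_moments_diff_scale:
  assumes "has_eigenvalue_moments \<mu> u" "has_eigenvalue_moments \<mu> w"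
  shows "has_eigenvalue_moments \<mu> (\<lambda>x. u x - t * w x)"
  unfolding has_eigenvalue_moments_def
proof (intro conjI allI)
  have ad: "admissible u" "admissible w" using assms unfolding has_eigenvalue_moments_def by auto
  then show "admissible (\<lambda>x. u x - t * w x)" by (rule admissible_diff_scale)
  fix a b
  let ?k = "\<lambda>x. of_real \<mu> * (weyl_denom x * monomial a b x) + weyl_monomial_laplacian a b x"
  have c: "continuous_on UNIV ?k" by (intro continuous_intros continuous_weyl_monomial)
  have "(LINT x|tri_measure. of_real (u x - t * w x) * ?k x) =
      (LINT x|tri_measure. of_real (u x) * ?k x - of_real t * (of_real (w x) * ?k x))"
    by (simp add: algebra_simps)
  also have "\<dots> = 0"
    using assms integrable_admissible_mult[OF ad(1) c] integrable_admissible_mult[OF ad(2) c]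
    unfolding has_eigenvalue_moments_def
    by (subst Bochner_Integration.integral_diff) auto
  finally show "(LINT x|tri_measure. of_real (u x - t * w x) * ?k x) = 0" .
qed

lemma Re_of_real_mult: "Re (of_real r * z) = r * Re z"
  by simp

text \<open>The test function is shifted from one side of the weak equation to the other: once with
the weak equation of \<open>u\<close>, and once with Green's formula for the explicit function.\<close>

lemma eigenfunction_moments:
  assumes "dirichlet_eigenfunction equilateral_triangle \<mu> u"
  shows "has_eigenvalue_moments \<mu> u"
proof -
  let ?T = equilateral_triangle
  obtain g where g: "H10 ?T u g" and weak: "\<And>w h. H10 ?T w h \<Longrightarrow>
      (LINT x|tri_measure. g x \<bullet> h x) = (LINT x|tri_measure. \<mu> * u x * w x)"
    using assms unfolding dirichlet_eigenfunction_def dirichlet_laplacian_def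
      set_integral_dom_measure[OF open_triangle] by blast
  have ad: "admissible u"
    using assms g unfolding admissible_def dirichlet_eigenfunction_def H10_def by blast
  have "(LINT x|tri_measure. of_real (u x) * (of_real \<mu> * (weyl_denom x * monomial a b x) + weyl_monomial_laplacian a b x)) = 0" for a b
  proof -
    let ?k = "\<lambda>x. of_real \<mu> * (weyl_denom x * monomial a b x) + weyl_monomial_laplacian a b x"
    have c: "continuous_on UNIV ?k" by (intro continuous_intros continuous_weyl_monomial)
    have Re0: "Re (\<theta> * (LINT x|tri_measure. of_real (u x) * ?k x)) = 0" for \<theta>
    proof -
      let ?h = "re_grad (\<lambda>x v. \<theta> * (weyl_denom x * monomial_deriv a b x v + monomial a b x * weyl_denom_deriv x v))"
      have "(LINT x|tri_measure. g x \<bullet> ?h x) = (LINT x|tri_measure. \<mu> * u x * Re (\<theta> * (weyl_denom x * monomial a b x)))"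
        by (rule weak[OF weyl_monomial_cmult(1)])
      moreover have "(LINT x|tri_measure. g x \<bullet> ?h x) = - (LINT x|tri_measure. Re (\<theta> * weyl_monomial_laplacian a b x) * u x)"
        using H10_weak_laplacian[OF open_triangle bounded_triangle g weyl_monomial_cmult(2)]
        by (simp only: inner_commute)
      ultimately have e: "(LINT x|tri_measure. \<mu> * u x * Re (\<theta> * (weyl_denom x * monomial a b x)))
          + (LINT x|tri_measure. Re (\<theta> * weyl_monomial_laplacian a b x) * u x) = 0" by simp
      have c1: "continuous_on UNIV (\<lambda>x. \<theta> * (weyl_denom x * monomial a b x))"
        and c2: "continuous_on UNIV (\<lambda>x. \<theta> * weyl_monomial_laplacian a b x)"
        by (intro continuous_intros continuous_weyl_monomial)+
      have i1: "integrable tri_measure (\<lambda>x. \<mu> * u x * Re (\<theta> * (weyl_denom x * monomial a b x)))"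
        using integrable_Re[OF integrable_admissible_mult[OF ad c1]]
        unfolding Re_of_real_mult mult.assoc by (rule integrable_mult_right)
      have i2: "integrable tri_measure (\<lambda>x. Re (\<theta> * weyl_monomial_laplacian a b x) * u x)"
        using integrable_Re[OF integrable_admissible_mult[OF ad c2]]
        unfolding Re_of_real_mult by (simp only: mult.commute)
      have "Re (\<theta> * (LINT x|tri_measure. of_real (u x) * ?k x)) =
          Re (LINT x|tri_measure. \<theta> * (of_real (u x) * ?k x))" by simp
      also have "\<dots> = (LINT x|tri_measure. Re (\<theta> * (of_real (u x) * ?k x)))"
        using integrable_admissible_mult[OF ad c] by (subst integral_Re) auto
      also have "\<dots> = (LINT x|tri_measure. \<mu> * u x * Re (\<theta> * (weyl_denom x * monomial a b x))
          + Re (\<theta> * weyl_monomial_laplacian a b x) * u x)"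
        by (rule Bochner_Integration.integral_cong) (simp_all add: algebra_simps)
      also have "\<dots> = 0" using e i1 i2 by simp
      finally show ?thesis .
    qed
    show ?thesis
      using Re0[of 1] Re0[of "- \<i>"] by (intro complex_eqI) simp_all
  qed
  with ad show ?thesis unfolding has_eigenvalue_moments_def by blast
qed

lemma moment_recurrence:
  assumes "has_eigenvalue_moments \<mu> u"
  shows "of_real (\<mu> - eig_unit * real (eig_coeff a b)) * moment u a b =
    - of_real eig_unit * (of_nat (3 * a * (a - 1)) * moment u (a - 2) (b + 1)
     + of_nat (3 * b * (b - 1)) * moment u (a + 1) (b - 2) + of_nat (9 * a * b) * moment u (a - 1) (b - 1))"
proof -
  have ad: "admissible u" using assms unfolding has_eigenvalue_moments_def by blast
  define F where "F a b x = of_real (u x) * (weyl_denom x * monomial a b x)" for a b x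
  have i: "integrable tri_measure (F a b)" for a b
    unfolding F_def by (rule integrable_admissible_mult[OF ad continuous_weyl_monomial(1)])
  have m: "moment u a b = (LINT x|tri_measure. F a b x)" for a b unfolding moment_def F_def ..
  let ?s = "complex_of_real eig_unit"
  have "(LINT x|tri_measure. of_real (u x) * (of_real \<mu> * (weyl_denom x * monomial a b x) + weyl_monomial_laplacian a b x)) =
    (LINT x|tri_measure. of_real (\<mu> - eig_unit * real (eig_coeff a b)) * F a b x
      + ?s * of_nat (3 * a * (a - 1)) * F (a - 2) (b + 1) x
      + ?s * of_nat (3 * b * (b - 1)) * F (a + 1) (b - 2) x + ?s * of_nat (9 * a * b) * F (a - 1) (b - 1) x)"
    unfolding F_def weyl_monomial_laplacian_def by (intro Bochner_Integration.integral_cong) (simp_all add: algebra_simps)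
  also have "\<dots> = of_real (\<mu> - eig_unit * real (eig_coeff a b)) * moment u a b
      + ?s * of_nat (3 * a * (a - 1)) * moment u (a - 2) (b + 1)
      + ?s * of_nat (3 * b * (b - 1)) * moment u (a + 1) (b - 2) + ?s * of_nat (9 * a * b) * moment u (a - 1) (b - 1)"
    unfolding m by (simp add: i del: of_nat_mult of_real_diff of_real_mult)
  finally have "\<dots> = 0" using assms unfolding has_eigenvalue_moments_def by simp
  then show ?thesis by (simp add: algebra_simps eq_neg_iff_add_eq_0 del: of_nat_mult of_real_diff of_real_mult)
qed

text \<open>By the recurrence, a moment of degree \<open>n\<close> times a factor that is nonzero away from
resonances is a combination of moments of lower degree.\<close>

lemma nonresonant_moments_vanish:
  assumes u: "has_eigenvalue_moments \<mu> u"
    and res: "\<And>a b. \<mu> = eig_unit * real (eig_coeff a b) \<Longrightarrow> moment u a b = 0"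
  shows "moment u a b = 0"
proof (induction "a + b" arbitrary: a b rule: less_induct)
  case less
  show ?case
  proof (cases "\<mu> = eig_unit * real (eig_coeff a b)")
    case False
    have z1: "of_nat (3 * a * (a - 1)) * moment u (a - 2) (b + 1) = 0"
      using less[of "a - 2" "b + 1"] by (cases "a < 2") (auto simp: less_2_cases_iff)
    have z2: "of_nat (3 * b * (b - 1)) * moment u (a + 1) (b - 2) = 0"
      using less[of "a + 1" "b - 2"] by (cases "b < 2") (auto simp: less_2_cases_iff)
    have z3: "of_nat (9 * a * b) * moment u (a - 1) (b - 1) = 0"
      using less[of "a - 1" "b - 1"] by (cases "a = 0") auto
    have "of_real (\<mu> - eig_unit * real (eig_coeff a b)) * moment u a b = 0"
      unfolding moment_recurrence[OF u] z1 z2 z3 by simp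
    then show ?thesis using False by (simp add: del: of_real_diff of_real_mult)
  qed (rule res)
qed

text \<open>Products of polynomials are handled by proving a multiplier property: multiplication by
\<open>q(z)\<close> preserves the set of all \<open>p\<close> that are orthogonal to \<open>u \<phi> z\<^sup>a cnj(z)\<^sup>b\<close> for all \<open>a\<close> and
\<open>b\<close>. This property is closed under sums and products of multipliers.\<close>

lemma moments_vanish_imp_orthogonal_polynomial:
  assumes ad: "admissible u" and m: "\<And>a b. moment u a b = 0"
    and q: "real_polynomial_function (q :: complex \<Rightarrow> real)"
  shows "(LINT x|tri_measure. of_real (u x) * weyl_denom x * of_real (q (fund_char x))) = 0"
proof -
  define orth where "orth p \<longleftrightarrow> continuous_on UNIV p \<and>
    (\<forall>a b. (LINT x|tri_measure. of_real (u x) * (weyl_denom x * monomial a b x * p x)) = 0)" for p :: "real^2 \<Rightarrow> complex"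
  have cc: "continuous_on UNIV fund_char" by (rule has_weak_laplacianD[OF has_weak_laplacian_fund_char])
  have int: "integrable tri_measure (\<lambda>x. of_real (u x) * (weyl_denom x * monomial a b x * p x))"
    if "continuous_on UNIV p" for a b p
    using that by (intro integrable_admissible_mult[OF ad] continuous_intros continuous_weyl_monomial)
  have orth_add: "orth (\<lambda>x. \<alpha> * p x + \<beta> * p' x)" if "orth p" "orth p'" for p p' \<alpha> \<beta>
  proof -
    have "(LINT x|tri_measure. of_real (u x) * (weyl_denom x * monomial a b x * (\<alpha> * p x + \<beta> * p' x))) =
      (LINT x|tri_measure. \<alpha> * (of_real (u x) * (weyl_denom x * monomial a b x * p x))
        + \<beta> * (of_real (u x) * (weyl_denom x * monomial a b x * p' x)))" for a b
      by (simp add: algebra_simps)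
    then show ?thesis using that int unfolding orth_def by (auto intro!: continuous_intros)
  qed
  have orth_char: "orth (\<lambda>x. fund_char x * p x)" "orth (\<lambda>x. cnj (fund_char x) * p x)" if "orth p" for p
  proof -
    have e: "weyl_denom x * monomial a b x * (fund_char x * p x) = weyl_denom x * monomial (a + 1) b x * p x"
      "weyl_denom x * monomial a b x * (cnj (fund_char x) * p x) = weyl_denom x * monomial a (b + 1) x * p x" for a b x
      by (simp_all add: monomial_def)
    have c: "continuous_on UNIV p" and z: "\<And>a b. (LINT x|tri_measure. of_real (u x) * (weyl_denom x * monomial a b x * p x)) = 0"
      using that unfolding orth_def by auto
    show "orth (\<lambda>x. fund_char x * p x)" "orth (\<lambda>x. cnj (fund_char x) * p x)"
      unfolding orth_def e by (intro conjI allI continuous_intros c cc z)+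
  qed
  have "\<forall>p. orth p \<longrightarrow> orth (\<lambda>x. of_real (q (fund_char x)) * p x)"
    using q
  proof induction
    case (linear f)
    have f: "of_real (f w) = (of_real (f 1) / 2 + of_real (f \<i>) / (2 * \<i>)) * w
        + (of_real (f 1) / 2 - of_real (f \<i>) / (2 * \<i>)) * cnj w" for w
    proof -
      interpret bounded_linear f by fact
      have "f w = f (Re w *\<^sub>R 1 + Im w *\<^sub>R \<i>)"
        by (rule arg_cong[where f = f]) (simp add: complex_eq_iff)
      also have "\<dots> = Re w * f 1 + Im w * f \<i>" by (simp only: add scaleR real_scaleR_def)
      finally show ?thesis by (simp add: complex_eq_iff field_simps)
    qed
    then obtain \<alpha> \<beta> where f': "\<And>w. complex_of_real (f w) = \<alpha> * w + \<beta> * cnj w" by blast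
    show ?case
    proof (intro allI impI)
      fix p assume "orth p"
      from orth_add[OF orth_char[OF this]] show "orth (\<lambda>x. of_real (f (fund_char x)) * p x)"
        unfolding f' by (simp add: distrib_right mult.assoc)
    qed
  next
    case (const c)
    show ?case using orth_add[where \<beta> = 0 and \<alpha> = "of_real c"] by simp
  next
    case (add f g)
    show ?case
    proof (intro allI impI)
      fix p assume "orth p"
      then show "orth (\<lambda>x. of_real (f (fund_char x) + g (fund_char x)) * p x)"
        using orth_add[where \<alpha> = 1 and \<beta> = 1] add.IH by (simp add: distrib_right)
    qed
  next
    case (mult f g)
    show ?case
    proof (intro allI impI)
      fix p assume "orth p"
      then have "orth (\<lambda>x. of_real (f (fund_char x)) * (of_real (g (fund_char x)) * p x))"
        using mult.IH by blast
      then show "orth (\<lambda>x. of_real (f (fund_char x) * g (fund_char x)) * p x)"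
        by (simp add: mult.assoc)
    qed
  qed
  moreover have "orth (\<lambda>x. 1)" unfolding orth_def using m by (simp add: moment_def)
  ultimately have "orth (\<lambda>x. of_real (q (fund_char x)) * 1)" by blast
  then have "(LINT x|tri_measure. of_real (u x) * (weyl_denom x * monomial 0 0 x * (of_real (q (fund_char x)) * 1))) = 0"
    unfolding orth_def by blast
  then show ?thesis by (simp add: monomial_def mult.assoc)
qed

text \<open>Stone-Weierstrass on the closed triangle, for the algebra of polynomials in the real and
imaginary part of the character; these separate points because the character is injective.\<close>

lemma moments_vanish_imp_orthogonal_continuous:
  assumes ad: "admissible u" and m: "\<And>a b. moment u a b = 0"
    and f: "continuous_on UNIV f"
  shows "(LINT x|tri_measure. u x * Re (weyl_denom x) * f x) = 0"
proof -
  have cc: "continuous_on UNIV fund_char" by (rule has_weak_laplacianD[OF has_weak_laplacian_fund_char])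
  have cw: "continuous_on UNIV weyl_denom" by (rule has_weak_laplacianD[OF has_weak_laplacian_weyl_denom])
  have int: "integrable tri_measure (\<lambda>x. u x * Re (weyl_denom x) * g x)" if g: "continuous_on UNIV g" for g
  proof -
    have "continuous_on UNIV (\<lambda>x. weyl_denom x * of_real (g x))" using cw g by (intro continuous_intros)
    from integrable_Re[OF integrable_admissible_mult[OF ad this]] show ?thesis by (simp add: mult.assoc)
  qed
  have cq: "continuous_on UNIV (\<lambda>x. q (fund_char x))" if "real_polynomial_function q" for q
  proof (rule continuous_on_compose2[OF _ cc])
    show "continuous_on UNIV q"
      by (simp add: continuous_at_imp_continuous_on continuous_real_polymonial_function[OF that])
  qed simp
  define B where "B = (LINT x|tri_measure. \<bar>u x * Re (weyl_denom x)\<bar>)"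
  have iB: "integrable tri_measure (\<lambda>x. \<bar>u x * Re (weyl_denom x)\<bar>)"
    using int[of "\<lambda>_. 1"] by simp
  have B: "B \<ge> 0" unfolding B_def by simp
  have "\<bar>LINT x|tri_measure. u x * Re (weyl_denom x) * f x\<bar> \<le> e * B" if e: "e > 0" for e
  proof -
    have "\<exists>g. (\<exists>q. real_polynomial_function q \<and> g = (\<lambda>x. q (fund_char x))) \<and> (\<forall>x\<in>closed_triangle. \<bar>f x - g x\<bar> < e)"
    proof (rule Stone_Weierstrass_HOL[where P = "\<lambda>g. \<exists>q. real_polynomial_function q \<and> g = (\<lambda>x. q (fund_char x))"])
      show "compact closed_triangle" by (rule compact_closed_triangle)
      show "\<exists>q. real_polynomial_function q \<and> (\<lambda>x. c) = (\<lambda>x. q (fund_char x))" for c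
        by (intro exI[of _ "\<lambda>_. c"]) auto
      show "\<exists>q. real_polynomial_function q \<and> (\<lambda>x. g x + h x) = (\<lambda>x. q (fund_char x))"
        if "(\<exists>q. real_polynomial_function q \<and> g = (\<lambda>x. q (fund_char x))) \<and>
          (\<exists>q. real_polynomial_function q \<and> h = (\<lambda>x. q (fund_char x)))" for g h
        using that real_polynomial_function.intros(3) by blast
      show "\<exists>q. real_polynomial_function q \<and> (\<lambda>x. g x * h x) = (\<lambda>x. q (fund_char x))"
        if "(\<exists>q. real_polynomial_function q \<and> g = (\<lambda>x. q (fund_char x))) \<and>
          (\<exists>q. real_polynomial_function q \<and> h = (\<lambda>x. q (fund_char x)))" for g h
        using that real_polynomial_function.intros(4) by blast
      show "continuous_on closed_triangle g"
        if "\<exists>q. real_polynomial_function q \<and> g = (\<lambda>x. q (fund_char x))" for g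
        using that cq continuous_on_subset by blast
      show "\<exists>g. (\<exists>q. real_polynomial_function q \<and> g = (\<lambda>x. q (fund_char x))) \<and> g x \<noteq> g y"
        if "x \<in> closed_triangle \<and> y \<in> closed_triangle \<and> x \<noteq> y" for x y
      proof -
        have "fund_char x \<noteq> fund_char y" using that fund_char_inj by metis
        then have "Re (fund_char x) \<noteq> Re (fund_char y) \<or> Im (fund_char x) \<noteq> Im (fund_char y)"
          using complex_eqI by blast
        moreover have "real_polynomial_function Re" "real_polynomial_function Im"
          by (auto intro: real_polynomial_function.intros(1) bounded_linear_Re bounded_linear_Im)
        ultimately show ?thesis by blast
      qed
    qed (use f e continuous_on_subset in auto)
    then obtain q where q: "real_polynomial_function q"
      and qf: "\<And>x. x \<in> closed_triangle \<Longrightarrow> \<bar>f x - q (fund_char x)\<bar> < e" by auto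
    have "(LINT x|tri_measure. of_real (u x * Re (weyl_denom x) * q (fund_char x))) =
        (LINT x|tri_measure. of_real (u x) * weyl_denom x * complex_of_real (q (fund_char x)))"
      by (rule Bochner_Integration.integral_cong) (auto simp: complex_eq_iff Im_weyl_denom)
    also have "\<dots> = 0" by (rule moments_vanish_imp_orthogonal_polynomial[OF ad m q])
    finally have q0: "(LINT x|tri_measure. u x * Re (weyl_denom x) * q (fund_char x)) = 0"
      unfolding integral_complex_of_real by simp
    have "(LINT x|tri_measure. u x * Re (weyl_denom x) * f x) =
        (LINT x|tri_measure. u x * Re (weyl_denom x) * f x - u x * Re (weyl_denom x) * q (fund_char x))"
      using q0 int[OF f] int[OF cq[OF q]] by simp
    also have "\<bar>\<dots>\<bar> \<le> (LINT x|tri_measure. \<bar>u x * Re (weyl_denom x) * f x - u x * Re (weyl_denom x) * q (fund_char x)\<bar>)"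
      by (rule integral_abs_bound)
    also have "\<dots> \<le> (LINT x|tri_measure. e * \<bar>u x * Re (weyl_denom x)\<bar>)"
    proof (rule integral_mono)
      show "integrable tri_measure (\<lambda>x. \<bar>u x * Re (weyl_denom x) * f x - u x * Re (weyl_denom x) * q (fund_char x)\<bar>)"
        using int[OF f] int[OF cq[OF q]] by simp
      show "integrable tri_measure (\<lambda>x. e * \<bar>u x * Re (weyl_denom x)\<bar>)" using iB by simp
      fix x assume "x \<in> space tri_measure"
      then have "x \<in> closed_triangle" using triangle_subset by (auto simp: space_tri_measure)
      then have "\<bar>f x - q (fund_char x)\<bar> \<le> e" using qf by fastforce
      then show "\<bar>u x * Re (weyl_denom x) * f x - u x * Re (weyl_denom x) * q (fund_char x)\<bar> \<le> e * \<bar>u x * Re (weyl_denom x)\<bar>"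
        by (simp add: mult_right_mono mult.commute[of e] flip: right_diff_distrib abs_mult)
           (simp add: abs_mult mult_left_mono)
    qed
    finally show ?thesis unfolding B_def by simp
  qed
  note bound = this
  show ?thesis
  proof (rule ccontr)
    assume "(LINT x|tri_measure. u x * Re (weyl_denom x) * f x) \<noteq> 0"
    then have p: "\<bar>LINT x|tri_measure. u x * Re (weyl_denom x) * f x\<bar> / (B + 1) > 0" (is "?I / _ > 0") using B by simp
    from bound[OF p] have "?I \<le> ?I * (B / (B + 1))" by simp
    moreover have "B / (B + 1) < 1" using B by simp
    ultimately have "?I \<le> 0"
      using p B by (smt (verit) mult_le_cancel_left1 zero_less_divide_iff)
    then show False using p B by (simp add: zero_less_divide_iff)
  qed
qed

text \<open>Orthogonality to a bump function supported where \<open>u\<close> has the sign of \<open>u x0\<close> is impossible,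
because the Weyl denominator is positive in the triangle.\<close>

lemma admissible_eq_0:
  assumes ad: "admissible u" and m: "\<And>a b. moment u a b = 0" and x0: "x0 \<in> equilateral_triangle"
  shows "u x0 = 0"
proof (rule ccontr)
  assume u0: "u x0 \<noteq> 0"
  let ?T = equilateral_triangle
  note uD = admissibleD[OF ad]
  have cw: "continuous_on UNIV weyl_denom" by (rule has_weak_laplacianD[OF has_weak_laplacian_weyl_denom])
  have "open (?T \<inter> (\<lambda>x. u x * u x0) -` {0<..})"
    using uD by (intro continuous_open_preimage continuous_intros open_triangle) auto
  moreover have "x0 \<in> ?T \<inter> (\<lambda>x. u x * u x0) -` {0<..}"
    using x0 u0 by (simp add: zero_less_mult_iff linorder_neq_iff disj_commute)
  ultimately obtain r where r: "r > 0" "ball x0 r \<subseteq> ?T \<inter> (\<lambda>x. u x * u x0) -` {0<..}"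
    using open_contains_ball by blast
  (* The factor u x0 makes the integrand nonnegative whatever the sign of u x0 is. *)
  define f where "f x = u x0 * max 0 (r - dist x0 x)" for x
  have cf: "continuous_on A f" for A unfolding f_def by (intro continuous_intros)
  let ?h = "\<lambda>x. u x * Re (weyl_denom x) * f x"
  have "(LINT x|tri_measure. ?h x) = 0" by (rule moments_vanish_imp_orthogonal_continuous[OF ad m cf])
  moreover have "integrable tri_measure ?h"
  proof -
    have "continuous_on UNIV (\<lambda>x. weyl_denom x * of_real (f x))" using cw cf by (intro continuous_intros)
    from integrable_Re[OF integrable_admissible_mult[OF ad this]] show ?thesis by (simp add: mult.assoc)
  qed
  moreover have "?h x \<ge> 0" if x: "x \<in> ?T" for x
  proof (cases "dist x0 x < r")
    case True
    then have "u x * u x0 > 0" using r(2) by (auto simp: subset_iff)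
    moreover have "?h x = (u x * u x0) * (Re (weyl_denom x) * max 0 (r - dist x0 x))" by (simp add: f_def)
    moreover have "0 \<le> Re (weyl_denom x) * max 0 (r - dist x0 x)" using weyl_denom_pos[OF x] by simp
    ultimately show ?thesis by (metis less_imp_le mult_nonneg_nonneg)
  qed (simp add: f_def)
  moreover have "continuous_on ?T ?h"
    using uD cw cf by (intro continuous_intros) (auto intro: continuous_on_subset)
  ultimately have "?h x0 = 0" using continuous_nonneg_integral_0[OF open_triangle] x0 by blast
  then show False using u0 r(1) weyl_denom_pos[OF x0] by (simp add: f_def)
qed

section \<open>The two lowest eigenvalues\<close>

text \<open>Eigenfunctions are normalized to vanish outside the domain, unlike the trigonometric
formulas.\<close>

definition on_triangle :: "(real^2 \<Rightarrow> real) \<Rightarrow> real^2 \<Rightarrow> real"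
  where "on_triangle f x = (if x \<in> equilateral_triangle then f x else 0)"

definition ground_state :: "real^2 \<Rightarrow> real"
  where "ground_state = on_triangle (\<lambda>x. Re (weyl_denom x))"
definition excited_Re :: "real^2 \<Rightarrow> real"
  where "excited_Re = on_triangle (\<lambda>x. Re (weyl_denom x) * Re (fund_char x))"
definition excited_Im :: "real^2 \<Rightarrow> real"
  where "excited_Im = on_triangle (\<lambda>x. Re (weyl_denom x) * Im (fund_char x))"

text \<open>If there are no lower terms in the Laplacian of \<open>\<phi> z\<^sup>a cnj(z)\<^sup>b\<close>, then real and imaginary
part satisfy the weak eigenvalue equation by Green's formula.\<close>

lemma on_triangle_eigenfunction:
  assumes L: "weyl_monomial_laplacian a b = (\<lambda>x. - of_real \<mu> * (weyl_denom x * monomial a b x))"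
    and f: "\<And>x. f x = Re (\<theta> * (weyl_denom x * monomial a b x))"
    and y: "y \<in> equilateral_triangle" "f y \<noteq> 0"
  shows "dirichlet_eigenfunction equilateral_triangle \<mu> (on_triangle f)" "admissible (on_triangle f)"
proof -
  let ?T = equilateral_triangle and ?u = "on_triangle f"
  let ?g = "re_grad (\<lambda>x v. \<theta> * (weyl_denom x * monomial_deriv a b x v + monomial a b x * weyl_denom_deriv x v))"
  have cf: "continuous_on UNIV f"
    unfolding f[abs_def] by (intro continuous_intros continuous_weyl_monomial)
  show ad: "admissible ?u"
    by (rule admissible_bounded_continuous[OF cf]) (simp add: on_triangle_def)
  have H: "H10 ?T ?u ?g"
    by (rule H10_cong[OF open_triangle _ weyl_monomial_cmult(1)[of \<theta> a b]]) (simp add: on_triangle_def f)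
  have "square_integrable_on (\<lambda>x. \<mu> * ?u x) ?T"
    using admissibleD[OF ad]
    unfolding square_integrable_on_iff[OF open_triangle] by (auto simp: power_mult_distrib)
  moreover have "(LINT x:?T|lborel. ?g x \<bullet> h x) = (LINT x:?T|lborel. \<mu> * ?u x * w x)" if "H10 ?T w h" for w h
  proof -
    have "(LINT x|tri_measure. ?g x \<bullet> h x) = - (LINT x|tri_measure. Re (\<theta> * weyl_monomial_laplacian a b x) * w x)"
      by (rule H10_weak_laplacian[OF open_triangle bounded_triangle that weyl_monomial_cmult(2)])
    also have "\<dots> = (LINT x|tri_measure. - (Re (\<theta> * weyl_monomial_laplacian a b x) * w x))" by simp
    also have "\<dots> = (LINT x|tri_measure. \<mu> * ?u x * w x)"
    proof (rule Bochner_Integration.integral_cong[OF refl])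
      fix x assume "x \<in> space tri_measure"
      then have "?u x = Re (\<theta> * (weyl_denom x * monomial a b x))"
        by (simp add: space_tri_measure on_triangle_def f)
      moreover have "\<theta> * weyl_monomial_laplacian a b x = of_real (- \<mu>) * (\<theta> * (weyl_denom x * monomial a b x))"
        unfolding L by (simp add: mult_ac)
      ultimately show "- (Re (\<theta> * weyl_monomial_laplacian a b x) * w x) = \<mu> * ?u x * w x"
        by (simp only: Re_of_real_mult mult_minus_left minus_minus)
    qed
    finally show ?thesis unfolding set_integral_dom_measure[OF open_triangle] .
  qed
  ultimately have "dirichlet_laplacian ?T ?u (\<lambda>x. \<mu> * ?u x)"
    unfolding dirichlet_laplacian_def using H by blast
  moreover have "continuous_on ?T ?u" by (rule admissibleD[OF ad])
  moreover have "?u y \<noteq> 0" "\<forall>x. x \<notin> ?T \<longrightarrow> ?u x = 0" using y by (auto simp: on_triangle_def)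
  ultimately show "dirichlet_eigenfunction ?T \<mu> ?u"
    unfolding dirichlet_eigenfunction_def by blast
qed

text \<open>These points witness that the real and the imaginary part of the character are not
identically zero on the triangle.\<close>

lemma triangle_points:
  obtains p q where "p \<in> equilateral_triangle" "Re (fund_char p) = 1"
    "q \<in> equilateral_triangle" "Im (fund_char q) \<noteq> 0"
proof
  define pt :: "real \<Rightarrow> real \<Rightarrow> real^2" where "pt s t = vector [s + t / 2, t * sqrt 3 / 2]" for s t
  have pt: "bary1 (pt s t) = s" "bary2 (pt s t) = t" for s t
    by (simp_all add: bary1_def bary2_def pt_def)
  show "pt (1/4) (1/4) \<in> equilateral_triangle" "pt (1/4) (1/2) \<in> equilateral_triangle"
    unfolding equilateral_triangle_eq by (simp_all add: bary0_def pt)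
  show "Re (fund_char (pt (1/4) (1/4))) = 1"
    unfolding Re_fund_char pt by (simp add: field_simps)
  have "Im (fund_char (pt (1/4) (1/2))) = sin (2 * pi / 3) + sin (pi / 6) + sin (- (5 * pi / 6))"
    unfolding fund_char_def plane_wave_def inner_weight_bary pt by (simp add: field_simps)
  also have "sin (- (5 * pi / 6)) = - sin (pi / 6)" using sin_pi_minus[of "pi/6"] by (simp add: field_simps)
  also have "sin (2 * pi / 3) = sqrt 3 / 2" using sin_pi_minus[of "pi/3"] by (simp add: field_simps sin_60)
  finally have "Im (fund_char (pt (1/4) (1/2))) = sqrt 3 / 2" by simp
  moreover have "sqrt 3 / 2 \<noteq> (0::real)" by simp
  ultimately show "Im (fund_char (pt (1/4) (1/2))) \<noteq> 0" by (simp only: not_False_eq_True)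
qed

lemma ground_state_eigenfunction:
  "dirichlet_eigenfunction equilateral_triangle (3 * eig_unit) ground_state" "admissible ground_state"
proof -
  obtain p where p: "p \<in> equilateral_triangle" using triangle_points by blast
  then have "Re (weyl_denom p) \<noteq> 0" using weyl_denom_pos by fastforce
  then show "dirichlet_eigenfunction equilateral_triangle (3 * eig_unit) ground_state" "admissible ground_state"
    unfolding ground_state_def using p
    by (auto intro!: on_triangle_eigenfunction[where a = 0 and b = 0 and \<theta> = 1 and y = p and \<mu> = "3 * eig_unit"]
        simp: weyl_monomial_laplacian_def[abs_def] monomial_def eig_coeff_def)
qed

lemma excited_eigenfunction:
  "dirichlet_eigenfunction equilateral_triangle (7 * eig_unit) excited_Re" "admissible excited_Re"
  "dirichlet_eigenfunction equilateral_triangle (7 * eig_unit) excited_Im" "admissible excited_Im"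
proof -
  obtain p q where p: "p \<in> equilateral_triangle" "Re (fund_char p) = 1"
    and q: "q \<in> equilateral_triangle" "Im (fund_char q) \<noteq> 0" using triangle_points by blast
  have n: "Re (weyl_denom p) * Re (fund_char p) \<noteq> 0" "Re (weyl_denom q) * Im (fund_char q) \<noteq> 0"
    using weyl_denom_pos[OF p(1)] weyl_denom_pos[OF q(1)] p q by auto
  have L: "weyl_monomial_laplacian 1 0 = (\<lambda>x. - of_real (7 * eig_unit) * (weyl_denom x * monomial 1 0 x))"
    by (simp add: fun_eq_iff weyl_monomial_laplacian_def monomial_def eig_coeff_def)
  show "dirichlet_eigenfunction equilateral_triangle (7 * eig_unit) excited_Re" "admissible excited_Re"
    unfolding excited_Re_def
    by (rule on_triangle_eigenfunction[OF L, where \<theta> = 1 and y = p];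
        (use p(1) n(1) in \<open>simp add: monomial_def Im_weyl_denom\<close>))+
  show "dirichlet_eigenfunction equilateral_triangle (7 * eig_unit) excited_Im" "admissible excited_Im"
    unfolding excited_Im_def
    by (rule on_triangle_eigenfunction[OF L, where \<theta> = "- \<i>" and y = q];
        (use q(1) n(2) in \<open>simp add: monomial_def Im_weyl_denom\<close>))+
qed

definition triangle_inner :: "(real^2 \<Rightarrow> real) \<Rightarrow> (real^2 \<Rightarrow> real) \<Rightarrow> real"
  where "triangle_inner u w = (LINT x|tri_measure. u x * w x)"

lemma integrable_triangle_inner:
  assumes "admissible u" "admissible w"
  shows "integrable tri_measure (\<lambda>x. u x * w x)"
  using integrable_inner_square_integrable[of u tri_measure w] admissibleD[OF assms(1)] admissibleD[OF assms(2)]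
  by simp

lemma triangle_inner_diff_scale:
  assumes "admissible u" "admissible w" "admissible z"
  shows "triangle_inner (\<lambda>x. u x - t * w x) z = triangle_inner u z - t * triangle_inner w z"
proof -
  have "triangle_inner (\<lambda>x. u x - t * w x) z = (LINT x|tri_measure. u x * z x - t * (w x * z x))"
    unfolding triangle_inner_def by (simp add: algebra_simps)
  also have "\<dots> = triangle_inner u z - t * triangle_inner w z"
    unfolding triangle_inner_def using integrable_triangle_inner[OF assms(1,3)] integrable_triangle_inner[OF assms(2,3)] by simp
  finally show ?thesis .
qed

lemma triangle_inner_commute: "triangle_inner u w = triangle_inner w u"
  by (simp add: triangle_inner_def mult.commute)

lemma triangle_inner_self_eq_0:
  assumes "admissible u" "triangle_inner u u = 0" "x \<in> equilateral_triangle"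
  shows "u x = 0"
proof -
  have "u x * u x = 0"
    by (rule continuous_nonneg_integral_0[OF open_triangle
          continuous_on_mult[OF admissibleD(1)[OF assms(1)] admissibleD(1)[OF assms(1)]]
          _ integrable_triangle_inner[OF assms(1,1)] _ assms(3)])
       (use assms(2) in \<open>simp_all add: triangle_inner_def\<close>)
  then show ?thesis by simp
qed

lemma moment_low:
  assumes u: "admissible u"
  shows "moment u 0 0 = of_real (triangle_inner u ground_state)"
    and "moment u 1 0 = Complex (triangle_inner u excited_Re) (triangle_inner u excited_Im)"
    and "moment u 0 1 = Complex (triangle_inner u excited_Re) (- triangle_inner u excited_Im)"
proof -
  have Re: "Re (moment u a b) = (LINT x|tri_measure. Re (of_real (u x) * (weyl_denom x * monomial a b x)))"
    and Im: "Im (moment u a b) = (LINT x|tri_measure. Im (of_real (u x) * (weyl_denom x * monomial a b x)))" for a b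
    unfolding moment_def
    by (rule integral_Re[OF integrable_admissible_mult[OF u continuous_weyl_monomial(1)], symmetric]
          integral_Im[OF integrable_admissible_mult[OF u continuous_weyl_monomial(1)], symmetric])+
  have 1: "(LINT x|tri_measure. u x * Re (weyl_denom x)) = triangle_inner u ground_state"
    "(LINT x|tri_measure. u x * (Re (weyl_denom x) * Re (fund_char x))) = triangle_inner u excited_Re"
    "(LINT x|tri_measure. u x * (Re (weyl_denom x) * Im (fund_char x))) = triangle_inner u excited_Im"
    unfolding triangle_inner_def ground_state_def excited_Re_def excited_Im_def
    by (auto intro!: Bochner_Integration.integral_cong simp: space_tri_measure on_triangle_def)
  show "moment u 0 0 = of_real (triangle_inner u ground_state)"
    "moment u 1 0 = Complex (triangle_inner u excited_Re) (triangle_inner u excited_Im)"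
    "moment u 0 1 = Complex (triangle_inner u excited_Re) (- triangle_inner u excited_Im)"
    by (simp_all add: complex_eq_iff Re Im monomial_def Im_weyl_denom 1)
qed

lemma eig_coeff_cases:
  assumes "eig_coeff a b \<le> 7"
  shows "a = 0 \<and> b = 0 \<or> a = 1 \<and> b = 0 \<or> a = 0 \<and> b = 1"
proof -
  have "a + b < 2" using assms unfolding eig_coeff_def by linarith
  then show ?thesis by linarith
qed

lemma eig_unit_pos: "eig_unit > 0"
  by (simp add: eig_unit_def)

lemma resonance:
  assumes "\<mu> \<le> 7 * eig_unit" "\<mu> = eig_unit * real (eig_coeff a b)"
  shows "a = 0 \<and> b = 0 \<and> \<mu> = 3 * eig_unit \<or> (a = 1 \<and> b = 0 \<or> a = 0 \<and> b = 1) \<and> \<mu> = 7 * eig_unit"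
proof -
  have "eig_unit * real (eig_coeff a b) \<le> eig_unit * 7" using assms by simp
  then have "eig_coeff a b \<le> 7" using eig_unit_pos by simp
  from eig_coeff_cases[OF this] show ?thesis using assms(2) by (auto simp: eig_coeff_def)
qed

lemma small_eigenvalues:
  assumes "is_dirichlet_eigenvalue equilateral_triangle \<mu>" "\<mu> \<le> 7 * eig_unit"
  shows "\<mu> = 3 * eig_unit \<or> \<mu> = 7 * eig_unit"
proof (rule ccontr)
  assume n: "\<not> ?thesis"
  obtain u where u: "dirichlet_eigenfunction equilateral_triangle \<mu> u"
    using assms(1) unfolding is_dirichlet_eigenvalue_def by blast
  have m: "has_eigenvalue_moments \<mu> u" by (rule eigenfunction_moments[OF u])
  have "moment u a b = 0" for a b
    by (rule nonresonant_moments_vanish[OF m]) (use resonance[OF assms(2)] n in blast)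
  then have "u x = 0" for x
    using admissible_eq_0[of u x] m u unfolding has_eigenvalue_moments_def dirichlet_eigenfunction_def by blast
  then show False using u unfolding dirichlet_eigenfunction_def by blast
qed

text \<open>After subtraction of the orthogonal projection to the ground state, the only resonant
moment vanishes as well.\<close>

lemma ground_space:
  assumes u: "dirichlet_eigenfunction equilateral_triangle (3 * eig_unit) u"
  shows "\<exists>t. u = (\<lambda>x. t * ground_state x)"
proof -
  note g = ground_state_eigenfunction
  have m: "has_eigenvalue_moments (3 * eig_unit) u" "has_eigenvalue_moments (3 * eig_unit) ground_state"
    using eigenfunction_moments u g(1) by auto
  then have ad: "admissible u" unfolding has_eigenvalue_moments_def by blast
  define t where "t = triangle_inner u ground_state / triangle_inner ground_state ground_state"
  define v where "v x = u x - t * ground_state x" for x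
  have mv: "has_eigenvalue_moments (3 * eig_unit) v"
    unfolding v_def[abs_def] by (rule has_eigenvalue_moments_diff_scale[OF m])
  then have adv: "admissible v" unfolding has_eigenvalue_moments_def by blast
  have "triangle_inner ground_state ground_state \<noteq> 0"
  proof
    assume 0: "triangle_inner ground_state ground_state = 0"
    then have "ground_state x = 0" for x
      using triangle_inner_self_eq_0[OF g(2) 0, of x] g(1) unfolding dirichlet_eigenfunction_def by blast
    then show False using g(1) unfolding dirichlet_eigenfunction_def by blast
  qed
  then have "triangle_inner v ground_state = 0"
    unfolding v_def[abs_def] triangle_inner_diff_scale[OF ad g(2) g(2)] by (simp add: t_def)
  then have m0: "moment v 0 0 = 0" by (simp add: moment_low[OF adv])
  have "moment v a b = 0" for a b
  proof (rule nonresonant_moments_vanish[OF mv])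
    fix a b assume e: "3 * eig_unit = eig_unit * real (eig_coeff a b)"
    have "3 * eig_unit \<le> 7 * eig_unit" "3 * eig_unit \<noteq> 7 * eig_unit" using eig_unit_pos by auto
    then show "moment v a b = 0" using resonance[OF _ e] m0 by blast
  qed
  then have "v x = 0" if "x \<in> equilateral_triangle" for x using admissible_eq_0[OF adv _ that] by blast
  then have "u x = t * ground_state x" for x
    using u unfolding v_def dirichlet_eigenfunction_def ground_state_def on_triangle_def
    by (cases "x \<in> equilateral_triangle") auto
  then show ?thesis by blast
qed

text \<open>Gram-Schmidt orthogonalization makes both resonant moments vanish. If the orthogonalized
function \<open>e\<close> is zero on the triangle, then its coefficient is \<open>0 / 0 = 0\<close>, and orthogonality to
\<open>e\<close> is trivial.\<close>

lemma excited_space: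
  assumes u: "dirichlet_eigenfunction equilateral_triangle (7 * eig_unit) u"
  shows "\<exists>s t. u = (\<lambda>x. s * excited_Re x + t * excited_Im x)"
proof -
  note g = excited_eigenfunction
  have m: "has_eigenvalue_moments (7 * eig_unit) u" "has_eigenvalue_moments (7 * eig_unit) excited_Re"
    "has_eigenvalue_moments (7 * eig_unit) excited_Im"
    using eigenfunction_moments u g(1,3) by auto
  then have ad: "admissible u" unfolding has_eigenvalue_moments_def by blast
  define c where "c = triangle_inner excited_Im excited_Re / triangle_inner excited_Re excited_Re"
  define e where "e x = excited_Im x - c * excited_Re x" for x
  define s where "s = triangle_inner u excited_Re / triangle_inner excited_Re excited_Re"
  define t where "t = triangle_inner u e / triangle_inner e e"
  define w where "w x = u x - s * excited_Re x" for x
  define v where "v x = w x - t * e x" for x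
  have me: "has_eigenvalue_moments (7 * eig_unit) e"
    unfolding e_def[abs_def] by (rule has_eigenvalue_moments_diff_scale[OF m(3,2)])
  have mw: "has_eigenvalue_moments (7 * eig_unit) w"
    unfolding w_def[abs_def] by (rule has_eigenvalue_moments_diff_scale[OF m(1,2)])
  have mv: "has_eigenvalue_moments (7 * eig_unit) v"
    unfolding v_def[abs_def] by (rule has_eigenvalue_moments_diff_scale[OF mw me])
  have ade: "admissible e" and adw: "admissible w" and adv: "admissible v"
    using me mw mv unfolding has_eigenvalue_moments_def by auto
  have n: "triangle_inner excited_Re excited_Re \<noteq> 0"
  proof
    assume 0: "triangle_inner excited_Re excited_Re = 0"
    then have "excited_Re x = 0" for x
      using triangle_inner_self_eq_0[OF g(2) 0, of x] g(1) unfolding dirichlet_eigenfunction_def by blast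
    then show False using g(1) unfolding dirichlet_eigenfunction_def by blast
  qed
  have eR: "triangle_inner e excited_Re = 0" and wR: "triangle_inner w excited_Re = 0"
    unfolding e_def[abs_def] w_def[abs_def] triangle_inner_diff_scale[OF g(4,2,2)] triangle_inner_diff_scale[OF ad g(2,2)]
    using n by (simp_all add: c_def s_def)
  have vR: "triangle_inner v excited_Re = 0"
    unfolding v_def[abs_def] triangle_inner_diff_scale[OF adw ade g(2)] by (simp add: eR wR)
  have ve: "triangle_inner v e = 0"
  proof (cases "triangle_inner e e = 0")
    case True
    have "triangle_inner v e = (LINT x|tri_measure. 0)"
      unfolding triangle_inner_def using triangle_inner_self_eq_0[OF ade True]
      by (intro Bochner_Integration.integral_cong) (auto simp: space_tri_measure)
    then show ?thesis by simp
  next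
    case False
    have "triangle_inner w e = triangle_inner u e"
      unfolding w_def[abs_def] triangle_inner_diff_scale[OF ad g(2) ade] using eR by (simp add: triangle_inner_commute)
    then show ?thesis
      unfolding v_def[abs_def] triangle_inner_diff_scale[OF adw ade ade] using False by (simp add: t_def)
  qed
  have "triangle_inner e v = triangle_inner excited_Im v - c * triangle_inner excited_Re v"
    unfolding e_def[abs_def] by (rule triangle_inner_diff_scale[OF g(4,2) adv])
  then have vI: "triangle_inner v excited_Im = 0" using ve vR by (simp add: triangle_inner_commute)
  have m1: "moment v 1 0 = 0" "moment v 0 1 = 0" by (simp_all only: moment_low[OF adv] vI vR) (simp_all add: complex_eq_iff)
  have "moment v a b = 0" for a b
  proof (rule nonresonant_moments_vanish[OF mv])
    fix a b assume e: "7 * eig_unit = eig_unit * real (eig_coeff a b)"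
    have "7 * eig_unit \<noteq> 3 * eig_unit" using eig_unit_pos by auto
    then show "moment v a b = 0" using resonance[OF order_refl e] m1 by blast
  qed
  then have "v x = 0" if "x \<in> equilateral_triangle" for x using admissible_eq_0[OF adv _ that] by blast
  then have "u x = (s - t * c) * excited_Re x + t * excited_Im x" for x
    using u unfolding v_def w_def e_def dirichlet_eigenfunction_def excited_Re_def excited_Im_def on_triangle_def
    by (cases "x \<in> equilateral_triangle") (auto simp: algebra_simps)
  then show ?thesis by blast
qed

lemma ground_multiplicity: "dirichlet_multiplicity equilateral_triangle (3 * eig_unit) = 1"
  unfolding dirichlet_multiplicity_def
proof (rule fun_space.dim_unique[where B = "{ground_state}"])
  let ?S = "{u. dirichlet_eigenfunction equilateral_triangle (3 * eig_unit) u}"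
  show "{ground_state} \<subseteq> insert 0 ?S" using ground_state_eigenfunction by simp
  show "insert 0 ?S \<subseteq> fun_space.span {ground_state}"
  proof
    fix u assume "u \<in> insert 0 ?S"
    then show "u \<in> fun_space.span {ground_state}"
    proof
      assume "u = 0" then show ?thesis by (simp add: fun_space.span_zero)
    next
      assume "u \<in> ?S"
      then obtain t where "u = (\<lambda>x. t * ground_state x)" using ground_space by blast
      then show ?thesis using fun_space.span_scale[OF fun_space.span_base[of ground_state "{ground_state}"]] by simp
    qed
  qed
  have "\<exists>x. ground_state x \<noteq> 0" using ground_state_eigenfunction(1) unfolding dirichlet_eigenfunction_def by blast
  then have "ground_state \<noteq> 0" by (auto simp: fun_eq_iff)
  then show "fun_space.independent {ground_state}" by (simp add: fun_space.dependent_single)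
qed simp

text \<open>A dimension is \<open>0\<close> in the infinite-dimensional case, so the lower bound \<open>1\<close> also expresses
that the eigenspace is finite-dimensional.\<close>

lemma excited_multiplicity: "dirichlet_multiplicity equilateral_triangle (7 * eig_unit) \<ge> 1"
proof -
  let ?S = "{u. dirichlet_eigenfunction equilateral_triangle (7 * eig_unit) u}"
  let ?W = "{excited_Re, excited_Im}"
  have sub: "insert 0 ?S \<subseteq> fun_space.span ?W"
  proof
    fix u assume "u \<in> insert 0 ?S"
    then show "u \<in> fun_space.span ?W"
    proof
      assume "u = 0" then show ?thesis by (simp add: fun_space.span_zero)
    next
      assume "u \<in> ?S"
      then obtain s t where u: "u = (\<lambda>x. s * excited_Re x + t * excited_Im x)" using excited_space by blast
      have "(\<lambda>x. s * excited_Re x) + (\<lambda>x. t * excited_Im x) \<in> fun_space.span ?W"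
        by (intro fun_space.span_add fun_space.span_scale fun_space.span_base) auto
      then show ?thesis unfolding u by (simp add: plus_fun_def)
    qed
  qed
  obtain B where B: "B \<subseteq> insert 0 ?S" "fun_space.independent B" "insert 0 ?S \<subseteq> fun_space.span B"
    "card B = fun_space.dim (insert 0 ?S)"
    using fun_space.basis_exists by blast
  have "finite B" using fun_space.independent_span_bound[of ?W B] B sub by auto
  moreover have "B \<noteq> {}"
  proof
    assume "B = {}"
    then have "excited_Re = 0" using B(3) excited_eigenfunction(1) by auto
    then show False using excited_eigenfunction(1) unfolding dirichlet_eigenfunction_def by simp
  qed
  ultimately have "card B \<ge> 1" by (simp add: Suc_le_eq card_gt_0_iff)
  then show ?thesis unfolding dirichlet_multiplicity_def using B(4) by simp
qed

text \<open>The eigenvalue \<open>3 c\<close> contributes exactly one entry to the list, so that the second entry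
is the next eigenvalue \<open>7 c\<close>.\<close>

lemma eigval_2: "dirichlet_eigval equilateral_triangle 2 = 7 * eig_unit"
  unfolding dirichlet_eigval_def
proof (rule Least_equality)
  let ?T = equilateral_triangle
  have ev: "is_dirichlet_eigenvalue ?T (3 * eig_unit)" "is_dirichlet_eigenvalue ?T (7 * eig_unit)"
    using ground_state_eigenfunction excited_eigenfunction unfolding is_dirichlet_eigenvalue_def by blast+
  have "{\<nu>. is_dirichlet_eigenvalue ?T \<nu> \<and> \<nu> \<le> 7 * eig_unit} = {3 * eig_unit, 7 * eig_unit}"
    using ev small_eigenvalues eig_unit_pos by auto
  moreover have "3 * eig_unit \<noteq> 7 * eig_unit" using eig_unit_pos by simp
  ultimately show "is_dirichlet_eigenvalue ?T (7 * eig_unit) \<and>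
      2 \<le> (\<Sum>\<nu> | is_dirichlet_eigenvalue ?T \<nu> \<and> \<nu> \<le> 7 * eig_unit. dirichlet_multiplicity ?T \<nu>)"
    using ev(2) ground_multiplicity excited_multiplicity by simp
  fix \<mu> assume mu: "is_dirichlet_eigenvalue ?T \<mu> \<and>
      2 \<le> (\<Sum>\<nu> | is_dirichlet_eigenvalue ?T \<nu> \<and> \<nu> \<le> \<mu>. dirichlet_multiplicity ?T \<nu>)"
  show "7 * eig_unit \<le> \<mu>"
  proof (rule ccontr)
    assume less: "\<not> 7 * eig_unit \<le> \<mu>"
    then have 3: "\<mu> = 3 * eig_unit" using mu small_eigenvalues[of \<mu>] by auto
    have "{\<nu>. is_dirichlet_eigenvalue ?T \<nu> \<and> \<nu> \<le> \<mu>} = {3 * eig_unit}"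
    proof (intro set_eqI iffI)
      fix \<nu> assume "\<nu> \<in> {\<nu>. is_dirichlet_eigenvalue ?T \<nu> \<and> \<nu> \<le> \<mu>}"
      then show "\<nu> \<in> {3 * eig_unit}" using less small_eigenvalues[of \<nu>] by auto
    qed (use ev 3 in auto)
    then show False using mu ground_multiplicity by simp
  qed
qed

section \<open>Failure of the Extended Courant Property\<close>

theorem proposition3p3:
  shows "\<not> dirichlet_ECP equilateral_triangle \<and>
    (\<exists>m\<ge>1. \<exists>v \<in> dirichlet_combinations equilateral_triangle
                     (dirichlet_eigval equilateral_triangle m).
      nodal_count equilateral_triangle v
        > enat (dirichlet_kappa equilateral_triangle (dirichlet_eigval equilateral_triangle m)))"
proof -
  let ?T = equilateral_triangle
  let ?S = "{u. \<exists>\<nu>\<le>7 * eig_unit. dirichlet_eigenfunction ?T \<nu> u}"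
  define v where "v = (\<lambda>x. 5/4 * ground_state x) + excited_Re"
  have "ground_state \<in> ?S" "excited_Re \<in> ?S"
    using ground_state_eigenfunction(1) excited_eigenfunction(1) eig_unit_pos
    by (auto intro: exI[of _ "3 * eig_unit"] exI[of _ "7 * eig_unit"])
  then have v: "v \<in> dirichlet_combinations ?T (dirichlet_eigval ?T 2)"
    unfolding dirichlet_combinations_def eigval_2 v_def
    by (intro fun_space.span_add fun_space.span_scale fun_space.span_base)
  have "v x = nodal_example x" if "x \<in> ?T" for x
    using that by (simp add: v_def ground_state_def excited_Re_def on_triangle_def nodal_example_def algebra_simps)
  then have n: "enat 3 \<le> nodal_count ?T v" by (rule nodal_count_example)
  have "dirichlet_kappa ?T (dirichlet_eigval ?T 2) \<le> 2"
    unfolding dirichlet_kappa_def by (rule Least_le) simp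
  then have "enat (dirichlet_kappa ?T (dirichlet_eigval ?T 2)) < enat 3" by simp
  then have gt: "enat (dirichlet_kappa ?T (dirichlet_eigval ?T 2)) < nodal_count ?T v"
    using n by (rule less_le_trans)
  moreover have "\<not> dirichlet_ECP ?T"
  proof
    assume "dirichlet_ECP ?T"
    then have "nodal_count ?T v \<le> enat (dirichlet_kappa ?T (dirichlet_eigval ?T 2))"
      using v unfolding dirichlet_ECP_def by (metis one_le_numeral)
    then show False using gt by (simp add: not_less[symmetric])
  qed
  ultimately show ?thesis using v by (intro conjI exI[of _ "2::nat"]) auto
qed

end
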